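(* Let $T_1,\dots,T_N\in\mathfrak G\cup\mathfrak B$ be a finite collection of good and bad maps with $\Sigma_G\neq\emptyset$ and $\Sigma_B\neq\emptyset$, let $\Sigma=\{1,\dots,N\}$, and let $\mathbf p=(p_j)_{j\in\Sigma}$ be a positive probability vector. Let $\mu_{\mathbf p}$ be the unique (up to scalar multiplication) $\sigma$-finite stationary measure for the associated random map $F$ that is absolutely continuous with respect to Lebesgue measure $\lambda$. Suppose $\theta=\sum_{b\in\Sigma_B}p_b\ell_b<1$. Then there exist $K>0$ and $\varkappa>0$ such that for any Borel set $A\subseteq[0,1]$ with $\lambda(A)\in(0,1)$ one has $$\mu_{\mathbf p}(A)\le K\,\frac{1}{\log^{\varkappa}(1/\lambda(A))}.$$
   Context: Fix $c\in(0,1)$. $D$ denotes the derivative (one-sided at $0$ and $1$). The Schwarzian derivative is $\mathbf ST=\frac{D^3T}{DT}-\frac32\big(\frac{D^2T}{DT}\big)^2$; $T$ has non-positive Schwarzian derivative on an interval if $DT\ne0$ and $\mathbf ST\le0$ there. The class $\mathfrak G$ of good maps consists of the maps $T_g:[0,1]\to[0,1]$ such that (G1) $T_g|_{(0,c)}$ and $T_g|_{(c,1)}$ are $C^3$ diffeomorphisms onto $(0,1)$ and $T_g(\{0,c,1\})\subseteq\{0,1\}$; (G2) $T_g$ has non-positive Schwarzian derivative on $[0,c)$ and $(c,1]$; (G3) there are associated constants $r_g\ge1$, $0<K_g<1$, $M_g>r_g$ with $K_g|x-c|^{r_g-1}\le|DT_g(x)|\le M_g|x-c|^{r_g-1}$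 for all $x\in[0,1]\setminus\{c\}$; (G4) $|DT_g(0)|,|DT_g(1)|>1$. The class $\mathfrak B$ of bad maps consists of the maps $T_b:[0,1]\to[0,1]$ such that (B1) $T_b|_{(0,c)}$ and $T_b|_{(c,1)}$ are $C^3$ diffeomorphisms, each onto $(0,c)$ or $(c,1)$, $T_b(\{0,1\})\subseteq\{0,1\}$ and $T_b(c)=c$; (B2) $T_b$ has non-positive Schwarzian derivative on $[0,c)$ and $(c,1]$; (B3) there are associated constants $\ell_b>1$, $0<K_b<1$, $M_b>\ell_b$ with $K_b|x-c|^{\ell_b-1}\le|DT_b(x)|\le M_b|x-c|^{\ell_b-1}$ for all $x\in[0,1]\setminus\{c\}$; (B4) $|DT_b(0)|,|DT_b(1)|>1$. For $T_1,\dots,T_N\in\mathfrak G\cup\mathfrak B$ put $\Sigma=\{1,\dots,N\}$, $\Sigma_G=\{j:T_j\in\mathfrak G\}$, $\Sigma_B=\{j:T_j\in\mathfrak B\}$. The random map (skew product) is $F:\Sigma^{\mathbb N}\times[0,1]\to\Sigma^{\mathbb N}\times[0,1]$, $F(\omega,x)=(\sigma\omega,T_{\omega_1}(x))$, with $\sigma$ the left shift. A Borel measure $\mu$ on $[0,1]$ is stationary for $F$ if $\sum_{j\in\Sigma}p_j\mu(T_j^{-1}A)=\mu(A)$ for all Borel $A\subseteq[0,1]$. A probability vector is positive if all its entries are positive. It is a fact (other theorems of the paper) that an absolutely continuous $\sigma$-finite stationary measure $\mu_{\mathbf p}$ exists, is unique up to scalar multiplication, and is finite when $\theta<1$. *)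

theory Defs
  imports "HOL-Analysis.Analysis"
begin

text \<open>
  All maps live on \<open>[0,1]\<close> and are represented by total functions on the reals whose
  values outside \<open>[0,1]\<close> are irrelevant. Derivatives are taken within \<open>[0,1]\<close>: this is the
  ordinary derivative at interior points and the one-sided derivative at \<open>0\<close> and \<open>1\<close>.
\<close>

definition deriv01 :: "(real \<Rightarrow> real) \<Rightarrow> real \<Rightarrow> real" where
  "deriv01 f x = vector_derivative f (at x within {0..1})"

definition thrice_differentiable_on :: "real set \<Rightarrow> (real \<Rightarrow> real) \<Rightarrow> bool" where
  "thrice_differentiable_on S f \<longleftrightarrow>
     (\<forall>k<3. \<forall>x\<in>S. ((deriv01 ^^ k) f) differentiable (at x within {0..1}))"

definition C3_on :: "real set \<Rightarrow> (real \<Rightarrow> real) \<Rightarrow> bool" where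
  "C3_on S f \<longleftrightarrow> thrice_differentiable_on S f \<and> continuous_on S ((deriv01 ^^ 3) f)"

text \<open>The inverse is given by \<open>inv_into\<close>, whose values off \<open>R\<close> are junk; harmless for open
  \<open>S, R \<subseteq> (0,1)\<close>, the only case used.\<close>

definition C3_diffeo :: "real set \<Rightarrow> real set \<Rightarrow> (real \<Rightarrow> real) \<Rightarrow> bool" where
  "C3_diffeo S R f \<longleftrightarrow> bij_betw f S R \<and> C3_on S f \<and> C3_on R (inv_into S f)"

definition schwarzian :: "(real \<Rightarrow> real) \<Rightarrow> real \<Rightarrow> real" where
  "schwarzian T x = (deriv01 ^^ 3) T x / deriv01 T x
     - 3 / 2 * ((deriv01 ^^ 2) T x / deriv01 T x)\<^sup>2"

text \<open>
  Differentiability is required explicitly because \<open>S\<close> will contain an endpoint of \<open>[0,1]\<close>,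
  where it does not follow from smoothness on the open branches.
\<close>

definition nonpos_schwarzian_on :: "real set \<Rightarrow> (real \<Rightarrow> real) \<Rightarrow> bool" where
  "nonpos_schwarzian_on S T \<longleftrightarrow> thrice_differentiable_on S T \<and>
     (\<forall>x\<in>S. deriv01 T x \<noteq> 0 \<and> schwarzian T x \<le> 0)"

definition deriv_bounds :: "real \<Rightarrow> (real \<Rightarrow> real) \<Rightarrow> real \<Rightarrow> real \<Rightarrow> real \<Rightarrow> bool" where
  "deriv_bounds c T r K M \<longleftrightarrow>
     (\<forall>x\<in>{0..1} - {c}. K * \<bar>x - c\<bar> powr (r - 1) \<le> \<bar>deriv01 T x\<bar> \<and>
                      \<bar>deriv01 T x\<bar> \<le> M * \<bar>x - c\<bar> powr (r - 1))"

definition good_maps :: "real \<Rightarrow> (real \<Rightarrow> real) set" where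
  "good_maps c = {T. T ` {0..1} \<subseteq> {0..1} \<and>
     C3_diffeo {0<..<c} {0<..<1} T \<and> C3_diffeo {c<..<1} {0<..<1} T \<and>
     T ` {0, c, 1} \<subseteq> {0, 1} \<and>
     nonpos_schwarzian_on {0..<c} T \<and> nonpos_schwarzian_on {c<..1} T \<and>
     (\<exists>r K M. 1 \<le> r \<and> 0 < K \<and> K < 1 \<and> r < M \<and> deriv_bounds c T r K M) \<and>
     \<bar>deriv01 T 0\<bar> > 1 \<and> \<bar>deriv01 T 1\<bar> > 1}"

text \<open>
  The exponent \<open>l\<close> associated with a bad map \<open>T\<close>. The two-sided bound near \<open>c\<close> determines it
  uniquely, so that \<open>\<theta>\<close> does not depend on a choice of constants.
\<close>

definition bad_exponent :: "real \<Rightarrow> (real \<Rightarrow> real) \<Rightarrow> real \<Rightarrow> bool" where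
  "bad_exponent c T l \<longleftrightarrow> 1 < l \<and>
     (\<exists>K M. 0 < K \<and> K < 1 \<and> l < M \<and> deriv_bounds c T l K M)"

definition bad_maps :: "real \<Rightarrow> (real \<Rightarrow> real) set" where
  "bad_maps c = {T. T ` {0..1} \<subseteq> {0..1} \<and>
     (\<exists>R \<in> {{0<..<c}, {c<..<1}}. C3_diffeo {0<..<c} R T) \<and>
     (\<exists>R \<in> {{0<..<c}, {c<..<1}}. C3_diffeo {c<..<1} R T) \<and>
     T ` {0, 1} \<subseteq> {0, 1} \<and> T c = c \<and>
     nonpos_schwarzian_on {0..<c} T \<and> nonpos_schwarzian_on {c<..1} T \<and>
     (\<exists>l. bad_exponent c T l) \<and>
     \<bar>deriv01 T 0\<bar> > 1 \<and> \<bar>deriv01 T 1\<bar> > 1}"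

definition Sigma_G :: "real \<Rightarrow> nat \<Rightarrow> (nat \<Rightarrow> real \<Rightarrow> real) \<Rightarrow> nat set" where
  "Sigma_G c N T = {j \<in> {1..N}. T j \<in> good_maps c}"

definition Sigma_B :: "real \<Rightarrow> nat \<Rightarrow> (nat \<Rightarrow> real \<Rightarrow> real) \<Rightarrow> nat set" where
  "Sigma_B c N T = {j \<in> {1..N}. T j \<in> bad_maps c}"

definition positive_prob_vector :: "nat \<Rightarrow> (nat \<Rightarrow> real) \<Rightarrow> bool" where
  "positive_prob_vector N p \<longleftrightarrow> (\<forall>j\<in>{1..N}. 0 < p j) \<and> (\<Sum>j=1..N. p j) = 1"

definition stationary ::
  "nat \<Rightarrow> (nat \<Rightarrow> real) \<Rightarrow> (nat \<Rightarrow> real \<Rightarrow> real) \<Rightarrow> real measure \<Rightarrow> bool" where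
  "stationary N p T \<mu> \<longleftrightarrow>
     sets \<mu> = sets (restrict_space borel {0..1}) \<and>
     (\<forall>A\<in>sets \<mu>. (\<Sum>j=1..N. ennreal (p j) * emeasure \<mu> (T j -` A \<inter> {0..1})) = emeasure \<mu> A)"

end

theory Submission
  imports Defs "HOL-Real_Asymp.Real_Asymp"
begin

text \<open>The measure in the theorem is only assumed sigma-finite, stationary and absolutely
  continuous. Its finiteness and its relation to any other stationary measure must therefore be
  derived: a density is constructed whose tails can be computed, and the given one is compared with
  it. Near \<open>c\<close> the two kinds of maps behave differently. A good branch covers (0,1), so
  what it contributes is a Koebe function across \<open>c\<close> and is bounded there. Only bad
  maps, which fix \<open>c\<close>, concentrate mass at \<open>c\<close>, and each of them
  multiplies -ln |x - c| by at most \<open>l j\<close>, up to an additive constant. Hence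
  \<open>theta\<close> < 1 enters twice: it makes the averaged logarithm at \<open>c\<close>
  contract in the Lyapunov estimate, and, being strict, it survives when the exponents
  \<open>l j\<close> are raised to a power slightly above 1, which is where \<kappa> > 1 comes from.
  One power is then lost at the endpoints, where mass leaves only geometrically and the
  contributions of all earlier times add up; the final exponent is \<kappa> - 1. Lower limits
  replace compactness. Inequalities between values of the means pass to them, Fatou bounds the mass,
  and preservation of mass by \<open>P\<close> turns the inequality for \<open>w\<close> into
  invariance.\<close>

text \<open>
  If \<open>\<rho>\<close> is the derivative of an inverse branch, nonpositive Schwarzian derivative makes
  \<open>\<rho>\<^bsup>-1/2\<^esup>\<close> concave, so that \<open>(x - a)\<^sup>2 \<rho>(x)\<close> increases and \<open>(b - x)\<^sup>2 \<rho>(x)\<close> decreases on the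
  range \<open>(a, b)\<close>. These two monotonicities define a cone of functions that is closed under sums
  and limits and preserved by the averaged transfer operator \<open>P\<close>, and they imply
  \<open>\<rho>(x) \<le> 4 mass / dist(x, {a, b})\<close>.

  Because \<open>\<theta> < 1\<close>, a Lyapunov function with logarithmic poles at \<open>0\<close>, \<open>c\<close> and \<open>1\<close> keeps a definite
  share of the mass of the Cesaro means of \<open>P\<^sup>k 1\<close> in a compact set. Their pointwise lower limit \<open>w\<close>
  satisfies \<open>P w \<le> w\<close> and has integral at most one, so it is a finite invariant density, positive
  off \<open>c\<close>. If \<open>h\<close> is the density of any stationary measure, the sets \<open>{h \<ge> s w}\<close> are backward
  invariant modulo null sets; a single good map has only trivial such sets, whence \<open>h \<le> s w\<close> for
  some \<open>s\<close>.

  It remains to bound the tails of \<open>w\<close>. With \<open>n(L)\<close> and \<open>m(L)\<close> the masses of the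
  \<open>exp(-L)\<close>-neighbourhoods of \<open>c\<close> and of \<open>{0, 1}\<close>, invariance gives
  \<open>n(L) \<le> const exp(-L) + \<Sum> p\<^sub>b n((L - C) / l\<^sub>b)\<close>, hence \<open>n(L) = O(L\<^bsup>-\<kappa>\<^esup>)\<close> for some \<open>\<kappa> > 1\<close>, and
  \<open>m(L) \<le> n((L - C) / r) + m(L + \<alpha>)\<close>, hence \<open>m(L) = O(L\<^bsup>1-\<kappa>\<^esup>)\<close>.
\<close>

section \<open>Koebe functions and branches\<close>

text \<open>Nonnegativity is part of the cone, and \<open>y = x\<close> extracts it at a single
  point. Values off the open interval are unconstrained, so a density may be unbounded or undefined
  in meaning at the ends of its range.\<close>

definition koebe :: "real \<Rightarrow> real \<Rightarrow> (real \<Rightarrow> real) \<Rightarrow> bool" where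
  "koebe a b f \<longleftrightarrow> (\<forall>x y. a < x \<and> x \<le> y \<and> y < b \<longrightarrow>
     0 \<le> f x \<and> (x - a)\<^sup>2 * f x \<le> (y - a)\<^sup>2 * f y \<and> (b - y)\<^sup>2 * f y \<le> (b - x)\<^sup>2 * f x)"

lemma koebeD:
  assumes "koebe a b f" "a < x" "x \<le> y" "y < b"
  shows "0 \<le> f x" "(x - a)\<^sup>2 * f x \<le> (y - a)\<^sup>2 * f y" "(b - y)\<^sup>2 * f y \<le> (b - x)\<^sup>2 * f x"
  using assms unfolding koebe_def by blast+

lemma koebe_nonneg: "koebe a b f \<Longrightarrow> x \<in> {a<..<b} \<Longrightarrow> 0 \<le> f x"
  using koebeD(1)[of a b f x x] by simp

lemma koebe_cong:
  assumes "koebe a b f" "\<And>x. x \<in> {a<..<b} \<Longrightarrow> f x = g x"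
  shows "koebe a b g"
  unfolding koebe_def
proof (intro allI impI)
  fix x y assume xy: "a < x \<and> x \<le> y \<and> y < b"
  then have "f x = g x" "f y = g y" using assms(2) by auto
  then show "0 \<le> g x \<and> (x - a)\<^sup>2 * g x \<le> (y - a)\<^sup>2 * g y \<and> (b - y)\<^sup>2 * g y \<le> (b - x)\<^sup>2 * g x"
    using koebeD[OF assms(1)] xy by metis
qed

lemma koebe_const:
  assumes "0 \<le> k" shows "koebe a b (\<lambda>_. k)"
  unfolding koebe_def using assms by (auto intro!: mult_right_mono power_mono)

lemma koebe_add:
  assumes "koebe a b f" "koebe a b g" shows "koebe a b (\<lambda>x. f x + g x)"
  unfolding koebe_def
proof (intro allI impI)
  fix x y assume xy: "a < x \<and> x \<le> y \<and> y < b"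
  show "0 \<le> f x + g x \<and> (x - a)\<^sup>2 * (f x + g x) \<le> (y - a)\<^sup>2 * (f y + g y)
      \<and> (b - y)\<^sup>2 * (f y + g y) \<le> (b - x)\<^sup>2 * (f x + g x)"
    using koebeD[OF assms(1), of x y] koebeD[OF assms(2), of x y] xy
    by (simp add: distrib_left add_mono)
qed

lemma koebe_scale:
  assumes "koebe a b f" "0 \<le> k" shows "koebe a b (\<lambda>x. k * f x)"
  unfolding koebe_def
proof (intro allI impI)
  fix x y assume xy: "a < x \<and> x \<le> y \<and> y < b"
  note d = koebeD[OF assms(1), of x y]
  have "k * ((x - a)\<^sup>2 * f x) \<le> k * ((y - a)\<^sup>2 * f y)" "k * ((b - y)\<^sup>2 * f y) \<le> k * ((b - x)\<^sup>2 * f x)"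
    using d xy assms(2) by (auto intro!: mult_left_mono)
  then show "0 \<le> k * f x \<and> (x - a)\<^sup>2 * (k * f x) \<le> (y - a)\<^sup>2 * (k * f y)
      \<and> (b - y)\<^sup>2 * (k * f y) \<le> (b - x)\<^sup>2 * (k * f x)"
    using d xy assms(2) by (simp add: mult.left_commute)
qed

lemma koebe_sum:
  assumes "\<And>i. i \<in> I \<Longrightarrow> koebe a b (f i)"
  shows "koebe a b (\<lambda>x. \<Sum>i\<in>I. f i x)"
  using assms
proof (induction I rule: infinite_finite_induct)
  case (insert i I)
  then show ?case using koebe_add[of a b "f i" "\<lambda>x. \<Sum>i\<in>I. f i x"] by simp
qed (auto intro: koebe_const)

text \<open>For a <= a' the quotient (x - a') / (x - a) is nonnegative and increasing on the smaller
  interval, so multiplying by its square preserves monotonicity; likewise at the right end.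
  \<open>q1\<close> and \<open>q2\<close> are these facts cross-multiplied.\<close>

lemma koebe_subinterval:
  assumes f: "koebe a b f" and "a \<le> a'" "b' \<le> b"
  shows "koebe a' b' f"
  unfolding koebe_def
proof (intro allI impI)
  fix x y assume xy: "a' < x \<and> x \<le> y \<and> y < b'"
  note d = koebeD[OF f, of x y]
  have fy: "0 \<le> f y" using koebeD(1)[OF f, of y y] xy assms by simp
  have q1: "(x - a') * (y - a) \<le> (y - a') * (x - a)"
    using mult_right_mono[of x y "a' - a"] xy assms by (simp add: algebra_simps)
  have q2: "(b' - y) * (b - x) \<le> (b' - x) * (b - y)"
    using mult_right_mono[of x y "b - b'"] xy assms by (simp add: algebra_simps)
  have "((x - a') * (y - a))\<^sup>2 * ((x - a)\<^sup>2 * f x) \<le> ((y - a') * (x - a))\<^sup>2 * ((y - a)\<^sup>2 * f y)"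
    by (rule mult_mono[OF power_mono]) (use q1 d xy assms fy in auto)
  then have "((x - a)\<^sup>2 * (y - a)\<^sup>2) * ((x - a')\<^sup>2 * f x) \<le> ((x - a)\<^sup>2 * (y - a)\<^sup>2) * ((y - a')\<^sup>2 * f y)"
    by (simp add: power_mult_distrib mult_ac)
  then have 1: "(x - a')\<^sup>2 * f x \<le> (y - a')\<^sup>2 * f y"
    by (rule mult_left_le_imp_le) (use xy assms in auto)
  have "((b' - y) * (b - x))\<^sup>2 * ((b - y)\<^sup>2 * f y) \<le> ((b' - x) * (b - y))\<^sup>2 * ((b - x)\<^sup>2 * f x)"
    by (rule mult_mono[OF power_mono]) (use q2 d xy assms fy in auto)
  then have "((b - x)\<^sup>2 * (b - y)\<^sup>2) * ((b' - y)\<^sup>2 * f y) \<le> ((b - x)\<^sup>2 * (b - y)\<^sup>2) * ((b' - x)\<^sup>2 * f x)"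
    by (simp add: power_mult_distrib mult_ac)
  then have 2: "(b' - y)\<^sup>2 * f y \<le> (b' - x)\<^sup>2 * f x"
    by (rule mult_left_le_imp_le) (use xy assms in auto)
  show "0 \<le> f x \<and> (x - a')\<^sup>2 * f x \<le> (y - a')\<^sup>2 * f y \<and> (b' - y)\<^sup>2 * f y \<le> (b' - x)\<^sup>2 * f x"
    using 1 2 d xy assms by auto
qed

text \<open>Multiplied by (x - a)^2 the function is monotone, hence Borel, and the factor can be
  divided out again.\<close>

lemma koebe_measurable:
  assumes f: "koebe a b f"
  shows "(\<lambda>x. indicator {a<..<b} x * f x) \<in> borel_measurable borel"
proof -
  have "mono_on {a<..<b} (\<lambda>x. (x - a)\<^sup>2 * f x)"
    using f by (auto simp: mono_on_def intro: koebeD)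
  then have "(\<lambda>x. (x - a)\<^sup>2 * f x) \<in> borel_measurable (restrict_space borel {a<..<b})"
    by (rule borel_measurable_mono_on_fnc)
  then have "(\<lambda>x. (x - a)\<^sup>2 * f x / (x - a)\<^sup>2) \<in> borel_measurable (restrict_space borel {a<..<b})"
    by (rule borel_measurable_divide[OF _ measurable_restrict_space1]) auto
  moreover have "(x - a)\<^sup>2 * f x / (x - a)\<^sup>2 = f x" if "x \<in> space (restrict_space borel {a<..<b})" for x
    using that by (simp add: space_restrict_space)
  ultimately have "f \<in> borel_measurable (restrict_space borel {a<..<b})"
    by (subst measurable_cong[of _ _ "\<lambda>x. (x - a)\<^sup>2 * f x / (x - a)\<^sup>2"]) auto
  then show ?thesis
    by (subst (asm) borel_measurable_restrict_space_iff) (auto simp: mult.commute)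
qed

text \<open>A Harnack inequality between a point \<open>x\<close> at depth \<delta> and an arbitrary
  point \<open>y\<close>. Depending on the order of the two points one of the monotonicities
  applies; on the larger side its squared factor is at most 1 because the interval has length at
  most 1.\<close>

lemma koebe_compare:
  assumes f: "koebe a b f" and "0 < \<delta>" "b - a \<le> 1"
    and x: "a + \<delta> \<le> x" "x \<le> b - \<delta>" and y: "a < y" "y < b"
  shows "\<delta>\<^sup>2 * f y * (min (y - a) (b - y))\<^sup>2 \<le> f x" "\<delta>\<^sup>2 * f x * (min (y - a) (b - y))\<^sup>2 \<le> f y"
proof -
  have fx: "0 \<le> f x" and fy: "0 \<le> f y" using koebe_nonneg[OF f] assms by auto
  have gen: "s * f u * t \<le> f v" if "p * f u \<le> q * f v" "0 < q" "q \<le> 1" "0 \<le> f v" "0 \<le> f u" "s * t \<le> p" 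
    for p q s t u v :: real
  proof -
    have "s * f u * t = (s * t) * f u" by simp
    also have "\<dots> \<le> p * f u" using that by (intro mult_right_mono) auto
    also have "\<dots> \<le> q * f v" by fact
    also have "\<dots> \<le> 1 * f v" using that by (intro mult_right_mono) auto
    finally show ?thesis by simp
  qed
  have pw: "s\<^sup>2 \<le> 1" if "0 \<le> s" "s \<le> 1" for s :: real using that by (simp add: power_le_one)
  have pr: "s\<^sup>2 * (min (y - a) (b - y))\<^sup>2 \<le> t\<^sup>2" if "0 \<le> s" "s * min (y - a) (b - y) \<le> t" for s t :: real
    using power_mono[of "s * min (y - a) (b - y)" t 2] that y by (simp add: power_mult_distrib)
  have d: "\<delta> * min (y - a) (b - y) \<le> t" if "\<delta> \<le> t \<or> y - a \<le> t \<or> b - y \<le> t" for t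
  proof -
    have "\<delta> \<le> 1" using assms by linarith
    then have "\<delta> * min (y - a) (b - y) \<le> \<delta> * 1"
      using assms y by (intro mult_left_mono) auto
    moreover have "\<delta> * min (y - a) (b - y) \<le> 1 * min (y - a) (b - y)"
      using \<open>\<delta> \<le> 1\<close> y by (intro mult_right_mono) auto
    ultimately have "\<delta> * min (y - a) (b - y) \<le> \<delta>" "\<delta> * min (y - a) (b - y) \<le> min (y - a) (b - y)" by simp_all
    then show ?thesis using that by auto
  qed
  show "\<delta>\<^sup>2 * f y * (min (y - a) (b - y))\<^sup>2 \<le> f x"
  proof (cases "x \<le> y")
    case True
    show ?thesis
      by (rule gen[of "(b - y)\<^sup>2" _ "(b - x)\<^sup>2"])
        (use koebeD(3)[OF f, of x y] True assms fx fy in \<open>auto intro!: pw pr d\<close>)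
  next
    case False
    show ?thesis
      by (rule gen[of "(y - a)\<^sup>2" _ "(x - a)\<^sup>2"])
        (use koebeD(2)[OF f, of y x] False assms fx fy in \<open>auto intro!: pw pr d\<close>)
  qed
  show "\<delta>\<^sup>2 * f x * (min (y - a) (b - y))\<^sup>2 \<le> f y"
  proof (cases "x \<le> y")
    case True
    show ?thesis
      by (rule gen[of "(x - a)\<^sup>2" _ "(y - a)\<^sup>2"])
        (use koebeD(2)[OF f, of x y] True assms fx fy in \<open>auto intro!: pw pr d\<close>)
  next
    case False
    show ?thesis
      by (rule gen[of "(b - x)\<^sup>2" _ "(b - y)\<^sup>2"])
        (use koebeD(3)[OF f, of y x] False assms fx fy in \<open>auto intro!: pw pr d\<close>)
  qed
qed

text \<open>Moving from \<open>x\<close> away from the nearer end by \<open>d\<close> at most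
  doubles the distance to that end, so the function stays above a quarter of its value at
  \<open>x\<close>. The mass over that stretch is at most 1.\<close>

lemma koebe_bound:
  assumes f: "koebe a b f" and mass: "(\<integral>\<^sup>+x. indicator {a<..<b} x * ennreal (f x) \<partial>lborel) \<le> 1"
    and x: "a < x" "x < b"
  shows "f x * min (x - a) (b - x) \<le> 4"
proof -
  define d where "d = min (x - a) (b - x)"
  have d: "0 < d" "d \<le> x - a" "d \<le> b - x" using x by (auto simp: d_def)
  define I where "I = (if x - a \<le> b - x then {x..<x + d} else {x - d<..x})"
  have I: "I \<in> sets lborel" "emeasure lborel I = ennreal d" "I \<subseteq> {a<..<b}"
    using d by (auto simp: I_def)
  have fy: "f x / 4 \<le> f y" if y: "y \<in> I" for y
  proof (cases "x - a \<le> b - x")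
    case True
    then have "x \<le> y" "y < b" "y - a \<le> 2 * (x - a)" using y I d by (auto simp: I_def)
    then have "0 \<le> f y" "(x - a)\<^sup>2 * f x \<le> (y - a)\<^sup>2 * f y" "(y - a)\<^sup>2 \<le> (2 * (x - a))\<^sup>2"
      using koebeD(2)[OF f x(1), of y] koebe_nonneg[OF f, of y] x by (auto intro!: power_mono)
    then have "(x - a)\<^sup>2 * f x \<le> (2 * (x - a))\<^sup>2 * f y"
      using mult_right_mono order_trans by blast
    then have "(x - a)\<^sup>2 * f x \<le> (x - a)\<^sup>2 * (4 * f y)"
      unfolding power_mult_distrib by simp
    then show ?thesis using x by simp
  next
    case False
    then have "y \<le> x" "a < y" "b - y \<le> 2 * (b - x)" using y I d by (auto simp: I_def)
    then have "0 \<le> f y" "(b - x)\<^sup>2 * f x \<le> (b - y)\<^sup>2 * f y" "(b - y)\<^sup>2 \<le> (2 * (b - x))\<^sup>2"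
      using koebeD(3)[OF f _ _ x(2), of y] koebe_nonneg[OF f, of y] x by (auto intro!: power_mono)
    then have "(b - x)\<^sup>2 * f x \<le> (2 * (b - x))\<^sup>2 * f y"
      using mult_right_mono order_trans by blast
    then have "(b - x)\<^sup>2 * f x \<le> (b - x)\<^sup>2 * (4 * f y)"
      unfolding power_mult_distrib by simp
    then show ?thesis using x by simp
  qed
  have fx: "0 \<le> f x" using koebe_nonneg[OF f] x by auto
  have "ennreal (f x / 4 * d) = ennreal (f x / 4) * emeasure lborel I"
    using d fx by (simp add: I ennreal_mult[symmetric])
  also have "\<dots> = (\<integral>\<^sup>+y. ennreal (f x / 4) * indicator I y \<partial>lborel)"
    using I by (simp add: nn_integral_cmult_indicator)
  also have "\<dots> \<le> (\<integral>\<^sup>+x. indicator {a<..<b} x * ennreal (f x) \<partial>lborel)"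
    using I fy by (intro nn_integral_mono) (auto split: split_indicator intro!: ennreal_leI)
  also have "\<dots> \<le> 1" by fact
  finally have "f x / 4 * d \<le> 1" by (simp add: ennreal_le_1)
  then show ?thesis by (simp add: d_def)
qed

section \<open>Transfer operator of a single monotone branch\<close>

definition push :: "real \<Rightarrow> real \<Rightarrow> (real \<Rightarrow> real) \<Rightarrow> (real \<Rightarrow> real) \<Rightarrow> real \<Rightarrow> real" where
  "push a b T f x = (if x \<in> T ` {a<..<b}
     then f (inv_into {a<..<b} T x) / \<bar>deriv T (inv_into {a<..<b} T x)\<bar> else 0)"

text \<open>The two alternatives are an increasing and a decreasing branch. The quotients are the
  multipliers that carry (distance to an end)^2 times a density on the domain to the same expression
  for its image on the range; a decreasing branch sends \<open>a\<close> to \<open>B\<close> and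
  \<open>b\<close> to \<open>A\<close>. Asking for their monotonicity pairwise is the form in which
  they multiply with the Koebe inequalities.\<close>

definition koebe_branch :: "real \<Rightarrow> real \<Rightarrow> real \<Rightarrow> real \<Rightarrow> (real \<Rightarrow> real) \<Rightarrow> bool" where
  "koebe_branch a b A B T \<longleftrightarrow> T ` {a<..<b} = {A<..<B} \<and>
     (\<forall>x\<in>{a<..<b}. T field_differentiable at x \<and> deriv T x \<noteq> 0) \<and>
     ((\<forall>x y. a < x \<and> x < y \<and> y < b \<longrightarrow> T x < T y \<and>
          (T x - A)\<^sup>2 / (\<bar>deriv T x\<bar> * (x - a)\<^sup>2) \<le> (T y - A)\<^sup>2 / (\<bar>deriv T y\<bar> * (y - a)\<^sup>2) \<and>
          (B - T y)\<^sup>2 / (\<bar>deriv T y\<bar> * (b - y)\<^sup>2) \<le> (B - T x)\<^sup>2 / (\<bar>deriv T x\<bar> * (b - x)\<^sup>2)) \<or>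
      (\<forall>x y. a < x \<and> x < y \<and> y < b \<longrightarrow> T y < T x \<and>
          (B - T x)\<^sup>2 / (\<bar>deriv T x\<bar> * (x - a)\<^sup>2) \<le> (B - T y)\<^sup>2 / (\<bar>deriv T y\<bar> * (y - a)\<^sup>2) \<and>
          (T y - A)\<^sup>2 / (\<bar>deriv T y\<bar> * (b - y)\<^sup>2) \<le> (T x - A)\<^sup>2 / (\<bar>deriv T x\<bar> * (b - x)\<^sup>2)))"

lemma koebe_branch_image: "koebe_branch a b A B T \<Longrightarrow> T ` {a<..<b} = {A<..<B}"
  by (simp add: koebe_branch_def)

lemma koebe_branch_deriv:
  assumes "koebe_branch a b A B T" "x \<in> {a<..<b}"
  shows "(T has_real_derivative deriv T x) (at x)" "deriv T x \<noteq> 0"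
  using assms unfolding koebe_branch_def by (auto simp: DERIV_deriv_iff_field_differentiable)

lemma koebe_branch_inj:
  assumes "koebe_branch a b A B T" shows "inj_on T {a<..<b}"
proof (rule inj_onI)
  fix x y assume xy: "x \<in> {a<..<b}" "y \<in> {a<..<b}" "T x = T y"
  have "T x \<noteq> T y" if "x < y" "a < x" "y < b" for x y
    using assms that unfolding koebe_branch_def by (metis less_irrefl)
  then show "x = y" using xy by (metis greaterThanLessThan_iff linorder_neqE)
qed

lemma push_image:
  assumes "inj_on T {a<..<b}" "x \<in> {a<..<b}"
  shows "push a b T f (T x) = f x / \<bar>deriv T x\<bar>"
  using assms by (auto simp: push_def)

lemma push_outside: "x \<notin> T ` {a<..<b} \<Longrightarrow> push a b T f x = 0"
  by (simp add: push_def)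

lemma push_nonneg: assumes "koebe a b f" shows "0 \<le> push a b T f x"
proof (cases "x \<in> T ` {a<..<b}")
  case True
  then have "0 \<le> f (inv_into {a<..<b} T x)" by (intro koebe_nonneg[OF assms] inv_into_into)
  then show ?thesis by (simp add: push_def)
qed (simp add: push_def)

text \<open>At u = T x the weighted image density factors as the multiplier from
  \<open>koebe_branch\<close> times the weighted density at \<open>x\<close>. Both factors are
  nonnegative and monotone in the same direction along the branch.\<close>

lemma push_koebe:
  assumes T: "koebe_branch a b A B T" and f: "koebe a b f"
  shows "koebe A B (push a b T f)"
  unfolding koebe_def
proof (intro allI impI)
  fix u v assume uv: "A < u \<and> u \<le> v \<and> v < B"
  then have "u \<in> T ` {a<..<b}" "v \<in> T ` {a<..<b}" using koebe_branch_image[OF T] by auto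
  then obtain x y where x: "x \<in> {a<..<b}" "u = T x" and y: "y \<in> {a<..<b}" "v = T y" by auto
  note inj = koebe_branch_inj[OF T]
  have dx: "\<bar>deriv T x\<bar> > 0" and dy: "\<bar>deriv T y\<bar> > 0" using koebe_branch_deriv[OF T] x y by auto
  have fx: "0 \<le> f x" and fy: "0 \<le> f y" using koebe_nonneg[OF f] x y by auto
  note px = push_image[OF inj x(1), of f] and py = push_image[OF inj y(1), of f]
  have comb: "s * (f x / \<bar>deriv T x\<bar>) \<le> t * (f y / \<bar>deriv T y\<bar>)"
    if "s / (\<bar>deriv T x\<bar> * p) \<le> t / (\<bar>deriv T y\<bar> * q)" "p * f x \<le> q * f y" "0 \<le> t" "0 < p" "0 < q" for s t p q
  proof -
    have "(s / (\<bar>deriv T x\<bar> * p)) * (p * f x) \<le> (t / (\<bar>deriv T y\<bar> * q)) * (q * f y)"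
      by (rule mult_mono) (use that dx dy fx in auto)
    then show ?thesis using that by (simp add: field_simps)
  qed
  have comb': "s * (f y / \<bar>deriv T y\<bar>) \<le> t * (f x / \<bar>deriv T x\<bar>)"
    if "s / (\<bar>deriv T y\<bar> * p) \<le> t / (\<bar>deriv T x\<bar> * q)" "p * f y \<le> q * f x" "0 \<le> t" "0 < p" "0 < q" for s t p q
  proof -
    have "(s / (\<bar>deriv T y\<bar> * p)) * (p * f y) \<le> (t / (\<bar>deriv T x\<bar> * q)) * (q * f x)"
      by (rule mult_mono) (use that dx dy fy in auto)
    then show ?thesis using that by (simp add: field_simps)
  qed
  have "0 \<le> push a b T f u" using px fx x by simp
  moreover have "(u - A)\<^sup>2 * push a b T f u \<le> (v - A)\<^sup>2 * push a b T f v \<and>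
      (B - v)\<^sup>2 * push a b T f v \<le> (B - u)\<^sup>2 * push a b T f u"
  proof (cases "u = v")
    case False
    then have uv': "T x < T y" using uv x y by simp
    consider (inc) "\<forall>x y. a < x \<and> x < y \<and> y < b \<longrightarrow> T x < T y \<and>
          (T x - A)\<^sup>2 / (\<bar>deriv T x\<bar> * (x - a)\<^sup>2) \<le> (T y - A)\<^sup>2 / (\<bar>deriv T y\<bar> * (y - a)\<^sup>2) \<and>
          (B - T y)\<^sup>2 / (\<bar>deriv T y\<bar> * (b - y)\<^sup>2) \<le> (B - T x)\<^sup>2 / (\<bar>deriv T x\<bar> * (b - x)\<^sup>2)"
      | (dec) "\<forall>x y. a < x \<and> x < y \<and> y < b \<longrightarrow> T y < T x \<and>
          (B - T x)\<^sup>2 / (\<bar>deriv T x\<bar> * (x - a)\<^sup>2) \<le> (B - T y)\<^sup>2 / (\<bar>deriv T y\<bar> * (y - a)\<^sup>2) \<and>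
          (T y - A)\<^sup>2 / (\<bar>deriv T y\<bar> * (b - y)\<^sup>2) \<le> (T x - A)\<^sup>2 / (\<bar>deriv T x\<bar> * (b - x)\<^sup>2)"
      using T unfolding koebe_branch_def by auto
    then show ?thesis
    proof cases
      case inc
      then have xy: "x < y" using uv' x y
        by (metis greaterThanLessThan_iff linorder_neqE order_less_asym)
      with inc x y have "(T x - A)\<^sup>2 / (\<bar>deriv T x\<bar> * (x - a)\<^sup>2) \<le> (T y - A)\<^sup>2 / (\<bar>deriv T y\<bar> * (y - a)\<^sup>2)"
        "(B - T y)\<^sup>2 / (\<bar>deriv T y\<bar> * (b - y)\<^sup>2) \<le> (B - T x)\<^sup>2 / (\<bar>deriv T x\<bar> * (b - x)\<^sup>2)" by auto
      then show ?thesis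
        using comb[of "(T x - A)\<^sup>2" "(x - a)\<^sup>2" "(T y - A)\<^sup>2" "(y - a)\<^sup>2"] 
          comb'[of "(B - T y)\<^sup>2" "(b - y)\<^sup>2" "(B - T x)\<^sup>2" "(b - x)\<^sup>2"]
          koebeD[OF f, of x y] xy x y px py by simp
    next
      case dec
      then have xy: "y < x" using uv' x y
        by (metis greaterThanLessThan_iff linorder_neqE order_less_asym)
      with dec x y have "(B - T y)\<^sup>2 / (\<bar>deriv T y\<bar> * (y - a)\<^sup>2) \<le> (B - T x)\<^sup>2 / (\<bar>deriv T x\<bar> * (x - a)\<^sup>2)"
        "(T x - A)\<^sup>2 / (\<bar>deriv T x\<bar> * (b - x)\<^sup>2) \<le> (T y - A)\<^sup>2 / (\<bar>deriv T y\<bar> * (b - y)\<^sup>2)" by auto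
      then show ?thesis
        using comb[of "(T x - A)\<^sup>2" "(b - x)\<^sup>2" "(T y - A)\<^sup>2" "(b - y)\<^sup>2"] 
          comb'[of "(B - T y)\<^sup>2" "(y - a)\<^sup>2" "(B - T x)\<^sup>2" "(x - a)\<^sup>2"]
          koebeD[OF f, of y x] xy x y px py by simp
    qed
  qed simp
  ultimately show "0 \<le> push a b T f u \<and> (u - A)\<^sup>2 * push a b T f u \<le> (v - A)\<^sup>2 * push a b T f v \<and>
      (B - v)\<^sup>2 * push a b T f v \<le> (B - u)\<^sup>2 * push a b T f u" by blast
qed

lemma koebe_branch_continuous:
  assumes T: "koebe_branch a b A B T" shows "continuous_on {a<..<b} T"
  using DERIV_isCont[OF koebe_branch_deriv(1)[OF T]] by (intro continuous_at_imp_continuous_on ballI)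

text \<open>Change of variables for the image of Lebesgue measure: for the constant density 1 the
  Jacobian times the image density at T y is identically 1. General densities are reduced to this
  case in \<open>nn_integral_push\<close>.\<close>

lemma koebe_branch_lborel:
  assumes T: "koebe_branch a b A B T" and [measurable]: "T \<in> borel_measurable borel"
    and [measurable]: "X \<in> sets borel"
  shows "emeasure lborel ({a<..<b} \<inter> T -` X) = (\<integral>\<^sup>+x. ennreal (push a b T (\<lambda>_. 1) x) * indicator X x \<partial>lborel)"
proof -
  define S where "S = {a<..<b} \<inter> T -` X"
  have [measurable]: "S \<in> sets borel" unfolding S_def
    using measurable_sets_borel[of T borel X] assms by (intro sets.Int) auto
  let ?f = "push a b T (\<lambda>_. 1)"
  have inj: "inj_on T S" using koebe_branch_inj[OF T] by (rule inj_on_subset) (auto simp: S_def)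
  have der: "(T has_field_derivative deriv T x) (at x within S)" if "x \<in> S" for x
    using koebe_branch_deriv(1)[OF T, of x] that by (auto simp: S_def intro: DERIV_subset)
  have 1: "\<bar>deriv T y\<bar> * ?f (T y) = 1" if "y \<in> S" for y
    using push_image[OF koebe_branch_inj[OF T], of y] koebe_branch_deriv(2)[OF T, of y] that by (auto simp: S_def)
  have fin: "emeasure lborel S < \<infinity>"
  proof -
    have "emeasure lborel S \<le> emeasure lborel {a<..<b}"
      by (intro emeasure_mono) (auto simp: S_def)
    also have "\<dots> < \<infinity>" by (cases "a \<le> b") (auto simp: )
    finally show ?thesis .
  qed
  have "S \<in> lmeasurable" using fin by (intro fmeasurableI) auto
  then have c: "(\<lambda>_. 1::real) absolutely_integrable_on S" "integral S (\<lambda>_. 1::real) = measure lebesgue S"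
    by (auto simp only: lmeasure_integral absolutely_integrable_on_const)
  have "(\<lambda>y. \<bar>deriv T y\<bar> * ?f (T y)) absolutely_integrable_on S \<and> integral S (\<lambda>y. \<bar>deriv T y\<bar> * ?f (T y)) = measure lborel S"
  proof
    show "(\<lambda>y. \<bar>deriv T y\<bar> * ?f (T y)) absolutely_integrable_on S"
      using c(1) by (rule absolutely_integrable_spike[OF _ negligible_empty]) (auto simp: 1)
    show "integral S (\<lambda>y. \<bar>deriv T y\<bar> * ?f (T y)) = measure lborel S"
      using c(2) 1 by (subst integral_cong[of S _ "\<lambda>_. 1"]) (auto simp: measure_completion)
  qed
  then have "?f absolutely_integrable_on (T ` S)" "integral (T ` S) ?f = measure lborel S"
    using has_absolute_integral_change_of_variables_1'[of S T "deriv T" ?f "measure lborel S"] inj der by auto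
  then have "(?f has_integral measure lborel S) (T ` S)"
    by (metis absolutely_integrable_on_def integrable_integral)
  then have "(\<integral>\<^sup>+x. ennreal (?f x) * indicator (T ` S) x \<partial>lborel) = ennreal (measure lborel S)"
    by (rule nn_integral_has_integral_lebesgue'[rotated]) (simp add: push_def)
  also have "(\<integral>\<^sup>+x. ennreal (?f x) * indicator (T ` S) x \<partial>lborel) = (\<integral>\<^sup>+x. ennreal (?f x) * indicator X x \<partial>lborel)"
    by (intro nn_integral_cong) (auto simp: push_def S_def split: split_indicator)
  also have "ennreal (measure lborel S) = emeasure lborel S"
    using fin by (simp add: emeasure_eq_ennreal_measure less_top)
  finally show ?thesis by (simp add: S_def)
qed

lemma push_measurable:
  assumes T: "koebe_branch a b A B T" and f: "koebe a b f"
  shows "push a b T f \<in> borel_measurable borel"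
proof -
  have "(\<lambda>x. indicator {A<..<B} x * push a b T f x) = push a b T f"
    using koebe_branch_image[OF T] by (auto simp: fun_eq_iff push_def split: split_indicator)
  then show ?thesis using koebe_measurable[OF push_koebe[OF T f]] by simp
qed

text \<open>The image of \<open>f\<close> equals the image of 1 times a function \<open>h\<close>
  with h (T y) = f y, so the identity of measures for constant density suffices.\<close>

lemma nn_integral_push:
  assumes T: "koebe_branch a b A B T" and [measurable]: "T \<in> borel_measurable borel"
    and f: "koebe a b f" and \<psi>[measurable]: "\<psi> \<in> borel_measurable borel"
  shows "(\<integral>\<^sup>+x. \<psi> x * ennreal (push a b T f x) \<partial>lborel) =
    (\<integral>\<^sup>+y. indicator {a<..<b} y * (\<psi> (T y) * ennreal (f y)) \<partial>lborel)"
proof -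
  let ?g = "push a b T (\<lambda>_. 1)"
  have one: "koebe a b (\<lambda>_. 1)" by (rule koebe_const) simp
  have [measurable]: "?g \<in> borel_measurable borel" "push a b T f \<in> borel_measurable borel"
    using push_measurable[OF T one] push_measurable[OF T f] by auto
  have eq: "distr (density lborel (indicator {a<..<b})) borel T = density lborel ?g"
  proof (rule measure_eqI)
    fix X assume "X \<in> sets (distr (density lborel (indicator {a<..<b})) borel T)"
    then have [measurable]: "X \<in> sets borel" by simp
    have TX[measurable]: "T -` X \<in> sets borel" using measurable_sets_borel[of T borel X] by simp
    have "emeasure (distr (density lborel (indicator {a<..<b})) borel T) X =
       emeasure (density lborel (indicator {a<..<b})) (T -` X)"
      by (subst emeasure_distr) auto
    also have "\<dots> = emeasure lborel ({a<..<b} \<inter> T -` X)"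
      using TX by (subst emeasure_density)
        (auto simp: nn_integral_indicator[symmetric] indicator_inter_arith simp del: nn_integral_indicator)
    also have "\<dots> = emeasure (density lborel ?g) X"
      using koebe_branch_lborel[OF T] by (subst emeasure_density) auto
    finally show "emeasure (distr (density lborel (indicator {a<..<b})) borel T) X = emeasure (density lborel ?g) X" .
  qed simp
  define h where "h x = push a b T f x / ?g x" for x
  have [measurable]: "h \<in> borel_measurable borel" unfolding h_def by measurable
  have inj: "inj_on T {a<..<b}" by (rule koebe_branch_inj[OF T])
  have hT: "h (T y) = f y" if "y \<in> {a<..<b}" for y
    using koebe_branch_deriv(2)[OF T that] by (simp add: h_def push_image[OF inj that])
  have hg: "ennreal (push a b T f x) = ennreal (?g x) * ennreal (h x)" for x
  proof (cases "x \<in> T ` {a<..<b}")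
    case True
    then obtain y where y: "y \<in> {a<..<b}" "x = T y" by auto
    show ?thesis
      using koebe_branch_deriv(2)[OF T y(1)] hT[OF y(1)] koebe_nonneg[OF f y(1)]
      by (simp add: y(2) push_image[OF inj y(1)] ennreal_mult[symmetric])
  qed (simp add: push_outside)
  have "(\<integral>\<^sup>+x. \<psi> x * ennreal (push a b T f x) \<partial>lborel) = (\<integral>\<^sup>+x. ennreal (?g x) * (\<psi> x * ennreal (h x)) \<partial>lborel)"
    by (intro nn_integral_cong) (simp add: hg mult_ac)
  also have "\<dots> = (\<integral>\<^sup>+x. \<psi> x * ennreal (h x) \<partial>density lborel ?g)"
    by (subst nn_integral_density) auto
  also have "\<dots> = (\<integral>\<^sup>+y. \<psi> (T y) * ennreal (h (T y)) \<partial>density lborel (indicator {a<..<b}))"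
    unfolding eq[symmetric] by (subst nn_integral_distr) auto
  also have "\<dots> = (\<integral>\<^sup>+y. indicator {a<..<b} y * (\<psi> (T y) * ennreal (h (T y))) \<partial>lborel)"
    by (subst nn_integral_density) auto
  also have "\<dots> = (\<integral>\<^sup>+y. indicator {a<..<b} y * (\<psi> (T y) * ennreal (f y)) \<partial>lborel)"
    by (intro nn_integral_cong) (auto simp: hT split: split_indicator)
  finally show ?thesis .
qed

section \<open>Branches with nonpositive Schwarzian derivative\<close>

text \<open>The mean value theorem on [s, t] with s tending to 0, since only the one-sided limit of
  \<tau> at 0 is known.\<close>

lemma powr_deriv_growth_upper:
  fixes \<tau> d1 :: "real \<Rightarrow> real"
  assumes d: "\<And>t. 0 < t \<Longrightarrow> t < L \<Longrightarrow> (\<tau> has_real_derivative d1 t) (at t)"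
    and lim: "(\<tau> \<longlongrightarrow> 0) (at_right 0)"
    and r: "1 \<le> r" and ub: "\<And>t. 0 < t \<Longrightarrow> t < L \<Longrightarrow> d1 t \<le> M * t powr (r - 1)"
    and t: "0 < t" "t < L" and "0 \<le> M"
  shows "\<tau> t \<le> M * t powr r"
proof -
  have ev: "\<forall>\<^sub>F s in at_right 0. \<tau> t - \<tau> s \<le> M * t powr r"
    using eventually_at_right_less[of "0::real"] eventually_at_right_real[OF t(1)]
  proof eventually_elim
    case (elim s)
    then have s: "0 < s" "s < t" by auto
    obtain z where z: "s < z" "z < t" "\<tau> t - \<tau> s = (t - s) * d1 z"
      using MVT2[of s t \<tau> d1] d s t by (metis less_trans less_le_trans order_le_less_trans)
    have "d1 z \<le> M * z powr (r - 1)" using ub[of z] z s t by auto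
    also have "\<dots> \<le> M * t powr (r - 1)" using z s r \<open>0 \<le> M\<close> by (intro mult_left_mono powr_mono2) auto
    finally have "\<tau> t - \<tau> s \<le> (t - s) * (M * t powr (r - 1))"
      unfolding z(3) using s by (intro mult_left_mono) auto
    also have "\<dots> \<le> t * (M * t powr (r - 1))" using s \<open>0 \<le> M\<close> by (intro mult_right_mono) auto
    also have "\<dots> = M * t powr r" using t by (simp add: powr_diff)
    finally show ?case .
  qed
  have "((\<lambda>s. \<tau> t - \<tau> s) \<longlongrightarrow> \<tau> t - 0) (at_right 0)" by (intro tendsto_intros lim)
  from tendsto_upperbound[OF this ev] show ?thesis by simp
qed

lemma schwarzian_ratio_mono:
  fixes \<tau> d1 d2 d3 :: "real \<Rightarrow> real"
  assumes d: "\<And>t. 0 < t \<Longrightarrow> t < L \<Longrightarrow> (\<tau> has_real_derivative d1 t) (at t)"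
      "\<And>t. 0 < t \<Longrightarrow> t < L \<Longrightarrow> (d1 has_real_derivative d2 t) (at t)"
      "\<And>t. 0 < t \<Longrightarrow> t < L \<Longrightarrow> (d2 has_real_derivative d3 t) (at t)"
    and pos: "\<And>t. 0 < t \<Longrightarrow> t < L \<Longrightarrow> 0 < \<tau> t" "\<And>t. 0 < t \<Longrightarrow> t < L \<Longrightarrow> 0 < d1 t"
    and S: "\<And>t. 0 < t \<Longrightarrow> t < L \<Longrightarrow> d3 t / d1 t - 3 / 2 * (d2 t / d1 t)\<^sup>2 \<le> 0"
    and lim: "(\<tau> \<longlongrightarrow> 0) (at_right 0)"
    and r: "1 \<le> r" and K: "0 < K" and L': "0 < L'" "L' \<le> L"
    and bounds: "\<And>t. 0 < t \<Longrightarrow> t < L' \<Longrightarrow> K * t powr (r - 1) \<le> d1 t \<and> d1 t \<le> M * t powr (r - 1)"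
    and st: "0 < s" "s < t" "t < L"
  shows "(\<tau> s)\<^sup>2 / (d1 s * s\<^sup>2) \<le> (\<tau> t)\<^sup>2 / (d1 t * t\<^sup>2)"
proof -
  \<comment> \<open>\<open>F'' = - S F / 2\<close>, where \<open>S\<close> is the Schwarzian of \<open>\<tau>\<close>, so \<open>F\<close> is convex and vanishes at \<open>0\<close>.\<close>
  define q where "q t = inverse (sqrt (d1 t))" for t
  define F where "F t = \<tau> t * q t" for t
  have dq: "(q has_real_derivative - (d2 t / (2 * d1 t)) * q t) (at t)" if "0 < t" "t < L" for t
    unfolding q_def using pos(2)[OF that] d(2)[OF that]
    by (auto intro!: derivative_eq_intros simp: field_simps power2_eq_square real_sqrt_mult_self)
  have conv: "convex_on {0<..<L} F"
  proof (rule f''_ge0_imp_convex)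
    fix u assume "u \<in> {0<..<L}"
    then have u: "0 < u" "u < L" by auto
    note p = pos(2)[OF u]
    show "(F has_real_derivative d1 u * q u - \<tau> u * q u * d2 u / (2 * d1 u)) (at u)"
      unfolding F_def using d(1)[OF u] dq[OF u] p
      by (auto intro!: derivative_eq_intros simp: field_simps)
    have "((\<lambda>t. d1 t * q t - \<tau> t * q t * d2 t / (2 * d1 t)) has_real_derivative
        - (1/2) * \<tau> u * q u * (d3 u / d1 u - 3 / 2 * (d2 u / d1 u)\<^sup>2)) (at u)"
      using d(1)[OF u] d(2)[OF u] d(3)[OF u] dq[OF u] p
      by (auto intro!: derivative_eq_intros simp: field_simps power2_eq_square)
    then show "((\<lambda>t. d1 t * q t - \<tau> t * q t * d2 t / (2 * d1 t)) has_real_derivative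
        - (1/2) * \<tau> u * q u * (d3 u / d1 u - 3 / 2 * (d2 u / d1 u)\<^sup>2)) (at u)" .
    show "0 \<le> - (1/2) * \<tau> u * q u * (d3 u / d1 u - 3 / 2 * (d2 u / d1 u)\<^sup>2)"
      using S[OF u] pos(1)[OF u] p by (intro mult_nonpos_nonpos) (auto simp: q_def)
  qed simp
  have M: "0 < M"
  proof -
    have "K * (L'/2) powr (r - 1) \<le> M * (L'/2) powr (r - 1)" using bounds[of "L'/2"] L' by linarith
    then show ?thesis using K L' by simp
  qed
  \<comment> \<open>The power bounds on the derivative serve to make \<open>F\<close> vanish at 0:
    \<tau> is of order u^r, while \<open>q\<close> is at most of order u^(-(r-1)/2).\<close>
  have Fbound: "F u \<le> M / sqrt K * u powr ((r + 1) / 2)" if u: "0 < u" "u < L'" for u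
  proof -
    have "\<tau> u \<le> M * u powr r"
      by (rule powr_deriv_growth_upper[OF _ lim r, of L' d1 M]) (use d(1) bounds L' u M in auto)
    moreover have "q u \<le> inverse (sqrt K * u powr ((r - 1) / 2))"
    proof -
      have "sqrt (K * u powr (r - 1)) = sqrt K * u powr ((r - 1) / 2)"
        using u by (simp add: real_sqrt_mult powr_half_sqrt_powr)
      moreover have "sqrt (K * u powr (r - 1)) \<le> sqrt (d1 u)" using bounds[OF u] by simp
      ultimately show ?thesis unfolding q_def using K u by (intro le_imp_inverse_le) auto
    qed
    ultimately have "F u \<le> (M * u powr r) * inverse (sqrt K * u powr ((r - 1) / 2))"
      unfolding F_def using pos u L' M K by (intro mult_mono) (auto simp: q_def less_imp_le)
    also have "\<dots> = M / sqrt K * (u powr r / u powr ((r - 1) / 2))" by (simp add: field_simps)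
    also have "u powr r / u powr ((r - 1) / 2) = u powr ((r + 1) / 2)"
      by (simp add: powr_diff[symmetric] field_simps)
    finally show ?thesis .
  qed
  have F0: "(F \<longlongrightarrow> 0) (at_right 0)"
  proof (rule tendsto_sandwich)
    show "\<forall>\<^sub>F u in at_right 0. 0 \<le> F u"
      using eventually_at_right_real[of 0 L] L' 
      by (auto elim!: eventually_mono simp: F_def q_def intro!: mult_nonneg_nonneg less_imp_le[OF pos(1)] less_imp_le[OF pos(2)])
    show "\<forall>\<^sub>F u in at_right 0. F u \<le> M / sqrt K * u powr ((r + 1) / 2)"
      using eventually_at_right_real[OF L'(1)] by eventually_elim (use Fbound in auto)
    have "((\<lambda>u::real. u powr ((r + 1) / 2)) \<longlongrightarrow> 0) (at_right 0)"
      by (rule tendsto_zero_powrI[where b = "(r + 1) / 2"]) (use r in \<open>auto intro!: tendsto_intros eventually_at_right_less[THEN eventually_mono]\<close>)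
    then show "((\<lambda>u. M / sqrt K * u powr ((r + 1) / 2)) \<longlongrightarrow> 0) (at_right 0)"
      by (rule tendsto_mult_right_zero)
  qed simp
  \<comment> \<open>A convex function with limit 0 at 0 has increasing F u / u. Since
    \<open>F\<close> need not be 0 at 0, the chord starts at a small \<open>u\<close> which then
    tends to 0.\<close>
  have "F s \<le> (s / t) * F t"
  proof -
    have "\<forall>\<^sub>F u in at_right 0. F s \<le> ((t - s) / (t - u)) * F u + ((s - u) / (t - u)) * F t"
      using eventually_at_right_real[OF st(1)]
    proof eventually_elim
      case (elim u)
      then have u: "0 < u" "u < s" by auto
      have "((t - s) / (t - u)) * u + ((s - u) / (t - u)) * t = s * (t - u) / (t - u)"
        by (simp add: add_divide_distrib[symmetric] diff_divide_distrib[symmetric] algebra_simps del: times_divide_eq_left)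
      also have "\<dots> = s" using u st by simp
      finally have e: "((t - s) / (t - u)) * u + ((s - u) / (t - u)) * t = s" .
      have e1: "1 - (s - u) / (t - u) = (t - s) / (t - u)" using u st by (simp add: field_simps)
      have "F ((1 - (s - u) / (t - u)) *\<^sub>R u + ((s - u) / (t - u)) *\<^sub>R t)
          \<le> (1 - (s - u) / (t - u)) * F u + ((s - u) / (t - u)) * F t"
        using u st by (intro convex_onD[OF conv]) auto
      then show ?case unfolding e1 real_scaleR_def e .
    qed
    moreover have "((\<lambda>u. ((t - s) / (t - u)) * F u + ((s - u) / (t - u)) * F t) \<longlongrightarrow>
       ((t - s) / (t - 0)) * 0 + ((s - 0) / (t - 0)) * F t) (at_right 0)"
      using st by (intro tendsto_intros F0) auto
    ultimately have "F s \<le> ((t - s) / (t - 0)) * 0 + ((s - 0) / (t - 0)) * F t"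
      by (intro tendsto_lowerbound) auto
    then show ?thesis by simp
  qed
  then have "F s / s \<le> F t / t" using st by (simp add: field_simps)
  moreover have "0 \<le> F s / s" using pos st by (auto simp: F_def q_def less_imp_le)
  ultimately have le: "(F s / s)\<^sup>2 \<le> (F t / t)\<^sup>2" by (rule power_mono)
  have eq: "(F u / u)\<^sup>2 = (\<tau> u)\<^sup>2 / (d1 u * u\<^sup>2)" if "0 < u" "u < L" for u
  proof -
    have "(q u)\<^sup>2 = inverse (d1 u)" using pos(2)[OF that] by (simp add: q_def power_inverse)
    then show ?thesis by (simp add: F_def power_mult_distrib power_inverse divide_inverse mult_ac)
  qed
  have "0 < t" "s < L" using st by auto
  then show ?thesis using le eq[OF st(1)] eq[OF _ st(3)] by metis
qed

text \<open>One notion covers every end of a branch: at \<open>c\<close> the exponent is that of the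
  map, at 0 and 1 it can be taken to be 1.\<close>

definition powr_bounds_at :: "real \<Rightarrow> (real \<Rightarrow> real) \<Rightarrow> real filter \<Rightarrow> bool" where
  "powr_bounds_at e T1 F \<longleftrightarrow> (\<exists>r K M. 1 \<le> r \<and> 0 < K \<and>
     (\<forall>\<^sub>F x in F. K * \<bar>x - e\<bar> powr (r - 1) \<le> \<bar>T1 x\<bar> \<and> \<bar>T1 x\<bar> \<le> M * \<bar>x - e\<bar> powr (r - 1)))"

text \<open>Both ends reduce to \<open>schwarzian_ratio_mono\<close>, applied to T(a + t) - A and to
  B - T(b - t). The reflection flips the sign of the second derivative, which enters the Schwarzian
  only squared.\<close>

lemma koebe_branchI_increasing:
  fixes T T1 T2 T3 :: "real \<Rightarrow> real"
  assumes ab: "a < b" and im: "T ` {a<..<b} = {A<..<B}"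
    and d: "\<And>x. x \<in> {a<..<b} \<Longrightarrow> (T has_real_derivative T1 x) (at x)"
      "\<And>x. x \<in> {a<..<b} \<Longrightarrow> (T1 has_real_derivative T2 x) (at x)"
      "\<And>x. x \<in> {a<..<b} \<Longrightarrow> (T2 has_real_derivative T3 x) (at x)"
    and pos: "\<And>x. x \<in> {a<..<b} \<Longrightarrow> 0 < T1 x"
    and S: "\<And>x. x \<in> {a<..<b} \<Longrightarrow> T3 x / T1 x - 3 / 2 * (T2 x / T1 x)\<^sup>2 \<le> 0"
    and bounds: "powr_bounds_at a T1 (at_right a)" "powr_bounds_at b T1 (at_left b)"
  shows "koebe_branch a b A B T"
proof -
  have mono: "T x < T y" if "a < x" "x < y" "y < b" for x y
  proof (rule DERIV_pos_imp_increasing[OF that(2)])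
    fix z assume "x \<le> z" "z \<le> y"
    then have "z \<in> {a<..<b}" using that by auto
    then show "\<exists>D. (T has_real_derivative D) (at z) \<and> 0 < D" using d(1) pos by blast
  qed
  have inAB: "A < T x" "T x < B" if "a < x" "x < b" for x using im that by auto
  have dT: "deriv T x = T1 x" if "a < x" "x < b" for x using d(1)[of x] that by (auto intro: DERIV_imp_deriv)
  have L: "0 < b - a" using ab by simp
  have shift: "((\<lambda>t. G (a + t)) has_real_derivative D) (at t)"
    if "(G has_real_derivative D) (at (a + t))" for G :: "real \<Rightarrow> real" and D t
  proof -
    have "((\<lambda>t. a + t) has_real_derivative 1) (at t)" by (auto intro!: derivative_eq_intros)
    from DERIV_chain2[where f = G and g = "\<lambda>t. a + t" and x = t and s = UNIV, OF that this] show ?thesis by simp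
  qed
  have reflect: "((\<lambda>t. G (b - t)) has_real_derivative - D) (at t)"
    if "(G has_real_derivative D) (at (b - t))" for G :: "real \<Rightarrow> real" and D t
  proof -
    have "((\<lambda>t. b - t) has_real_derivative -1) (at t)" by (auto intro!: derivative_eq_intros)
    from DERIV_chain2[where f = G and g = "\<lambda>t. b - t" and x = t and s = UNIV, OF that this] show ?thesis by simp
  qed
  have left: "(T x - A)\<^sup>2 / (T1 x * (x - a)\<^sup>2) \<le> (T y - A)\<^sup>2 / (T1 y * (y - a)\<^sup>2)" if xy: "a < x" "x < y" "y < b" for x y
  proof -
    obtain r K M where r: "1 \<le> r" "0 < K"
      and ev: "\<forall>\<^sub>F x in at_right a. K * \<bar>x - a\<bar> powr (r - 1) \<le> \<bar>T1 x\<bar> \<and> \<bar>T1 x\<bar> \<le> M * \<bar>x - a\<bar> powr (r - 1)"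
      using bounds(1) unfolding powr_bounds_at_def by blast
    obtain z where z: "a < z" and zb: "\<And>x. a < x \<Longrightarrow> x < z \<Longrightarrow>
        K * \<bar>x - a\<bar> powr (r - 1) \<le> \<bar>T1 x\<bar> \<and> \<bar>T1 x\<bar> \<le> M * \<bar>x - a\<bar> powr (r - 1)"
      using ev unfolding eventually_at_right_field by blast
    \<comment> \<open>Continuity at \<open>a\<close> is not assumed; the limit follows from
      monotonicity and from \<open>T\<close> taking every value of (A, B). The minimum with the
      midpoint below keeps the chosen value inside the range when \<open>e\<close> is large.\<close>
    have lim: "((\<lambda>t. T (a + t) - A) \<longlongrightarrow> 0) (at_right 0)"
    proof (rule order_tendstoI)
      fix e :: real assume "e < 0"
      show "\<forall>\<^sub>F t in at_right 0. e < T (a + t) - A"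
        using eventually_at_right_real[OF L]
      proof eventually_elim
        case (elim t)
        then show ?case using inAB(1)[of "a + t"] \<open>e < 0\<close> by auto
      qed
    next
      fix e :: real assume "0 < e"
      have "A < B" using inAB[of x] xy by auto
      then have "min (A + e) ((A + B) / 2) \<in> T ` {a<..<b}" using \<open>0 < e\<close> im by (auto simp: min_def field_simps)
      then obtain w where w: "a < w" "w < b" "T w \<le> A + e" by auto
      have "0 < w - a" using w by simp
      show "\<forall>\<^sub>F t in at_right 0. T (a + t) - A < e"
        using eventually_at_right_real[OF \<open>0 < w - a\<close>]
      proof eventually_elim
        case (elim t)
        then show ?case using mono[of "a + t" w] w by auto
      qed
    qed
    have "(T (a + (x - a)) - A)\<^sup>2 / (T1 (a + (x - a)) * (x - a)\<^sup>2) \<le> (T (a + (y - a)) - A)\<^sup>2 / (T1 (a + (y - a)) * (y - a)\<^sup>2)"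
    proof (rule schwarzian_ratio_mono[where L = "b - a" and L' = "min (z - a) (b - a)" and r = r and K = K and M = M
          and \<tau> = "\<lambda>t. T (a + t) - A" and ?d1.0 = "\<lambda>t. T1 (a + t)" and ?d2.0 = "\<lambda>t. T2 (a + t)" and ?d3.0 = "\<lambda>t. T3 (a + t)"])
      fix t assume t: "0 < t" "t < b - a"
      then have at: "a + t \<in> {a<..<b}" by auto
      show "((\<lambda>t. T (a + t) - A) has_real_derivative T1 (a + t)) (at t)"
        using shift[OF d(1)[OF at]] by (auto intro!: derivative_eq_intros)
      show "((\<lambda>t. T1 (a + t)) has_real_derivative T2 (a + t)) (at t)"
        using shift[OF d(2)[OF at]] by (auto intro!: derivative_eq_intros)
      show "((\<lambda>t. T2 (a + t)) has_real_derivative T3 (a + t)) (at t)"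
        using shift[OF d(3)[OF at]] by (auto intro!: derivative_eq_intros)
      show "0 < T (a + t) - A" using inAB[of "a + t"] at by auto
      show "0 < T1 (a + t)" by (rule pos[OF at])
      show "T3 (a + t) / T1 (a + t) - 3 / 2 * (T2 (a + t) / T1 (a + t))\<^sup>2 \<le> 0" by (rule S[OF at])
    next
      fix t assume t: "0 < t" "t < min (z - a) (b - a)"
      then have at: "a + t \<in> {a<..<b}" "a + t < z" by auto
      show "K * t powr (r - 1) \<le> T1 (a + t) \<and> T1 (a + t) \<le> M * t powr (r - 1)"
        using zb[of "a + t"] pos[OF at(1)] at t by auto
    qed (use lim r z xy in auto)
    then show ?thesis by simp
  qed
  have right: "(B - T y)\<^sup>2 / (T1 y * (b - y)\<^sup>2) \<le> (B - T x)\<^sup>2 / (T1 x * (b - x)\<^sup>2)" if xy: "a < x" "x < y" "y < b" for x y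
  proof -
    obtain r K M where r: "1 \<le> r" "0 < K"
      and ev: "\<forall>\<^sub>F x in at_left b. K * \<bar>x - b\<bar> powr (r - 1) \<le> \<bar>T1 x\<bar> \<and> \<bar>T1 x\<bar> \<le> M * \<bar>x - b\<bar> powr (r - 1)"
      using bounds(2) unfolding powr_bounds_at_def by blast
    obtain z where z: "z < b" and zb: "\<And>x. z < x \<Longrightarrow> x < b \<Longrightarrow>
        K * \<bar>x - b\<bar> powr (r - 1) \<le> \<bar>T1 x\<bar> \<and> \<bar>T1 x\<bar> \<le> M * \<bar>x - b\<bar> powr (r - 1)"
      using ev unfolding eventually_at_left_field by blast
    have lim: "((\<lambda>t. B - T (b - t)) \<longlongrightarrow> 0) (at_right 0)"
    proof (rule order_tendstoI)
      fix e :: real assume "e < 0"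
      show "\<forall>\<^sub>F t in at_right 0. e < B - T (b - t)"
        using eventually_at_right_real[OF L]
      proof eventually_elim
        case (elim t)
        then show ?case using inAB(2)[of "b - t"] \<open>e < 0\<close> by auto
      qed
    next
      fix e :: real assume "0 < e"
      have "A < B" using inAB[of x] xy by auto
      then have "max (B - e) ((A + B) / 2) \<in> T ` {a<..<b}" using \<open>0 < e\<close> im by (auto simp: max_def field_simps)
      then obtain w where w: "a < w" "w < b" "B - e \<le> T w" by auto
      have "0 < b - w" using w by simp
      show "\<forall>\<^sub>F t in at_right 0. B - T (b - t) < e"
        using eventually_at_right_real[OF \<open>0 < b - w\<close>]
      proof eventually_elim
        case (elim t)
        then show ?case using mono[of w "b - t"] w by auto
      qed
    qed
    have "(B - T (b - (b - y)))\<^sup>2 / (T1 (b - (b - y)) * (b - y)\<^sup>2) \<le> (B - T (b - (b - x)))\<^sup>2 / (T1 (b - (b - x)) * (b - x)\<^sup>2)"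
    proof (rule schwarzian_ratio_mono[where L = "b - a" and L' = "min (b - z) (b - a)" and r = r and K = K and M = M
          and \<tau> = "\<lambda>t. B - T (b - t)" and ?d1.0 = "\<lambda>t. T1 (b - t)" and ?d2.0 = "\<lambda>t. - T2 (b - t)" and ?d3.0 = "\<lambda>t. T3 (b - t)"])
      fix t assume t: "0 < t" "t < b - a"
      then have at: "b - t \<in> {a<..<b}" by auto
      show "((\<lambda>t. B - T (b - t)) has_real_derivative T1 (b - t)) (at t)"
        using reflect[OF d(1)[OF at]] by (auto intro!: derivative_eq_intros)
      show "((\<lambda>t. T1 (b - t)) has_real_derivative - T2 (b - t)) (at t)"
        using reflect[OF d(2)[OF at]] by (auto intro!: derivative_eq_intros)
      show "((\<lambda>t. - T2 (b - t)) has_real_derivative T3 (b - t)) (at t)"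
        using reflect[OF d(3)[OF at]] by (auto intro!: derivative_eq_intros)
      show "0 < B - T (b - t)" using inAB[of "b - t"] at by auto
      show "0 < T1 (b - t)" by (rule pos[OF at])
      show "T3 (b - t) / T1 (b - t) - 3 / 2 * (- T2 (b - t) / T1 (b - t))\<^sup>2 \<le> 0" using S[OF at] by simp
    next
      fix t assume t: "0 < t" "t < min (b - z) (b - a)"
      then have at: "b - t \<in> {a<..<b}" "z < b - t" by auto
      show "K * t powr (r - 1) \<le> T1 (b - t) \<and> T1 (b - t) \<le> M * t powr (r - 1)"
        using zb[of "b - t"] pos[OF at(1)] at t by auto
    qed (use lim r z xy in auto)
    then show ?thesis by simp
  qed
  show ?thesis
    unfolding koebe_branch_def
  proof (intro conjI ballI disjI1 allI impI)
    fix x assume x: "x \<in> {a<..<b}"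
    show "T field_differentiable at x" using d(1)[OF x] by (auto simp: field_differentiable_def)
    show "deriv T x \<noteq> 0" using dT[of x] pos[OF x] x by auto
  next
    fix x y assume xy: "a < x \<and> x < y \<and> y < b"
    then have p: "\<bar>deriv T x\<bar> = T1 x" "\<bar>deriv T y\<bar> = T1 y" using dT pos[of x] pos[of y] by auto
    show "T x < T y" using mono xy by auto
    show "(T x - A)\<^sup>2 / (\<bar>deriv T x\<bar> * (x - a)\<^sup>2) \<le> (T y - A)\<^sup>2 / (\<bar>deriv T y\<bar> * (y - a)\<^sup>2)"
      unfolding p using left xy by auto
    show "(B - T y)\<^sup>2 / (\<bar>deriv T y\<bar> * (b - y)\<^sup>2) \<le> (B - T x)\<^sup>2 / (\<bar>deriv T x\<bar> * (b - x)\<^sup>2)"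
      unfolding p using right xy by auto
  qed (rule im)
qed

text \<open>The derivative is continuous without zeros, so it has constant sign. A decreasing
  \<open>T\<close> is replaced by -T, which has the same Schwarzian; its inequalities over (-B, -A)
  are those of the decreasing alternative for \<open>T\<close>.\<close>

lemma koebe_branchI:
  fixes T T1 T2 T3 :: "real \<Rightarrow> real"
  assumes ab: "a < b" and im: "T ` {a<..<b} = {A<..<B}"
    and d: "\<And>x. x \<in> {a<..<b} \<Longrightarrow> (T has_real_derivative T1 x) (at x)"
      "\<And>x. x \<in> {a<..<b} \<Longrightarrow> (T1 has_real_derivative T2 x) (at x)"
      "\<And>x. x \<in> {a<..<b} \<Longrightarrow> (T2 has_real_derivative T3 x) (at x)"
    and nz: "\<And>x. x \<in> {a<..<b} \<Longrightarrow> T1 x \<noteq> 0"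
    and S: "\<And>x. x \<in> {a<..<b} \<Longrightarrow> T3 x / T1 x - 3 / 2 * (T2 x / T1 x)\<^sup>2 \<le> 0"
    and bounds: "powr_bounds_at a T1 (at_right a)" "powr_bounds_at b T1 (at_left b)"
  shows "koebe_branch a b A B T"
proof -
  have cont: "continuous_on {a<..<b} T1"
    using DERIV_isCont[OF d(2)] by (intro continuous_at_imp_continuous_on ballI)
  have "connected (T1 ` {a<..<b})" by (intro connected_continuous_image cont) simp
  then have sgn: "0 \<notin> T1 ` {a<..<b} \<Longrightarrow> (\<forall>x\<in>{a<..<b}. 0 < T1 x) \<or> (\<forall>x\<in>{a<..<b}. T1 x < 0)"
    by (smt (verit) connectedD_interval image_eqI)
  then consider (pos) "\<And>x. x \<in> {a<..<b} \<Longrightarrow> 0 < T1 x" | (neg) "\<And>x. x \<in> {a<..<b} \<Longrightarrow> T1 x < 0"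
    using nz by fastforce
  then show ?thesis
  proof cases
    case pos
    show ?thesis by (rule koebe_branchI_increasing[OF ab im d pos S bounds])
  next
    case neg
    have "(\<lambda>x. - T x) ` {a<..<b} = uminus ` {A<..<B}" unfolding im[symmetric] by auto
    then have im': "(\<lambda>x. - T x) ` {a<..<b} = {-B<..<-A}" by simp
    have m: "koebe_branch a b (-B) (-A) (\<lambda>x. - T x)"
    proof (rule koebe_branchI_increasing[OF ab im', of "\<lambda>x. - T1 x" "\<lambda>x. - T2 x" "\<lambda>x. - T3 x"])
      show "powr_bounds_at a (\<lambda>x. - T1 x) (at_right a)" "powr_bounds_at b (\<lambda>x. - T1 x) (at_left b)"
        using bounds by (simp_all add: powr_bounds_at_def)
    qed (use neg S in \<open>auto intro!: derivative_eq_intros d\<close>)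
    have T: "(T has_real_derivative T1 x) (at x)" if "x \<in> {a<..<b}" for x using d(1) that by auto
    have dT: "deriv T x = T1 x" "deriv (\<lambda>x. - T x) x = - T1 x" if "x \<in> {a<..<b}" for x
      using T[OF that] by (auto intro!: DERIV_imp_deriv derivative_eq_intros)
    have inc: "- T x < - T y \<and> (- T x - (-B))\<^sup>2 / (\<bar>deriv (\<lambda>x. - T x) x\<bar> * (x - a)\<^sup>2) \<le> (- T y - (-B))\<^sup>2 / (\<bar>deriv (\<lambda>x. - T x) y\<bar> * (y - a)\<^sup>2) \<and>
          (-A - (- T y))\<^sup>2 / (\<bar>deriv (\<lambda>x. - T x) y\<bar> * (b - y)\<^sup>2) \<le> (-A - (- T x))\<^sup>2 / (\<bar>deriv (\<lambda>x. - T x) x\<bar> * (b - x)\<^sup>2)"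
      if "a < x" "x < y" "y < b" for x y
    proof -
      \<comment> \<open>This excludes the decreasing alternative when \<open>koebe_branch\<close> is
        unfolded for -T.\<close>
      have "T y < T x"
      proof (rule DERIV_neg_imp_decreasing[OF that(2)])
        fix z assume "x \<le> z" "z \<le> y"
        then have "z \<in> {a<..<b}" using that by auto
        then show "\<exists>D. (T has_real_derivative D) (at z) \<and> D < 0" using d(1) neg by blast
      qed
      then have "- T x < - T y" by simp
      then show ?thesis using m that unfolding koebe_branch_def by (meson less_asym)
    qed
    show ?thesis
      unfolding koebe_branch_def
    proof (intro conjI ballI disjI2 allI impI)
      fix x assume x: "x \<in> {a<..<b}"
      show "T field_differentiable at x" using d(1)[OF x] by (auto simp: field_differentiable_def)
      show "deriv T x \<noteq> 0" using dT[OF x] neg[OF x] by auto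
    next
      fix x y assume xy: "a < x \<and> x < y \<and> y < b"
      then have x: "x \<in> {a<..<b}" and y: "y \<in> {a<..<b}" by auto
      note i = inc[of x y, unfolded dT[OF x] dT[OF y]]
      show "T y < T x" using i xy by auto
      show "(B - T x)\<^sup>2 / (\<bar>deriv T x\<bar> * (x - a)\<^sup>2) \<le> (B - T y)\<^sup>2 / (\<bar>deriv T y\<bar> * (y - a)\<^sup>2)"
        "(T y - A)\<^sup>2 / (\<bar>deriv T y\<bar> * (b - y)\<^sup>2) \<le> (T x - A)\<^sup>2 / (\<bar>deriv T x\<bar> * (b - x)\<^sup>2)"
        using i xy unfolding dT[OF x] dT[OF y] by auto
    qed (rule im)
  qed
qed

section \<open>Good and bad maps\<close>

definition edge :: "real \<Rightarrow> real" where
  "edge x = min x (1 - x)"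

lemma deriv01_interior:
  assumes "f differentiable (at x within {0..1})" "0 < x" "x < 1"
  shows "(f has_real_derivative deriv01 f x) (at x)"
proof -
  have "(f has_vector_derivative deriv01 f x) (at x within {0..1})"
    using assms(1) unfolding deriv01_def by (simp add: vector_derivative_works)
  then show ?thesis
    using assms by (simp add: has_real_derivative_iff_has_vector_derivative at_within_Icc_at)
qed

lemma thrice_differentiable_derivs:
  assumes f: "thrice_differentiable_on S f" and x: "x \<in> S" "0 < x" "x < 1"
  shows "(f has_real_derivative deriv01 f x) (at x)"
    "(deriv01 f has_real_derivative (deriv01 ^^ 2) f x) (at x)"
    "((deriv01 ^^ 2) f has_real_derivative (deriv01 ^^ 3) f x) (at x)"
proof -
  have d: "((deriv01 ^^ k) f has_real_derivative (deriv01 ^^ Suc k) f x) (at x)" if "k < 3" for k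
    using f x that deriv01_interior[of "(deriv01 ^^ k) f" x] unfolding thrice_differentiable_on_def by simp
  show "(f has_real_derivative deriv01 f x) (at x)" using d[of 0] by simp
  show "(deriv01 f has_real_derivative (deriv01 ^^ 2) f x) (at x)" using d[of 1] by (simp add: numeral_2_eq_2)
  show "((deriv01 ^^ 2) f has_real_derivative (deriv01 ^^ 3) f x) (at x)"
    using d[of 2] by (simp add: numeral_3_eq_3 numeral_2_eq_2)
qed

lemma powr_bounds_at_critical:
  assumes "deriv_bounds c T r K M" "1 \<le> r" "0 < K" "0 < c" "c < 1"
  shows "powr_bounds_at c (deriv01 T) (at_left c)" "powr_bounds_at c (deriv01 T) (at_right c)"
proof -
  have *: "K * \<bar>x - c\<bar> powr (r - 1) \<le> \<bar>deriv01 T x\<bar> \<and> \<bar>deriv01 T x\<bar> \<le> M * \<bar>x - c\<bar> powr (r - 1)"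
    if "x \<in> {0<..<c} \<union> {c<..<1}" for x
    using assms that unfolding deriv_bounds_def by auto
  have "\<forall>\<^sub>F x in at_left c. x \<in> {0<..<c} \<union> {c<..<1}"
    using eventually_at_left_real[OF assms(4)] by eventually_elim blast
  then have "\<forall>\<^sub>F x in at_left c. K * \<bar>x - c\<bar> powr (r - 1) \<le> \<bar>deriv01 T x\<bar> \<and> \<bar>deriv01 T x\<bar> \<le> M * \<bar>x - c\<bar> powr (r - 1)"
    by eventually_elim (rule *)
  then show "powr_bounds_at c (deriv01 T) (at_left c)" unfolding powr_bounds_at_def using assms by blast
  have "\<forall>\<^sub>F x in at_right c. x \<in> {0<..<c} \<union> {c<..<1}"
    using eventually_at_right_real[OF assms(5)] by eventually_elim blast
  then have "\<forall>\<^sub>F x in at_right c. K * \<bar>x - c\<bar> powr (r - 1) \<le> \<bar>deriv01 T x\<bar> \<and> \<bar>deriv01 T x\<bar> \<le> M * \<bar>x - c\<bar> powr (r - 1)"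
    by eventually_elim (rule *)
  then show "powr_bounds_at c (deriv01 T) (at_right c)" unfolding powr_bounds_at_def using assms by blast
qed

text \<open>Near a point other than \<open>c\<close> the distance |x - c| lies between \<rho> and 1,
  so the derivative is bounded above and away from 0, and exponent 1 serves for every
  \<open>r\<close>.\<close>

lemma powr_bounds_at_regular:
  assumes "deriv_bounds c T r K M" "1 \<le> r" "0 < K" and e: "0 \<le> e" "e \<le> 1" "e \<noteq> c" and "0 < c" "c < 1"
    and F: "F \<le> at e within {0..1}"
  shows "powr_bounds_at e (deriv01 T) F"
proof -
  define \<rho> where "\<rho> = \<bar>e - c\<bar> / 2"
  have \<rho>: "0 < \<rho>" using e by (simp add: \<rho>_def)
  have "\<forall>\<^sub>F x in at e within {0..1}. x \<in> {0..1} \<and> x \<noteq> e \<and> dist x e < \<rho>"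
    using \<rho> by (auto simp: eventually_at)
  then have "\<forall>\<^sub>F x in F. x \<in> {0..1} \<and> x \<noteq> e \<and> dist x e < \<rho>" using F by (rule filter_leD[rotated])
  then have "\<forall>\<^sub>F x in F. (K * \<rho> powr (r - 1)) * \<bar>x - e\<bar> powr (1 - 1) \<le> \<bar>deriv01 T x\<bar> \<and>
      \<bar>deriv01 T x\<bar> \<le> \<bar>M\<bar> * \<bar>x - e\<bar> powr (1 - 1)"
  proof eventually_elim
    case (elim x)
    have xc: "\<rho> \<le> \<bar>x - c\<bar>" using elim abs_triangle_ineq[of "e - x" "x - c"] unfolding \<rho>_def dist_real_def by (simp add: abs_minus_commute)
    have x1: "\<bar>x - c\<bar> \<le> 1" using elim assms by auto
    have b: "K * \<bar>x - c\<bar> powr (r - 1) \<le> \<bar>deriv01 T x\<bar>" "\<bar>deriv01 T x\<bar> \<le> M * \<bar>x - c\<bar> powr (r - 1)"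
      using assms(1) elim xc \<rho> unfolding deriv_bounds_def by auto
    have "K * \<rho> powr (r - 1) \<le> K * \<bar>x - c\<bar> powr (r - 1)"
      using assms \<rho> xc by (intro mult_left_mono powr_mono2) auto
    moreover have "M * \<bar>x - c\<bar> powr (r - 1) \<le> \<bar>M\<bar> * 1"
      using x1 assms by (intro mult_mono) (auto intro: powr_le1)
    ultimately show ?case using b elim by simp
  qed
  then show ?thesis unfolding powr_bounds_at_def using assms \<rho>
    by (intro exI[of _ 1] exI[of _ "K * \<rho> powr (r - 1)"] exI[of _ "\<bar>M\<bar>"]) simp
qed

lemma koebe_branch_left:
  assumes c: "0 < c" "c < 1" and "C3_diffeo {0<..<c} {A<..<B} T" and "nonpos_schwarzian_on {0..<c} T"
    and b: "deriv_bounds c T r K M" "1 \<le> r" "0 < K"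
  shows "koebe_branch 0 c A B T"
proof (rule koebe_branchI)
  show "powr_bounds_at 0 (deriv01 T) (at_right 0)"
    by (rule powr_bounds_at_regular[OF b]) (use c in \<open>auto simp: at_within_Icc_at_right\<close>)
  show "powr_bounds_at c (deriv01 T) (at_left c)" by (rule powr_bounds_at_critical[OF b c])
  show "T ` {0<..<c} = {A<..<B}" using assms(3) unfolding C3_diffeo_def by (simp add: bij_betw_def)
  fix x assume x: "x \<in> {0<..<c}"
  have "thrice_differentiable_on {0<..<c} T" using assms(3) unfolding C3_diffeo_def C3_on_def by simp
  then show "(T has_real_derivative deriv01 T x) (at x)" "(deriv01 T has_real_derivative (deriv01 ^^ 2) T x) (at x)"
    "((deriv01 ^^ 2) T has_real_derivative (deriv01 ^^ 3) T x) (at x)"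
    using thrice_differentiable_derivs[of "{0<..<c}" T x] x c by auto
  show "deriv01 T x \<noteq> 0" "(deriv01 ^^ 3) T x / deriv01 T x - 3 / 2 * ((deriv01 ^^ 2) T x / deriv01 T x)\<^sup>2 \<le> 0"
    using assms(4) x unfolding nonpos_schwarzian_on_def schwarzian_def by auto
qed (rule c)

lemma koebe_branch_right:
  assumes c: "0 < c" "c < 1" and "C3_diffeo {c<..<1} {A<..<B} T" and "nonpos_schwarzian_on {c<..1} T"
    and b: "deriv_bounds c T r K M" "1 \<le> r" "0 < K"
  shows "koebe_branch c 1 A B T"
proof (rule koebe_branchI)
  show "powr_bounds_at 1 (deriv01 T) (at_left 1)"
    by (rule powr_bounds_at_regular[OF b]) (use c in \<open>auto simp: at_within_Icc_at_left\<close>)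
  show "powr_bounds_at c (deriv01 T) (at_right c)" by (rule powr_bounds_at_critical[OF b c])
  show "T ` {c<..<1} = {A<..<B}" using assms(3) unfolding C3_diffeo_def by (simp add: bij_betw_def)
  fix x assume x: "x \<in> {c<..<1}"
  have "thrice_differentiable_on {c<..<1} T" using assms(3) unfolding C3_diffeo_def C3_on_def by simp
  then show "(T has_real_derivative deriv01 T x) (at x)" "(deriv01 T has_real_derivative (deriv01 ^^ 2) T x) (at x)"
    "((deriv01 ^^ 2) T has_real_derivative (deriv01 ^^ 3) T x) (at x)"
    using thrice_differentiable_derivs[of "{c<..<1}" T x] x c by auto
  show "deriv01 T x \<noteq> 0" "(deriv01 ^^ 3) T x / deriv01 T x - 3 / 2 * ((deriv01 ^^ 2) T x / deriv01 T x)\<^sup>2 \<le> 0"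
    using assms(4) x unfolding nonpos_schwarzian_on_def schwarzian_def by auto
qed (rule c)

section \<open>Where images lie relative to 0, c and 1\<close>

lemma koebe_branch_squeeze:
  assumes T: "koebe_branch a b A B T" and "a < u" "u < x" "x < v" "v < b"
  shows "min \<bar>T x - T u\<bar> \<bar>T x - T v\<bar> \<le> min (T x - A) (B - T x)"
proof -
  have "T u \<in> {A<..<B}" "T x \<in> {A<..<B}" "T v \<in> {A<..<B}"
    using koebe_branch_image[OF T] assms by auto
  moreover have "T u < T x \<and> T x < T v \<or> T v < T x \<and> T x < T u"
    using assms unfolding koebe_branch_def by (meson less_trans)
  ultimately show ?thesis by auto
qed

lemma abs_diff_ge_deriv:
  fixes T T1 :: "real \<Rightarrow> real"
  assumes "p < q" and "\<And>z. p \<le> z \<Longrightarrow> z \<le> q \<Longrightarrow> (T has_real_derivative T1 z) (at z)"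
    and "\<And>z. p \<le> z \<Longrightarrow> z \<le> q \<Longrightarrow> m \<le> \<bar>T1 z\<bar>"
  shows "m * (q - p) \<le> \<bar>T q - T p\<bar>"
proof -
  obtain z where "p < z" "z < q" "T q - T p = (q - p) * T1 z" using MVT2[OF assms(1,2)] by auto
  then show ?thesis using assms(1) assms(3)[of z] by (simp add: abs_mult mult.commute mult_left_mono)
qed

text \<open>Compare T x with the images of two points on either side of \<open>x\<close>: the point
  \<eta>/2 further from \<open>c\<close> and the midpoint of \<open>x\<close> and \<open>c\<close>.
  The mean value theorem separates the images by at least K d^(r-1) \<eta>/2 and K (d/2)^r, where d
  = |x - c| <= 1, and both images lie inside the range of the branch.\<close>

lemma away_from_edge:
  assumes c: "0 < c" "c < 1" and b: "deriv_bounds c T r K M" "1 \<le> r" "0 < K"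
    and L: "koebe_branch 0 c A B T" and R: "koebe_branch c 1 A' B' T"
    and \<eta>: "0 < \<eta>" and x: "\<eta> \<le> edge x" "x \<noteq> c"
  shows "K * min (\<eta> / 2) (1 / 2 powr r) * \<bar>x - c\<bar> powr r \<le>
    (if x < c then min (T x - A) (B - T x) else min (T x - A') (B' - T x))"
proof -
  have deriv: "(T has_real_derivative deriv01 T z) (at z)" "\<bar>deriv01 T z\<bar> \<ge> K * \<bar>z - c\<bar> powr (r - 1)"
    if "z \<in> {0<..<c} \<union> {c<..<1}" for z
  proof -
    have d: "(T has_real_derivative deriv T z) (at z)" using that koebe_branch_deriv(1)[OF L] koebe_branch_deriv(1)[OF R] by auto
    then have "T differentiable (at z within {0..1})"
      by (meson differentiable_at_withinI field_differentiable_def field_differentiable_imp_differentiable real_differentiable_def)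
    then show "(T has_real_derivative deriv01 T z) (at z)" using deriv01_interior that c by auto
    show "\<bar>deriv01 T z\<bar> \<ge> K * \<bar>z - c\<bar> powr (r - 1)" using b that c unfolding deriv_bounds_def by auto
  qed
  have x01: "0 < x" "x < 1" "\<eta> \<le> x" "\<eta> \<le> 1 - x" using x \<eta> by (auto simp: edge_def)
  have lower: "m * \<bar>q - p\<bar> \<le> \<bar>T q - T p\<bar>" 
    if "p < q" "p \<in> {0<..<c} \<and> q \<in> {0<..<c} \<or> p \<in> {c<..<1} \<and> q \<in> {c<..<1}" 
      "0 \<le> s" "s \<le> \<bar>p - c\<bar>" "s \<le> \<bar>q - c\<bar>" "m = K * s powr (r - 1)" for m s p q
  proof -
    have "m * (q - p) \<le> \<bar>T q - T p\<bar>"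
    proof (rule abs_diff_ge_deriv[OF that(1)])
      fix z assume z: "p \<le> z" "z \<le> q"
      then have zz: "z \<in> {0<..<c} \<union> {c<..<1}" "s \<le> \<bar>z - c\<bar>" using that by auto
      show "(T has_real_derivative deriv01 T z) (at z)" using deriv(1) zz by auto
      have "m \<le> K * \<bar>z - c\<bar> powr (r - 1)" unfolding that(6) using zz that b by (intro mult_left_mono powr_mono2) auto
      then show "m \<le> \<bar>deriv01 T z\<bar>" using deriv(2)[OF zz(1)] by simp
    qed
    then show ?thesis using that(1) by simp
  qed
  define d where "d = \<bar>x - c\<bar>"
  have d: "0 < d" "d \<le> 1" using x x01 c by (auto simp: d_def)
  have e1: "K * (\<eta> / 2) * d powr r \<le> (K * d powr (r - 1)) * (\<eta> / 2)"
    using powr_mono'[of "r - 1" r d] d b \<eta> by simp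
  have e2: "K * (1 / 2 powr r) * d powr r = (K * (d / 2) powr (r - 1)) * (d / 2)"
    using d by (simp add: powr_divide powr_diff)
  have m: "K * min (\<eta> / 2) (1 / 2 powr r) * d powr r \<le> t" 
    if "t = min (K * (\<eta> / 2) * d powr r) (K * (1 / 2 powr r) * d powr r)" for t
  proof -
    have "K * m * d powr r \<le> K * m' * d powr r" if "m \<le> m'" for m m'
      using b that by (intro mult_right_mono mult_left_mono) auto
    from this[OF min.cobounded1] this[OF min.cobounded2] show ?thesis unfolding that by (rule min.boundedI)
  qed
  have mm: "K * min (\<eta> / 2) (1 / 2 powr r) * d powr r \<le> s"
    if "(K * d powr (r - 1)) * (\<eta> / 2) \<le> p" "(K * (d / 2) powr (r - 1)) * (d / 2) \<le> q" "min p q \<le> s" for p q s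
    using m[OF refl] e1 e2 that by linarith
  show ?thesis
  proof (cases "x < c")
    case True
    have 1: "(K * d powr (r - 1)) * \<bar>x - (x - \<eta> / 2)\<bar> \<le> \<bar>T x - T (x - \<eta> / 2)\<bar>"
      by (rule lower[where s = "d"]) (use True x01 \<eta> d in \<open>auto simp: d_def\<close>)
    have 2: "\<bar>x - (x - \<eta> / 2)\<bar> = \<eta> / 2" using \<eta> by simp
    have 3: "(K * (d / 2) powr (r - 1)) * \<bar>(x + c) / 2 - x\<bar> \<le> \<bar>T ((x + c) / 2) - T x\<bar>"
      by (rule lower[where s = "d / 2"]) (use True x01 \<eta> d in \<open>auto simp: d_def field_simps\<close>)
    have 4: "\<bar>(x + c) / 2 - x\<bar> = d / 2" using True by (auto simp: d_def field_simps)
    have 5: "min \<bar>T x - T (x - \<eta> / 2)\<bar> \<bar>T ((x + c) / 2) - T x\<bar> \<le> min (T x - A) (B - T x)"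
      using koebe_branch_squeeze[OF L, of "x - \<eta> / 2" x "(x + c) / 2"] True x01 \<eta>
      by (simp add: abs_minus_commute)
    show ?thesis using mm[OF 1[unfolded 2] 3[unfolded 4] 5] True by (simp add: d_def)
  next
    case False
    then have xc: "c < x" using x by auto
    have 1: "(K * d powr (r - 1)) * \<bar>(x + \<eta> / 2) - x\<bar> \<le> \<bar>T (x + \<eta> / 2) - T x\<bar>"
      by (rule lower[where s = "d"]) (use xc x01 \<eta> d in \<open>auto simp: d_def\<close>)
    have 2: "\<bar>(x + \<eta> / 2) - x\<bar> = \<eta> / 2" using \<eta> by simp
    have 3: "(K * (d / 2) powr (r - 1)) * \<bar>x - (x + c) / 2\<bar> \<le> \<bar>T x - T ((x + c) / 2)\<bar>"
      by (rule lower[where s = "d / 2"]) (use xc x01 \<eta> d in \<open>auto simp: d_def field_simps\<close>)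
    have 4: "\<bar>x - (x + c) / 2\<bar> = d / 2" using xc by (auto simp: d_def field_simps)
    have 5: "min \<bar>T (x + \<eta> / 2) - T x\<bar> \<bar>T x - T ((x + c) / 2)\<bar> \<le> min (T x - A') (B' - T x)"
      using koebe_branch_squeeze[OF R, of "(x + c) / 2" x "x + \<eta> / 2"] xc x01 \<eta>
      by (simp add: abs_minus_commute min.commute)
    show ?thesis using mm[OF 1[unfolded 2] 3[unfolded 4] 5] False by (simp add: d_def)
  qed
qed

text \<open>The difference quotient converges to a number of modulus greater than 1, hence
  eventually exceeds the midpoint between 1 and that modulus.\<close>

lemma repelling_endpoint:
  assumes diff: "T differentiable (at e within {0..1})" and "1 < \<bar>deriv01 T e\<bar>" and "0 < \<delta>"
  shows "\<forall>\<^sub>F x in at e within {0..1}. (1 + \<bar>deriv01 T e\<bar>) / 2 * \<bar>x - e\<bar> \<le> \<bar>T x - T e\<bar> \<and> \<bar>T x - T e\<bar> < \<delta>"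
proof -
  let ?D = "deriv01 T e"
  have "(T has_vector_derivative ?D) (at e within {0..1})"
    using diff unfolding deriv01_def by (simp add: vector_derivative_works)
  then have hd: "(T has_real_derivative ?D) (at e within {0..1})"
    by (simp add: has_real_derivative_iff_has_vector_derivative)
  then have "((\<lambda>x. (T x - T e) / (x - e)) \<longlongrightarrow> ?D) (at e within {0..1})"
    by (simp add: has_field_derivative_iff)
  then have "((\<lambda>x. \<bar>(T x - T e) / (x - e)\<bar>) \<longlongrightarrow> \<bar>?D\<bar>) (at e within {0..1})" by (rule tendsto_rabs)
  then have 1: "\<forall>\<^sub>F x in at e within {0..1}. (1 + \<bar>?D\<bar>) / 2 < \<bar>(T x - T e) / (x - e)\<bar>"
    by (rule order_tendstoD) (use assms in auto)
  have "(T \<longlongrightarrow> T e) (at e within {0..1})"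
    using has_field_derivative_imp_has_derivative[OF hd] has_derivative_continuous continuous_within by blast
  then have 2: "\<forall>\<^sub>F x in at e within {0..1}. dist (T x) (T e) < \<delta>" using assms(3) by (rule tendstoD)
  have 3: "\<forall>\<^sub>F x in at e within {0..1}. x \<noteq> e" by (simp add: eventually_at_filter)
  show ?thesis using 1 2 3
  proof eventually_elim
    case (elim x)
    then show ?case by (auto simp: abs_divide field_simps dist_real_def)
  qed
qed

lemma edge_repelling:
  assumes c: "0 < c" "c < 1" and im: "T ` {0..1} \<subseteq> {0..1}" and ends: "T 0 \<in> {0, 1}" "T 1 \<in> {0, 1}"
    and S: "nonpos_schwarzian_on {0..<c} T" "nonpos_schwarzian_on {c<..1} T"
    and D: "1 < \<bar>deriv01 T 0\<bar>" "1 < \<bar>deriv01 T 1\<bar>" and "0 < \<delta>"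
  shows "\<exists>a>1. \<forall>\<^sub>F \<eta> in at_right 0. \<forall>x\<in>{0<..<1}. edge x < \<eta> \<longrightarrow> a * edge x \<le> edge (T x) \<and> edge (T x) < \<delta>"
proof -
  define a where "a = min ((1 + \<bar>deriv01 T 0\<bar>) / 2) ((1 + \<bar>deriv01 T 1\<bar>) / 2)"
  have a: "1 < a" using D by (simp add: a_def)
  have a01: "a \<le> (1 + \<bar>deriv01 T 0\<bar>) / 2" "a \<le> (1 + \<bar>deriv01 T 1\<bar>) / 2" unfolding a_def by (rule min.cobounded1, rule min.cobounded2)
  have diff: "T differentiable (at 0 within {0..1})" "T differentiable (at 1 within {0..1})"
  proof -
    have "((deriv01 ^^ 0) T) differentiable (at x within {0..1})" if "x \<in> {0..<c} \<union> {c<..1}" for x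
      using S that unfolding nonpos_schwarzian_on_def thrice_differentiable_on_def by (metis Un_iff zero_less_numeral)
    then show "T differentiable (at 0 within {0..1})" "T differentiable (at 1 within {0..1})" using c by auto
  qed
  \<comment> \<open>A point within 1/2 of an endpoint has that endpoint as its nearest one. So
    \<open>edge (T x)\<close> is the distance from T x to the image of the nearby endpoint, which is
    itself 0 or 1.\<close>
  define \<delta>' where "\<delta>' = min \<delta> (1/2)"
  have \<delta>': "0 < \<delta>'" using assms by (simp add: \<delta>'_def)
  obtain d0 where d0: "0 < d0" "\<And>x. x \<in> {0..1} \<Longrightarrow> x \<noteq> 0 \<Longrightarrow> dist x 0 < d0 \<Longrightarrow>
      (1 + \<bar>deriv01 T 0\<bar>) / 2 * \<bar>x - 0\<bar> \<le> \<bar>T x - T 0\<bar> \<and> \<bar>T x - T 0\<bar> < \<delta>'"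
    using repelling_endpoint[OF diff(1) D(1) \<delta>'] unfolding eventually_at by blast
  obtain d1 where d1: "0 < d1" "\<And>x. x \<in> {0..1} \<Longrightarrow> x \<noteq> 1 \<Longrightarrow> dist x 1 < d1 \<Longrightarrow>
      (1 + \<bar>deriv01 T 1\<bar>) / 2 * \<bar>x - 1\<bar> \<le> \<bar>T x - T 1\<bar> \<and> \<bar>T x - T 1\<bar> < \<delta>'"
    using repelling_endpoint[OF diff(2) D(2) \<delta>'] unfolding eventually_at by blast
  have main: "a * edge x \<le> edge (T x) \<and> edge (T x) < \<delta>" if x: "x \<in> {0<..<1}" "edge x < min d0 d1" for x
  proof -
    have Tx: "T x \<in> {0..1}" by (rule subsetD[OF im], rule imageI) (use x in auto)
    have e: "edge x \<le> x" "edge x \<le> 1 - x" "0 \<le> edge x" using x by (auto simp: edge_def)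
    have "\<exists>e\<in>{0,1}. a * edge x \<le> \<bar>T x - T e\<bar> \<and> \<bar>T x - T e\<bar> < \<delta>'"
    proof (cases "x < d0")
      case True
      then have *: "(1 + \<bar>deriv01 T 0\<bar>) / 2 * \<bar>x - 0\<bar> \<le> \<bar>T x - T 0\<bar> \<and> \<bar>T x - T 0\<bar> < \<delta>'"
        using d0(2)[of x] x by (simp add: dist_real_def)
      have "a * edge x \<le> (1 + \<bar>deriv01 T 0\<bar>) / 2 * \<bar>x - 0\<bar>"
        using e a x by (intro mult_mono a01) auto
      then show ?thesis using * by auto
    next
      case False
      then have "1 - x < d1" using x by (auto simp: edge_def)
      then have *: "(1 + \<bar>deriv01 T 1\<bar>) / 2 * \<bar>x - 1\<bar> \<le> \<bar>T x - T 1\<bar> \<and> \<bar>T x - T 1\<bar> < \<delta>'"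
        using d1(2)[of x] x by (simp add: dist_real_def)
      have "a * edge x \<le> (1 + \<bar>deriv01 T 1\<bar>) / 2 * \<bar>x - 1\<bar>"
        using e a x by (intro mult_mono a01) auto
      then show ?thesis using * by auto
    qed
    then obtain t where t: "t \<in> {0, 1}" "a * edge x \<le> \<bar>T x - t\<bar>" "\<bar>T x - t\<bar> < \<delta>'" using ends by auto
    have "edge (T x) = \<bar>T x - t\<bar>" using t Tx by (auto simp: edge_def \<delta>'_def)
    then show ?thesis using t by (simp add: \<delta>'_def)
  qed
  have "\<forall>\<^sub>F \<eta> in at_right (0::real). \<eta> \<in> {0<..<min d0 d1}"
    by (rule eventually_at_right_real) (use d0 d1 in auto)
  then have "\<forall>\<^sub>F \<eta> in at_right 0. \<forall>x\<in>{0<..<1}. edge x < \<eta> \<longrightarrow> a * edge x \<le> edge (T x) \<and> edge (T x) < \<delta>"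
    by eventually_elim (use main in auto)
  then show ?thesis using a by blast
qed

lemma good_maps_branches:
  assumes c: "0 < c" "c < 1" and T: "T \<in> good_maps c"
  shows "koebe_branch 0 c 0 1 T" "koebe_branch c 1 0 1 T"
proof -
  obtain r K M where "1 \<le> r" "0 < K" "deriv_bounds c T r K M" using T unfolding good_maps_def by blast
  then show "koebe_branch 0 c 0 1 T" "koebe_branch c 1 0 1 T"
    using T c unfolding good_maps_def by (auto intro!: koebe_branch_left koebe_branch_right)
qed

lemma bad_maps_branches:
  assumes c: "0 < c" "c < 1" and T: "T \<in> bad_maps c"
  shows "koebe_branch 0 c 0 c T \<or> koebe_branch 0 c c 1 T" "koebe_branch c 1 0 c T \<or> koebe_branch c 1 c 1 T"
proof -
  obtain l K M where l: "1 < l" "0 < K" "deriv_bounds c T l K M"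
    using T unfolding bad_maps_def bad_exponent_def by blast
  obtain R R' where R: "R \<in> {{0<..<c}, {c<..<1}}" "C3_diffeo {0<..<c} R T"
    and R': "R' \<in> {{0<..<c}, {c<..<1}}" "C3_diffeo {c<..<1} R' T"
    using T unfolding bad_maps_def by blast
  have S: "nonpos_schwarzian_on {0..<c} T" "nonpos_schwarzian_on {c<..1} T" using T unfolding bad_maps_def by auto
  show "koebe_branch 0 c 0 c T \<or> koebe_branch 0 c c 1 T"
    using R koebe_branch_left[OF c _ S(1) l(3) _ l(2)] l by auto
  show "koebe_branch c 1 0 c T \<or> koebe_branch c 1 c 1 T"
    using R' koebe_branch_right[OF c _ S(2) l(3) _ l(2)] l by auto
qed

text \<open>A good map sends \<open>c\<close> to 0 or 1, a bad map fixes it.\<close>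

lemma good_bad_disjoint:
  assumes "0 < c" "c < 1" "T \<in> good_maps c" shows "T \<notin> bad_maps c"
  using assms unfolding good_maps_def bad_maps_def by auto

lemma maps_edge_repelling:
  assumes c: "0 < c" "c < 1" and T: "T \<in> good_maps c \<union> bad_maps c" and "0 < \<delta>"
  shows "\<exists>a>1. \<forall>\<^sub>F \<eta> in at_right 0. \<forall>x\<in>{0<..<1}. edge x < \<eta> \<longrightarrow> a * edge x \<le> edge (T x) \<and> edge (T x) < \<delta>"
  by (rule edge_repelling[OF c]) (use T assms(4) in \<open>auto simp: good_maps_def bad_maps_def\<close>)

lemma good_maps_away_from_edge:
  assumes c: "0 < c" "c < 1" and T: "T \<in> good_maps c" and \<eta>: "0 < \<eta>"
  shows "\<exists>k>0. \<exists>r\<ge>1. \<forall>x\<in>{0<..<c} \<union> {c<..<1}. \<eta> \<le> edge x \<longrightarrow> k * \<bar>x - c\<bar> powr r \<le> edge (T x)"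
proof -
  obtain r K M where b: "deriv_bounds c T r K M" "1 \<le> r" "0 < K" using T unfolding good_maps_def by blast
  note br = good_maps_branches[OF c T]
  have "K * min (\<eta> / 2) (1 / 2 powr r) * \<bar>x - c\<bar> powr r \<le> edge (T x)"
    if "x \<in> {0<..<c} \<union> {c<..<1}" "\<eta> \<le> edge x" for x
    using away_from_edge[OF c b br \<eta> that(2)] that(1) by (auto simp: edge_def split: if_splits)
  then show ?thesis using b \<eta>
    by (intro exI[of _ "K * min (\<eta> / 2) (1 / 2 powr r)"] exI[of _ r] conjI) auto
qed

text \<open>The range of each branch of a bad map is (0,c) or (c,1), so the distance to the ends of
  the range bounds from below both the distance to {0,1} and the distance to
  \<open>c\<close>.\<close>

lemma bad_maps_away_from_edge:
  assumes c: "0 < c" "c < 1" and T: "T \<in> bad_maps c" and l: "bad_exponent c T l" and \<eta>: "0 < \<eta>"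
  shows "\<exists>k>0. \<forall>x\<in>{0<..<c} \<union> {c<..<1}. \<eta> \<le> edge x \<longrightarrow>
    k * \<bar>x - c\<bar> powr l \<le> edge (T x) \<and> k * \<bar>x - c\<bar> powr l \<le> \<bar>T x - c\<bar>"
proof -
  obtain K M where b: "deriv_bounds c T l K M" "1 \<le> l" "0 < K" using l unfolding bad_exponent_def by auto
  obtain A B where L: "koebe_branch 0 c A B T" "(A, B) \<in> {(0, c), (c, 1)}" using bad_maps_branches(1)[OF c T] by auto
  obtain A' B' where R: "koebe_branch c 1 A' B' T" "(A', B') \<in> {(0, c), (c, 1)}" using bad_maps_branches(2)[OF c T] by auto
  have "K * min (\<eta> / 2) (1 / 2 powr l) * \<bar>x - c\<bar> powr l \<le> edge (T x) \<and>
      K * min (\<eta> / 2) (1 / 2 powr l) * \<bar>x - c\<bar> powr l \<le> \<bar>T x - c\<bar>"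
    if "x \<in> {0<..<c} \<union> {c<..<1}" "\<eta> \<le> edge x" for x
    using away_from_edge[OF c b L(1) R(1) \<eta> that(2)] that(1) L(2) R(2) c
    by (auto simp: edge_def split: if_splits)
  then show ?thesis using b \<eta>
    by (intro exI[of _ "K * min (\<eta> / 2) (1 / 2 powr l)"] conjI) auto
qed

section \<open>A zero-one law for full branch maps\<close>

text \<open>Bounded distortion in integrated form. With both points at depth \<delta> the Harnack
  inequality compares any two values up to the factor \<delta>^4; averaging over the middle
  interval, whose length is at most 1, gives the claim.\<close>

lemma koebe_proportion:
  assumes f: "koebe 0 1 f" and \<delta>: "0 < \<delta>" and [measurable]: "X \<in> sets borel" and X: "X \<subseteq> {\<delta><..<1 - \<delta>}"
  shows "emeasure lborel X * ennreal (\<delta> ^ 4) * (\<integral>\<^sup>+x. indicator {\<delta><..<1 - \<delta>} x * ennreal (f x) \<partial>lborel)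
    \<le> (\<integral>\<^sup>+x. indicator X x * ennreal (f x) \<partial>lborel)"
proof -
  let ?K = "{\<delta><..<1 - \<delta>}"
  have mf: "(\<lambda>x. indicator {0<..<1} x * f x) \<in> borel_measurable borel" by (rule koebe_measurable[OF f])
  have "(\<lambda>x. indicator ?K x * ennreal (indicator {0<..<1} x * f x)) \<in> borel_measurable borel"
    using mf by measurable
  moreover have "(\<lambda>x. indicator ?K x * ennreal (indicator {0<..<1} x * f x)) = (\<lambda>x. indicator ?K x * ennreal (f x))"
    using \<delta> by (auto split: split_indicator)
  ultimately have [measurable]: "(\<lambda>x. indicator ?K x * ennreal (f x)) \<in> borel_measurable borel" by simp
  define I where "I = (\<integral>\<^sup>+x. indicator X x * ennreal (f x) \<partial>lborel)"
  have le: "emeasure lborel X * ennreal (\<delta> ^ 4) * ennreal (f y) \<le> I" if y: "y \<in> ?K" for y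
  proof -
    have fx: "\<delta> ^ 4 * f y \<le> f x" if "x \<in> X" for x
    proof -
      have x: "x \<in> ?K" using X that by auto
      have "\<delta> ^ 4 * f y = \<delta>\<^sup>2 * f y * \<delta>\<^sup>2" by (simp add: power2_eq_square eval_nat_numeral)
      also have "\<dots> \<le> \<delta>\<^sup>2 * f y * (min (y - 0) (1 - y))\<^sup>2"
        using koebe_nonneg[OF f] x y \<delta> by (intro mult_left_mono power_mono) auto
      also have "\<dots> \<le> f x" using x y \<delta> by (intro koebe_compare(1)[OF f]) auto
      finally show ?thesis .
    qed
    have "0 \<le> f y" using koebe_nonneg[OF f] y \<delta> by auto
    then have "emeasure lborel X * ennreal (\<delta> ^ 4) * ennreal (f y) = ennreal (\<delta> ^ 4 * f y) * emeasure lborel X"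
      using \<delta> by (simp add: ennreal_mult mult_ac)
    also have "\<dots> = (\<integral>\<^sup>+x. ennreal (\<delta> ^ 4 * f y) * indicator X x \<partial>lborel)"
      by (simp add: nn_integral_cmult_indicator)
    also have "\<dots> \<le> I" unfolding I_def
      using fx by (intro nn_integral_mono) (auto split: split_indicator intro: ennreal_leI)
    finally show ?thesis .
  qed
  have "emeasure lborel X * ennreal (\<delta> ^ 4) * (\<integral>\<^sup>+x. indicator ?K x * ennreal (f x) \<partial>lborel)
      = (\<integral>\<^sup>+x. emeasure lborel X * ennreal (\<delta> ^ 4) * (indicator ?K x * ennreal (f x)) \<partial>lborel)"
    by (subst nn_integral_cmult) auto
  also have "\<dots> \<le> (\<integral>\<^sup>+x. I * indicator ?K x \<partial>lborel)"
    using le by (intro nn_integral_mono) (auto split: split_indicator)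
  also have "\<dots> = I * emeasure lborel ?K" by (simp add: nn_integral_cmult_indicator)
  also have "\<dots> \<le> I * 1"
    using \<delta> by (intro mult_left_mono) (cases "\<delta> \<le> 1 - \<delta>", auto simp: ennreal_le_1)
  finally show ?thesis by (simp add: I_def)
qed

text \<open>If \<open>S\<close> had measure s > 0, enclose it in an open set with excess less than
  \<kappa> s and choose disjoint covering balls inside that set. Each contains a share \<kappa> of
  \<open>Z\<close>, which is disjoint from \<open>S\<close>, so together they need more room than
  the excess offers. The points of \<open>S\<close> need not be the centres of the balls.\<close>

lemma null_by_vitali:
  fixes S Z :: "real set"
  assumes [measurable]: "S \<in> sets borel" "Z \<in> sets borel" and fin: "emeasure lborel S < \<infinity>" and disj: "S \<inter> Z = {}" and \<kappa>: "0 < \<kappa>"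
    and cover: "\<And>x d. x \<in> S \<Longrightarrow> 0 < d \<Longrightarrow> \<exists>a r. 0 < r \<and> r < d \<and> x \<in> cball a r \<and> ennreal (\<kappa> * (2 * r)) \<le> emeasure lborel (Z \<inter> cball a r)"
  shows "emeasure lborel S = 0"
proof (rule ccontr)
  assume nz: "emeasure lborel S \<noteq> 0"
  define s where "s = measure lborel S"
  have s: "emeasure lborel S = ennreal s" using fin by (simp add: s_def emeasure_eq_ennreal_measure less_top)
  then have s0: "0 < s" using nz by (metis ennreal_eq_0_iff linorder_not_le)
  then have "0 < ennreal (\<kappa> * s)" using \<kappa> by simp
  then obtain O' where O': "open O'" "S \<subseteq> O'" "emeasure lborel (O' - S) < ennreal (\<kappa> * s)"
    using outer_regular_lborel[of S "\<kappa> * s"] \<kappa> s0 by auto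
  define K where "K = {(a, r). 0 < r \<and> cball a r \<subseteq> O' \<and> ennreal (\<kappa> * (2 * r)) \<le> emeasure lborel (Z \<inter> cball a r)}"
  obtain C where C: "countable C" "C \<subseteq> K"
      "pairwise (\<lambda>i j. disjnt (cball (fst i) (snd i)) (cball (fst j) (snd j))) C"
      "negligible (S - (\<Union>i\<in>C. cball (fst i) (snd i)))"
  proof (rule Vitali_covering_theorem_cballs[of K snd S fst])
    fix x d assume x: "x \<in> S" and d: "(0::real) < d"
    obtain e where e: "0 < e" "ball x e \<subseteq> O'" using O' x by (meson openE subsetD)
    obtain a r where ar: "0 < r" "r < min d (e / 2)" "x \<in> cball a r" "ennreal (\<kappa> * (2 * r)) \<le> emeasure lborel (Z \<inter> cball a r)"
      using cover[OF x, of "min d (e / 2)"] d e by auto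
    have "cball a r \<subseteq> ball x e"
    proof
      fix y assume "y \<in> cball a r"
      then have "dist x y \<le> r + r" using ar(3) dist_triangle[of x y a] by (simp add: dist_commute)
      then show "y \<in> ball x e" using ar(2) by simp
    qed
    then show "\<exists>i. i \<in> K \<and> x \<in> cball (fst i) (snd i) \<and> snd i < d"
      using ar e by (intro exI[of _ "(a, r)"]) (auto simp: K_def)
  next
    show "0 < snd i" if "i \<in> K" for i using that by (auto simp: K_def)
  qed (rule that)
  let ?B = "\<lambda>i. cball (fst i) (snd i) :: real set"
  have CK: "0 < snd i" "?B i \<subseteq> O'" "ennreal (\<kappa> * (2 * snd i)) \<le> emeasure lborel (Z \<inter> ?B i)" if "i \<in> C" for i
  proof -
    have "(fst i, snd i) \<in> K" using C(2) that by auto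
    then show "0 < snd i" "?B i \<subseteq> O'" "ennreal (\<kappa> * (2 * snd i)) \<le> emeasure lborel (Z \<inter> ?B i)"
      unfolding K_def by (simp_all add: case_prod_beta)
  qed
  have disjB: "disjoint_family_on ?B C" using C(3) by (auto simp: disjoint_family_on_def pairwise_def disjnt_def)
  have eB: "emeasure lborel (?B i) = ennreal (2 * snd i)" if "i \<in> C" for i
    using CK(1)[OF that] by (simp add: cball_eq_atLeastAtMost)
  let ?U = "\<Union>i\<in>C. ?B i"
  have [measurable]: "?U \<in> sets borel" using C(1) by (intro sets.countable_UN') auto
  have SU: "emeasure lborel S \<le> emeasure lborel ?U"
  proof -
    have "emeasure lborel (S - ?U) = 0"
      using C(4) by (subst (asm) negligible_iff_null_sets) (simp add: null_sets_completion_iff null_setsD1)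
    have "emeasure lborel S \<le> emeasure lborel (?U \<union> (S - ?U))" by (intro emeasure_mono) auto
    also have "\<dots> \<le> emeasure lborel ?U + emeasure lborel (S - ?U)" by (intro emeasure_subadditive) auto
    finally show ?thesis using \<open>emeasure lborel (S - ?U) = 0\<close> by simp
  qed
  have "ennreal \<kappa> * emeasure lborel ?U = ennreal \<kappa> * (\<integral>\<^sup>+i. emeasure lborel (?B i) \<partial>count_space C)"
    using C(1) disjB by (subst emeasure_UN_countable) auto
  also have "\<dots> = (\<integral>\<^sup>+i. ennreal \<kappa> * emeasure lborel (?B i) \<partial>count_space C)"
    by (subst nn_integral_cmult) auto
  also have "\<dots> \<le> (\<integral>\<^sup>+i. emeasure lborel (Z \<inter> ?B i) \<partial>count_space C)"
    using CK eB \<kappa> by (intro nn_integral_mono) (auto simp: ennreal_mult[symmetric] less_imp_le)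
  also have "\<dots> = emeasure lborel (\<Union>i\<in>C. Z \<inter> ?B i)"
  proof (rule emeasure_UN_countable[symmetric])
    show "disjoint_family_on (\<lambda>i. Z \<inter> ?B i) C" using disjB unfolding disjoint_family_on_def by blast
  qed (use C(1) in auto)
  also have "\<dots> \<le> emeasure lborel (O' - S)"
  proof (rule emeasure_mono)
    show "(\<Union>i\<in>C. Z \<inter> ?B i) \<subseteq> O' - S" using CK(2) disj by blast
  qed (use O' in auto)
  finally have "ennreal \<kappa> * emeasure lborel ?U \<le> emeasure lborel (O' - S)" .
  moreover have "ennreal (\<kappa> * s) \<le> ennreal \<kappa> * emeasure lborel ?U"
    using SU \<kappa> by (simp add: ennreal_mult' s mult_left_mono)
  ultimately show False using O'(3) by (meson le_less_trans not_less)
qed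

section \<open>Inverse branches of the iterates of one full branch map\<close>

locale full_branch_map =
  fixes c :: real and T :: "real \<Rightarrow> real" and a \<eta> :: real
  assumes c: "0 < c" "c < 1" and T_meas[measurable]: "T \<in> borel_measurable borel"
    and left: "koebe_branch 0 c 0 1 T" and right: "koebe_branch c 1 0 1 T"
    and a: "1 < a" and \<eta>: "0 < \<eta>"
    and repel: "\<And>x. x \<in> {0<..<1} \<Longrightarrow> edge x < \<eta> \<Longrightarrow> a * edge x \<le> edge (T x)"
begin

definition lo :: "bool \<Rightarrow> real" where "lo b = (if b then 0 else c)"
definition hi :: "bool \<Rightarrow> real" where "hi b = (if b then c else 1)"

definition cyl :: "(nat \<Rightarrow> bool) \<Rightarrow> nat \<Rightarrow> real set" where
  "cyl s n = {y \<in> {0<..<1}. \<forall>k<n. (T ^^ k) y \<in> {lo (s k)<..<hi (s k)}}"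

text \<open>The density of the image under the n-th iterate of Lebesgue measure on
  \<open>cyl s n\<close>, that is, the absolute derivative of the inverse branch with itinerary
  \<open>s\<close>.\<close>

fun rho :: "(nat \<Rightarrow> bool) \<Rightarrow> nat \<Rightarrow> real \<Rightarrow> real" where
  "rho s 0 = (\<lambda>_. 1)"
| "rho s (Suc n) = push (lo (s n)) (hi (s n)) T (rho s n)"

lemma lo_hi: "0 \<le> lo b" "hi b \<le> 1" "lo b < hi b" "{lo b<..<hi b} \<subseteq> {0<..<1}"
  using c by (auto simp: lo_def hi_def)

lemma branch: "koebe_branch (lo b) (hi b) 0 1 T"
  using left right by (simp add: lo_def hi_def)

text \<open>Every branch is onto (0,1), so restriction to half of (0,1) followed by
  \<open>push\<close> returns to the cone over (0,1). The distortion constants are therefore the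
  same for all \<open>n\<close> and all itineraries.\<close>

lemma rho_koebe: "koebe 0 1 (rho s n)"
proof (induction n)
  case (Suc n)
  show ?case unfolding rho.simps
    by (rule push_koebe[OF branch koebe_subinterval[OF Suc lo_hi(1,2)]])
qed (simp add: koebe_const)

lemma rho_pos: "x \<in> {0<..<1} \<Longrightarrow> 0 < rho s n x"
proof (induction n arbitrary: x)
  case (Suc n)
  have "x \<in> T ` {lo (s n)<..<hi (s n)}" using Suc.prems koebe_branch_image[OF branch] by auto
  then obtain y where y: "y \<in> {lo (s n)<..<hi (s n)}" "x = T y" by auto
  have "0 < rho s n y" using Suc.IH y lo_hi by blast
  then show ?case
    using koebe_branch_deriv(2)[OF branch y(1)] by (simp add: y(2) push_image[OF koebe_branch_inj[OF branch] y(1)])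
qed simp

lemma funpow_measurable[measurable]: "(T ^^ n) \<in> borel_measurable borel"
  by (induction n) (auto intro: measurable_comp[OF _ T_meas])

lemma cyl_Suc: "cyl s (Suc n) = cyl s n \<inter> (T ^^ n) -` {lo (s n)<..<hi (s n)}"
  by (auto simp: cyl_def less_Suc_eq)

lemma cyl_measurable[measurable]: "cyl s n \<in> sets borel"
proof (induction n)
  case (Suc n)
  have "(T ^^ n) -` {lo (s n)<..<hi (s n)} \<in> sets borel"
    using measurable_sets_borel[OF funpow_measurable] by auto
  with Suc show ?case unfolding cyl_Suc by auto
qed (simp add: cyl_def greaterThanLessThan_def[symmetric])

lemma vimage_borel: "X \<in> sets borel \<Longrightarrow> (T ^^ n) -` X \<in> sets borel"
  using measurable_sets_borel[OF funpow_measurable] by auto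

lemma emeasure_cyl:
  assumes "X \<in> sets borel" "X \<subseteq> {0<..<1}"
  shows "emeasure lborel (cyl s n \<inter> (T ^^ n) -` X) = (\<integral>\<^sup>+x. indicator X x * ennreal (rho s n x) \<partial>lborel)"
  using assms
proof (induction n arbitrary: X)
  case 0
  then have "cyl s 0 \<inter> (T ^^ 0) -` X = X" by (auto simp: cyl_def)
  then show ?case using 0 by simp
next
  case (Suc n)
  note [measurable] = Suc.prems(1)
  let ?J = "{lo (s n)<..<hi (s n)}"
  have [measurable]: "T -` X \<in> sets borel" using vimage_borel[of X 1] Suc.prems by simp
  have "cyl s (Suc n) \<inter> (T ^^ Suc n) -` X = cyl s n \<inter> (T ^^ n) -` (?J \<inter> T -` X)"
    unfolding cyl_Suc by auto
  also have "emeasure lborel \<dots> = (\<integral>\<^sup>+x. indicator (?J \<inter> T -` X) x * ennreal (rho s n x) \<partial>lborel)"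
    using lo_hi(4)[of "s n"] by (intro Suc.IH) auto
  also have "\<dots> = (\<integral>\<^sup>+x. indicator ?J x * (indicator X (T x) * ennreal (rho s n x)) \<partial>lborel)"
    by (intro nn_integral_cong) (auto split: split_indicator)
  also have "\<dots> = (\<integral>\<^sup>+x. indicator X x * ennreal (rho s (Suc n) x) \<partial>lborel)"
    unfolding rho.simps
    by (rule nn_integral_push[OF branch T_meas koebe_subinterval[OF rho_koebe lo_hi(1,2)], symmetric]) simp
  finally show ?case .
qed

text \<open>Preimages of intervals under monotone branches are intervals. This makes the pieces of
  the Vitali cover balls, up to their endpoints.\<close>

lemma interval_cyl:
  assumes "is_interval J" "J \<subseteq> {0<..<1}"
  shows "is_interval (cyl s n \<inter> (T ^^ n) -` J)"
  using assms
proof (induction n arbitrary: J)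
  case 0
  then have "cyl s 0 \<inter> (T ^^ 0) -` J = J" by (auto simp: cyl_def)
  then show ?case using 0 by simp
next
  case (Suc n)
  let ?I = "{lo (s n)<..<hi (s n)}"
  have "is_interval (?I \<inter> T -` J)"
    unfolding is_interval_1
  proof (intro ballI allI impI)
    fix u v x assume u: "u \<in> ?I \<inter> T -` J" and v: "v \<in> ?I \<inter> T -` J" and x: "u \<le> x \<and> x \<le> v"
    have "T u \<le> T x \<and> T x \<le> T v \<or> T v \<le> T x \<and> T x \<le> T u"
    proof (cases "u = x \<or> x = v")
      case True
      then show ?thesis by auto
    next
      case False
      then have "lo (s n) < u" "u < x" "x < v" "v < hi (s n)" using u v x by auto
      then show ?thesis using branch[of "s n"] unfolding koebe_branch_def
        by (meson less_imp_le less_trans)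
    qed
    moreover have "T u \<in> J" "T v \<in> J" using u v by auto
    ultimately have "T x \<in> J" using Suc.prems(1) unfolding is_interval_1 by blast
    then show "x \<in> ?I \<inter> T -` J" using u v x by auto
  qed
  moreover have "cyl s (Suc n) \<inter> (T ^^ Suc n) -` J = cyl s n \<inter> (T ^^ n) -` (?I \<inter> T -` J)"
    unfolding cyl_Suc by auto
  moreover have "?I \<inter> T -` J \<subseteq> {0<..<1}" using lo_hi(4)[of "s n"] by auto
  ultimately show ?case using Suc.IH[of "?I \<inter> T -` J"] by (simp only:)
qed

lemma cyl_shrink:
  assumes \<delta>: "0 < \<delta>" "\<delta> < c" "\<delta> < 1 - c"
  shows "(\<lambda>n. measure lborel (cyl s n \<inter> (T ^^ n) -` {\<delta><..<1 - \<delta>})) \<longlonglongrightarrow> 0"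
proof -
  \<comment> \<open>The half of the \<open>n\<close>-th interval that is cut off at time \<open>n\<close> has a definite share of its
    length, and these halves are pairwise disjoint.\<close>
  let ?K = "{\<delta><..<1 - \<delta>}"
  let ?H = "\<lambda>b. ?K \<inter> {lo b<..<hi b}"
  define R where "R n = cyl s n \<inter> (T ^^ n) -` ?H (\<not> s n)" for n
  have [measurable]: "R n \<in> sets borel" for n unfolding R_def using vimage_borel by auto
  have cylfin: "emeasure lborel (cyl s n \<inter> X) < \<infinity>" if "X \<in> sets borel" for n X
  proof -
    have "emeasure lborel (cyl s n \<inter> X) \<le> emeasure lborel {0<..<1::real}"
      using that by (intro emeasure_mono) (auto simp: cyl_def)
    then show ?thesis by (simp add: le_less_trans)
  qed
  \<comment> \<open>The first factor is the length of the shorter half of the middle interval, cut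
    at \<open>c\<close>; the second is the distortion constant of
    \<open>koebe_proportion\<close>.\<close>
  define q where "q = min (c - \<delta>) (1 - \<delta> - c) * \<delta> ^ 4"
  have q: "0 < q" using \<delta> by (simp add: q_def)
  have len: "q * measure lborel (cyl s n \<inter> (T ^^ n) -` ?K) \<le> measure lborel (R n)" for n
  proof -
    have H: "ennreal (min (c - \<delta>) (1 - \<delta> - c)) \<le> emeasure lborel (?H b)" for b
    proof -
      have "?H b = {max \<delta> (lo b)<..<min (1 - \<delta>) (hi b)}" by auto
      moreover have "min (c - \<delta>) (1 - \<delta> - c) \<le> min (1 - \<delta>) (hi b) - max \<delta> (lo b)" "max \<delta> (lo b) \<le> min (1 - \<delta>) (hi b)"
        using \<delta> by (auto simp: lo_def hi_def)
      ultimately show ?thesis by (simp add: ennreal_leI)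
    qed
    have "ennreal q * emeasure lborel (cyl s n \<inter> (T ^^ n) -` ?K)
        = ennreal (min (c - \<delta>) (1 - \<delta> - c)) * ennreal (\<delta> ^ 4) * emeasure lborel (cyl s n \<inter> (T ^^ n) -` ?K)"
      using \<delta> by (simp add: q_def ennreal_mult)
    also have "\<dots> \<le> emeasure lborel (?H (\<not> s n)) * ennreal (\<delta> ^ 4) * emeasure lborel (cyl s n \<inter> (T ^^ n) -` ?K)"
      by (intro mult_right_mono H) auto
    also have "\<dots> \<le> emeasure lborel (R n)"
    proof -
      have "emeasure lborel (R n) = (\<integral>\<^sup>+x. indicator (?H (\<not> s n)) x * ennreal (rho s n x) \<partial>lborel)"
        unfolding R_def using \<delta> by (intro emeasure_cyl) auto
      moreover have "emeasure lborel (cyl s n \<inter> (T ^^ n) -` ?K) = (\<integral>\<^sup>+x. indicator ?K x * ennreal (rho s n x) \<partial>lborel)"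
        using \<delta> by (intro emeasure_cyl) auto
      moreover have "emeasure lborel (?H (\<not> s n)) * ennreal (\<delta> ^ 4) * (\<integral>\<^sup>+x. indicator ?K x * ennreal (rho s n x) \<partial>lborel)
          \<le> (\<integral>\<^sup>+x. indicator (?H (\<not> s n)) x * ennreal (rho s n x) \<partial>lborel)"
        by (intro koebe_proportion rho_koebe \<delta>) auto
      ultimately show ?thesis by (simp only:)
    qed
    finally have "ennreal q * emeasure lborel (cyl s n \<inter> (T ^^ n) -` ?K) \<le> emeasure lborel (R n)" .
    moreover have "emeasure lborel (R n) = ennreal (measure lborel (R n))"
      unfolding R_def using cylfin[OF vimage_borel] by (intro emeasure_eq_ennreal_measure) (auto simp: less_top)
    moreover have "emeasure lborel (cyl s n \<inter> (T ^^ n) -` ?K) = ennreal (measure lborel (cyl s n \<inter> (T ^^ n) -` ?K))"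
      using cylfin[OF vimage_borel] by (intro emeasure_eq_ennreal_measure) (auto simp: less_top)
    ultimately show ?thesis using q by (simp add: ennreal_mult[symmetric])
  qed
  have "disjoint_family R"
  proof -
    have "R m \<inter> R n = {}" if "m < n" for m n
    proof -
      have "(T ^^ m) y \<in> {lo (s m)<..<hi (s m)}" if "y \<in> R n" for y
        using that \<open>m < n\<close> by (auto simp: R_def cyl_def)
      moreover have "{lo (s m)<..<hi (s m)} \<inter> {lo (\<not> s m)<..<hi (\<not> s m)} = {}" by (auto simp: lo_def hi_def)
      ultimately show ?thesis by (fastforce simp: R_def)
    qed
    then show ?thesis unfolding disjoint_family_on_def by (metis Int_commute linorder_neqE_nat)
  qed
  moreover have "emeasure lborel (\<Union>n. R n) \<noteq> \<infinity>"
  proof -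
    have "emeasure lborel (\<Union>n. R n) \<le> emeasure lborel {0<..<1::real}"
      by (intro emeasure_mono) (auto simp: R_def cyl_def)
    then show ?thesis by (auto simp: top_unique)
  qed
  ultimately have "summable (\<lambda>n. measure lborel (R n))"
    by (intro sums_summable[OF measure_UNION]) auto
  then have R0: "(\<lambda>n. measure lborel (R n)) \<longlonglongrightarrow> 0" by (rule summable_LIMSEQ_zero)
  have "(\<lambda>n. measure lborel (R n) / q) \<longlonglongrightarrow> 0 / q" by (rule tendsto_divide[OF R0 tendsto_const]) (use q in simp)
  then have R0': "(\<lambda>n. measure lborel (R n) / q) \<longlonglongrightarrow> 0" by simp
  show ?thesis
    by (rule tendsto_sandwich[OF _ _ tendsto_const R0'])
      (use len q in \<open>auto simp: pos_le_divide_eq mult.commute\<close>)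
qed

definition pre :: "real set \<Rightarrow> real set" where
  "pre X = ({0<..<c} \<union> {c<..<1}) \<inter> T -` X"

lemma pre_null:
  assumes "X \<in> null_sets lborel" shows "pre X \<in> null_sets lborel"
proof -
  have X: "X \<in> sets borel" using assms by auto
  have "emeasure lborel ({lo b<..<hi b} \<inter> T -` X) = 0" for b
  proof -
    have "AE x in lborel. ennreal (push (lo b) (hi b) T (\<lambda>_. 1) x) * indicator X x = 0"
      using AE_not_in[OF assms] by eventually_elim simp
    then have "(\<integral>\<^sup>+x. ennreal (push (lo b) (hi b) T (\<lambda>_. 1) x) * indicator X x \<partial>lborel) = (\<integral>\<^sup>+x. 0 \<partial>(lborel :: real measure))"
      by (rule nn_integral_cong_AE)
    then show ?thesis using koebe_branch_lborel[OF branch T_meas X, of b] by simp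
  qed
  then have "{lo b<..<hi b} \<inter> T -` X \<in> null_sets lborel" for b
    using vimage_borel[OF X, of 1] by auto
  then have "({lo True<..<hi True} \<inter> T -` X) \<union> ({lo False<..<hi False} \<inter> T -` X) \<in> null_sets lborel" by blast
  moreover have "pre X = ({lo True<..<hi True} \<inter> T -` X) \<union> ({lo False<..<hi False} \<inter> T -` X)"
    by (auto simp: pre_def lo_def hi_def)
  ultimately show ?thesis by simp
qed

lemma image_unit: "x \<in> {0<..<1} \<Longrightarrow> x \<noteq> c \<Longrightarrow> T x \<in> {0<..<1}"
  using koebe_branch_image[OF left] koebe_branch_image[OF right]
  by (metis greaterThanLessThan_iff image_eqI linorder_neqE)

text \<open>The intervals of points that share an itinerary up to time \<open>n\<close> and land in a fixed compact set
  at time \<open>n\<close> form a Vitali cover on which the density of an invariant set is bounded below.\<close>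

lemma zero_one_law:
  assumes Z[measurable]: "Z \<in> sets borel" and Z01: "Z \<subseteq> {0<..<1}"
    and inv: "emeasure lborel {x \<in> {0<..<c} \<union> {c<..<1}. T x \<in> Z \<and> x \<notin> Z} = 0"
    and Zpos: "emeasure lborel Z \<noteq> 0"
  shows "emeasure lborel ({0<..<1} - Z) = 0"
proof -
  define N where "N = insert c {x \<in> {0<..<c} \<union> {c<..<1}. T x \<in> Z \<and> x \<notin> Z}"
  have N: "N \<in> null_sets lborel"
  proof -
    have "{x \<in> {0<..<c} \<union> {c<..<1}. T x \<in> Z \<and> x \<notin> Z} = ({0<..<c} \<union> {c<..<1}) \<inter> T -` Z - Z" by auto
    moreover have "({0<..<c} \<union> {c<..<1}) \<inter> T -` Z - Z \<in> sets borel"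
      using vimage_borel[OF Z, of 1] Z by simp
    ultimately have "{x \<in> {0<..<c} \<union> {c<..<1}. T x \<in> Z \<and> x \<notin> Z} \<in> null_sets lborel"
      using inv by (intro null_setsI) simp_all
    moreover have "{c} \<in> null_sets lborel" by auto
    ultimately have "{c} \<union> {x \<in> {0<..<c} \<union> {c<..<1}. T x \<in> Z \<and> x \<notin> Z} \<in> null_sets lborel" by blast
    then show ?thesis by (simp add: N_def)
  qed
  \<comment> \<open>All iterated preimages of the exceptional set are discarded. The remaining set
    \<open>G\<close> has full measure and is mapped into itself, and on it membership in
    \<open>Z\<close> passes from an iterate back to the point without exception.\<close>
  define E where "E = (\<Union>k. (pre ^^ k) N)"
  have "(pre ^^ k) N \<in> null_sets lborel" for k by (induction k) (auto simp: N pre_null)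
  then have E: "E \<in> null_sets lborel" unfolding E_def by (rule null_sets_UN)
  define G where "G = {0<..<1} - E"
  have G: "y \<in> {0<..<1}" "y \<noteq> c" "y \<notin> N" "T y \<in> G" if "y \<in> G" for y
  proof -
    show y: "y \<in> {0<..<1}" using that by (simp add: G_def)
    show "y \<notin> N" using that by (auto simp: G_def E_def dest: spec[of _ 0])
    then show yc: "y \<noteq> c" by (auto simp: N_def)
    have "T y \<notin> (pre ^^ k) N" for k
    proof
      assume "T y \<in> (pre ^^ k) N"
      then have "y \<in> (pre ^^ Suc k) N" using y yc by (auto simp: pre_def)
      then show False using that unfolding G_def E_def by blast
    qed
    then show "T y \<in> G" using image_unit[OF y yc] by (auto simp: G_def E_def)
  qed
  have Gn: "(T ^^ n) y \<in> G" if "y \<in> G" for y n using that by (induction n) (auto intro: G(4))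
  have GZ: "y \<in> Z" if "y \<in> G" "(T ^^ n) y \<in> Z" for y n
    using that(2)
  proof (induction n)
    case (Suc n)
    have "(T ^^ n) y \<notin> N" "(T ^^ n) y \<in> {0<..<c} \<union> {c<..<1}"
      using G(1,2,3)[OF Gn[OF that(1), of n]] by auto
    then have "(T ^^ n) y \<in> Z" using Suc.prems by (auto simp: N_def)
    then show ?case by (rule Suc.IH)
  qed simp
  \<comment> \<open>The middle intervals exhaust (0,1), so one of them carries part of
    \<open>Z\<close>. The condition \<delta> < \<eta> makes orbits outside it subject to the
    repulsion of the endpoints.\<close>
  obtain \<delta> where \<delta>: "0 < \<delta>" "\<delta> < c" "\<delta> < 1 - c" "\<delta> < \<eta>" and ZK: "emeasure lborel (Z \<inter> {\<delta><..<1 - \<delta>}) \<noteq> 0"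
  proof (rule ccontr)
    assume no: "\<not> thesis"
    define m where "m = min (min c (1 - c)) \<eta> / 2"
    have m: "0 < m" "m < c" "m < 1 - c" "m < \<eta>" using c \<eta> by (auto simp: m_def min_def)
    have "emeasure lborel (Z \<inter> {m / Suc k<..<1 - m / Suc k}) = 0" for k
    proof -
      have "m / Suc k \<le> m" using m by (simp add: field_simps)
      moreover have "0 < m / Suc k" using m by simp
      ultimately show ?thesis using no that[of "m / Suc k"] m by auto
    qed
    then have "Z \<inter> {m / Suc k<..<1 - m / Suc k} \<in> null_sets lborel" for k by auto
    then have "(\<Union>k. Z \<inter> {m / Suc k<..<1 - m / Suc k}) \<in> null_sets lborel" by (rule null_sets_UN)
    moreover have "Z \<subseteq> (\<Union>k. Z \<inter> {m / Suc k<..<1 - m / Suc k})"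
    proof
      fix x assume x: "x \<in> Z"
      then have "0 < edge x / m" using Z01 m by (auto simp: edge_def)
      then obtain k where "inverse (real (Suc k)) < edge x / m" using reals_Archimedean by blast
      then have "m / Suc k < edge x" using m by (simp add: field_simps)
      then show "x \<in> (\<Union>k. Z \<inter> {m / Suc k<..<1 - m / Suc k})" using x by (auto simp: edge_def intro!: exI[of _ k])
    qed
    ultimately have "Z \<in> null_sets lborel" using Z by (metis null_sets_subset sets_lborel)
    then show False using Zpos by auto
  qed
  let ?K = "{\<delta><..<1 - \<delta>}"
  \<comment> \<open>As long as an orbit stays outside the middle interval, its distance to the
    endpoints grows at least by the factor \<open>a\<close>, which cannot continue forever.\<close>
  have return: "\<exists>n\<ge>n0. (T ^^ n) y \<in> ?K" if y: "y \<in> G" for y n0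
  proof (rule ccontr)
    assume "\<not> ?thesis"
    then have small: "edge ((T ^^ n) y) \<le> \<delta>" if "n0 \<le> n" for n using that by (auto simp: edge_def not_less) 
    have pos: "0 < edge ((T ^^ n0) y)" using G(1)[OF Gn[OF y, of n0]] by (auto simp: edge_def)
    have grow: "a ^ k * edge ((T ^^ n0) y) \<le> edge ((T ^^ (n0 + k)) y)" for k
    proof (induction k)
      case (Suc k)
      have "a ^ Suc k * edge ((T ^^ n0) y) \<le> a * edge ((T ^^ (n0 + k)) y)"
        using Suc a by simp
      also have "\<dots> \<le> edge (T ((T ^^ (n0 + k)) y))"
        using small[of "n0 + k"] \<delta> G(1)[OF Gn[OF y]] by (intro repel) auto
      finally show ?case by simp
    qed simp
    obtain k where "\<delta> / edge ((T ^^ n0) y) < a ^ k" using real_arch_pow[OF a] by blast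
    then have "\<delta> < a ^ k * edge ((T ^^ n0) y)" using pos by (simp add: field_simps)
    then show False using grow[of k] small[of "n0 + k"] by simp
  qed
  define \<kappa> where "\<kappa> = measure lborel (Z \<inter> ?K) * \<delta> ^ 4"
  have ZKfin: "emeasure lborel (Z \<inter> ?K) = ennreal (measure lborel (Z \<inter> ?K))"
  proof -
    have "emeasure lborel (Z \<inter> ?K) \<le> emeasure lborel {0<..<1::real}"
      using Z01 by (intro emeasure_mono) auto
    then show ?thesis by (intro emeasure_eq_ennreal_measure) (auto simp: top_unique)
  qed
  have \<kappa>: "0 < \<kappa>" using ZK ZKfin \<delta> by (simp add: \<kappa>_def zero_less_measure_iff)
  have "emeasure lborel (G - Z) = 0"
  proof (rule null_by_vitali[OF _ Z])
    show "G - Z \<in> sets borel" using E Z by (auto simp: G_def)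
    have "emeasure lborel (G - Z) \<le> emeasure lborel {0<..<1::real}"
      by (intro emeasure_mono) (auto simp: G_def)
    then show "emeasure lborel (G - Z) < \<infinity>" by (simp add: le_less_trans)
    show "0 < \<kappa>" by (rule \<kappa>)
    fix y and d :: real assume y: "y \<in> G - Z" and d: "0 < d"
    define s where "s k = ((T ^^ k) y < c)" for k
    have "(T ^^ k) y \<in> {lo (s k)<..<hi (s k)}" for k
      using y G(1,2)[OF Gn, of y k] by (cases "(T ^^ k) y < c") (auto simp: s_def lo_def hi_def)
    then have ycyl: "y \<in> cyl s n" for n using y by (auto simp: cyl_def G_def)
    obtain n0 where n0: "\<And>n. n0 \<le> n \<Longrightarrow> measure lborel (cyl s n \<inter> (T ^^ n) -` ?K) < d"
      using order_tendstoD(2)[OF cyl_shrink[OF \<delta>(1-3), of s] d] unfolding eventually_sequentially by blast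
    obtain n where n: "n0 \<le> n" "(T ^^ n) y \<in> ?K" using return[of y n0] y by auto
    define L where "L = cyl s n \<inter> (T ^^ n) -` ?K"
    have [measurable]: "L \<in> sets borel" unfolding L_def using vimage_borel by auto
    have yL: "y \<in> L" using n ycyl by (simp add: L_def)
    have L01: "L \<subseteq> {0<..<1}" by (auto simp: L_def cyl_def)
    have iL: "is_interval L" unfolding L_def using \<delta> by (intro interval_cyl) auto
    \<comment> \<open>\<open>L\<close> is an interval with unknown endpoints. Its closed hull is the
      required ball, with radius half its length.\<close>
    define p r where "p = Inf L" and "r = Sup L"
    have bdd: "bdd_below L" "bdd_above L" using L01 by (auto intro!: bdd_belowI[of _ 0] bdd_aboveI[of _ 1] less_imp_le)
    have sub: "L \<subseteq> {p..r}" using bdd by (auto simp: p_def r_def cInf_lower cSup_upper)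
    have sup: "{p<..<r} \<subseteq> L"
    proof
      fix x assume x: "x \<in> {p<..<r}"
      obtain u where "u \<in> L" "u < x" using x yL cInf_lessD[of L x] by (auto simp: p_def)
      moreover obtain v where "v \<in> L" "x < v" using x yL less_cSupD[of L x] by (auto simp: r_def)
      ultimately show "x \<in> L" using iL unfolding is_interval_1 by (meson less_imp_le)
    qed
    have pr: "p \<le> r" using sub yL by auto
    have eL: "emeasure lborel L = ennreal (r - p)"
    proof (rule antisym)
      show "emeasure lborel L \<le> ennreal (r - p)" using emeasure_mono[OF sub, of lborel] pr by simp
      show "ennreal (r - p) \<le> emeasure lborel L" using emeasure_mono[OF sup, of lborel] pr by simp
    qed
    \<comment> \<open>The ball needs positive radius. If \<open>L\<close> were null, the strictly
      positive \<open>rho s n\<close> would vanish almost everywhere on the middle interval, which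
      has positive measure.\<close>
    have Lpos: "emeasure lborel L \<noteq> 0"
    proof
      assume "emeasure lborel L = 0"
      then have z: "(\<integral>\<^sup>+x. indicator ?K x * ennreal (rho s n x) \<partial>lborel) = 0"
        unfolding L_def using \<delta> by (subst (asm) emeasure_cyl) auto
      have "emeasure lborel (Z \<inter> ?K) = 0"
      proof -
        have mf: "(\<lambda>x. indicator {0<..<1} x * rho s n x) \<in> borel_measurable borel" by (rule koebe_measurable[OF rho_koebe])
        have "(\<lambda>x. indicator ?K x * ennreal (indicator {0<..<1} x * rho s n x)) \<in> borel_measurable borel"
          using mf by measurable
        moreover have "(\<lambda>x. indicator ?K x * ennreal (indicator {0<..<1} x * rho s n x)) = (\<lambda>x. indicator ?K x * ennreal (rho s n x))"
          using \<delta> by (auto split: split_indicator)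
        ultimately have "(\<lambda>x. indicator ?K x * ennreal (rho s n x)) \<in> borel_measurable lborel" by simp
        then have "AE x in lborel. indicator ?K x * ennreal (rho s n x) = 0"
          using z nn_integral_0_iff_AE by blast
        then have "AE x in lborel. x \<notin> Z \<inter> ?K"
        proof eventually_elim
          case (elim x)
          show ?case
          proof
            assume "x \<in> Z \<inter> ?K"
            then show False using elim rho_pos[of x s n] \<delta> by (simp split: split_indicator_asm)
          qed
        qed
        from emeasure_eq_0_AE[OF this] show ?thesis by (simp add: Int_def)
      qed
      then show False using ZK by simp
    qed
    then have pr': "p < r" using eL pr by (cases "p = r") auto
    \<comment> \<open>Distortion gives the pullback of \<open>Z\<close> within the middle interval a
      share \<kappa> of \<open>L\<close>, and by \<open>GZ\<close> this pullback lies in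
      \<open>Z\<close> except for points of the null set \<open>E\<close>.\<close>
    have "ennreal \<kappa> * emeasure lborel L \<le> emeasure lborel (Z \<inter> L)"
    proof -
      have "ennreal \<kappa> * emeasure lborel L = emeasure lborel (Z \<inter> ?K) * ennreal (\<delta> ^ 4) * emeasure lborel L"
        using \<delta> by (simp add: \<kappa>_def ZKfin ennreal_mult)
      also have "\<dots> \<le> (\<integral>\<^sup>+x. indicator (Z \<inter> ?K) x * ennreal (rho s n x) \<partial>lborel)"
      proof -
        have "emeasure lborel L = (\<integral>\<^sup>+x. indicator ?K x * ennreal (rho s n x) \<partial>lborel)"
          unfolding L_def using \<delta> by (intro emeasure_cyl) auto
        then show ?thesis using koebe_proportion[OF rho_koebe \<delta>(1), of "Z \<inter> ?K" s n] by simp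
      qed
      also have "\<dots> = emeasure lborel (cyl s n \<inter> (T ^^ n) -` (Z \<inter> ?K))"
        using Z01 by (subst emeasure_cyl) auto
      also have "\<dots> \<le> emeasure lborel ((Z \<inter> L) \<union> E)"
      proof (intro emeasure_mono subsetI)
        fix x assume x: "x \<in> cyl s n \<inter> (T ^^ n) -` (Z \<inter> ?K)"
        then have "x \<in> G \<or> x \<in> E" by (auto simp: G_def cyl_def)
        then show "x \<in> Z \<inter> L \<union> E" using x GZ[of x n] by (auto simp: L_def)
      qed (use E in auto)
      also have "\<dots> \<le> emeasure lborel (Z \<inter> L) + emeasure lborel E"
        using E by (intro emeasure_subadditive) auto
      finally show ?thesis using E by (simp add: null_setsD1)
    qed
    also have "\<dots> \<le> emeasure lborel (Z \<inter> {p..r})" using sub by (intro emeasure_mono) auto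
    finally have "ennreal (\<kappa> * (r - p)) \<le> emeasure lborel (Z \<inter> {p..r})"
      using \<kappa> pr by (simp add: eL ennreal_mult)
    moreover have "\<kappa> * (2 * ((r - p) / 2)) = \<kappa> * (r - p)" by simp
    ultimately have "ennreal (\<kappa> * (2 * ((r - p) / 2))) \<le> emeasure lborel (Z \<inter> {p..r})" by (simp only:)
    moreover have "{p..r} = cball ((p + r) / 2) ((r - p) / 2)" by (simp add: cball_eq_atLeastAtMost field_simps)
    moreover have "(r - p) / 2 < d" using n0[OF n(1)] eL pr' unfolding L_def[symmetric] by (simp add: measure_def)
    ultimately show "\<exists>a r. 0 < r \<and> r < d \<and> y \<in> cball a r \<and> ennreal (\<kappa> * (2 * r)) \<le> emeasure lborel (Z \<inter> cball a r)"
      using pr' sub yL by (intro exI[of _ "(p + r) / 2"] exI[of _ "(r - p) / 2"]) auto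
  qed auto
  moreover have "emeasure lborel ({0<..<1} - Z) \<le> emeasure lborel ((G - Z) \<union> E)"
    using E by (intro emeasure_mono) (auto simp: G_def)
  moreover have "\<dots> \<le> emeasure lborel (G - Z) + emeasure lborel E"
    using E by (intro emeasure_subadditive) (auto simp: G_def)
  ultimately show ?thesis using E by (simp add: null_setsD1)
qed

end

section \<open>The averaged transfer operator\<close>

text \<open>ln t <= 2 sqrt t replaces the logarithm by an integrable power, whose integral over
  [0, \<rho>] is 4 \<rho>; the two sides of \<open>e\<close> give 8 \<rho>. The linear dependence on
  \<rho> is what later makes the truncated pole at \<open>c\<close> cheap.\<close>

lemma nn_integral_log_singularity:
  fixes e :: real
  assumes \<rho>: "0 < \<rho>"
  shows "(\<integral>\<^sup>+x. ennreal (max 0 (ln (\<rho> / \<bar>x - e\<bar>))) \<partial>lborel) \<le> ennreal (8 * \<rho>)"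
proof -
  let ?g = "\<lambda>y. ennreal (2 * sqrt \<rho> * y powr (- (1/2))) * indicator {0..\<rho>} y"
  have I: "(\<integral>\<^sup>+y. ?g y \<partial>lborel) = ennreal (4 * \<rho>)"
  proof -
    have "((\<lambda>y. y powr (- (1/2))) has_integral (\<rho> powr (- (1/2) + 1) / (- (1/2) + 1))) {0..\<rho>}"
      using \<rho> by (intro has_integral_powr_from_0) auto
    then have "((\<lambda>y. 2 * sqrt \<rho> * y powr (- (1/2))) has_integral (2 * sqrt \<rho> * (\<rho> powr (- (1/2) + 1) / (- (1/2) + 1)))) {0..\<rho>}"
      by (rule has_integral_mult_right)
    also have "2 * sqrt \<rho> * (\<rho> powr (- (1/2) + 1) / (- (1/2) + 1)) = 4 * (sqrt \<rho> * sqrt \<rho>)"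
      using \<rho> by (simp add: powr_half_sqrt)
    also have "\<dots> = 4 * \<rho>" using \<rho> by simp
    finally show ?thesis using \<rho> by (intro nn_integral_has_integral_lebesgue') auto
  qed
  have bound: "max 0 (ln (\<rho> / y)) \<le> 2 * sqrt \<rho> * y powr (- (1/2))" if "0 < y" for y
  proof -
    have "ln (sqrt (\<rho> / y)) \<le> sqrt (\<rho> / y)" using that \<rho> by (intro ln_bound) auto
    then have "ln (\<rho> / y) \<le> 2 * sqrt (\<rho> / y)" using that \<rho> by (simp add: ln_sqrt)
    also have "\<dots> = 2 * sqrt \<rho> * y powr (- (1/2))" using that by (simp add: real_sqrt_divide powr_minus powr_half_sqrt field_simps)
    finally show ?thesis using \<rho> by simp
  qed
  have "(\<integral>\<^sup>+x. ennreal (max 0 (ln (\<rho> / \<bar>x - e\<bar>))) \<partial>lborel) = (\<integral>\<^sup>+x. ennreal (max 0 (ln (\<rho> / \<bar>x\<bar>))) \<partial>lborel)"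
    using nn_integral_real_affine[of "\<lambda>x. ennreal (max 0 (ln (\<rho> / \<bar>x - e\<bar>)))" 1 e] by simp
  also have "\<dots> \<le> (\<integral>\<^sup>+y. ?g y + ?g (- y) \<partial>lborel)"
  proof (rule nn_integral_mono)
    fix y :: real
    have zero: "max 0 (ln (\<rho> / t)) = 0" if "\<rho> < t" for t using that \<rho> by (simp add: ln_div)
    consider "y = 0" | "0 < y" | "y < 0" by linarith
    then show "ennreal (max 0 (ln (\<rho> / \<bar>y\<bar>))) \<le> ?g y + ?g (- y)"
    proof cases
      case 2
      then show ?thesis using bound[of y] zero[of y] by (cases "y \<le> \<rho>") (auto split: split_indicator intro: ennreal_leI)
    next
      case 3
      then show ?thesis using bound[of "- y"] zero[of "- y"] by (cases "- y \<le> \<rho>") (auto split: split_indicator intro: ennreal_leI)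
    qed simp
  qed
  also have "\<dots> = (\<integral>\<^sup>+y. ?g y \<partial>lborel) + (\<integral>\<^sup>+y. ?g (- y) \<partial>lborel)"
    by (rule nn_integral_add) auto
  also have "(\<integral>\<^sup>+y. ?g (- y) \<partial>lborel) = (\<integral>\<^sup>+y. ?g y \<partial>lborel)"
    using nn_integral_real_affine[of ?g "-1" 0] by simp
  finally show ?thesis using I \<rho> by (simp add: ennreal_plus[symmetric] del: ennreal_plus)
qed

text \<open>All estimates are in logarithmic form with constants common to the maps: \<eta> is the
  width of the repelling zone at the endpoints, \<open>a\<close> the expansion there,
  \<open>C\<close> absorbs multiplicative constants, and \<open>r\<close> dominates the exponents of
  all maps. Only \<open>bad_c\<close> keeps the individual exponents, because \<open>theta\<close>
  is their weighted sum.\<close>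

locale random_map =
  fixes c :: real and G B :: "'i set" and T :: "'i \<Rightarrow> real \<Rightarrow> real" and p l :: "'i \<Rightarrow> real"
    and a \<eta> C r :: real
  assumes c: "0 < c" "c < 1"
    and finite: "finite G" "finite B" and disj: "G \<inter> B = {}" and G_ne: "G \<noteq> {}"
    and p_pos: "\<And>j. j \<in> G \<union> B \<Longrightarrow> 0 < p j" and p_sum: "(\<Sum>j\<in>G \<union> B. p j) = 1"
    and T_meas: "\<And>j. j \<in> G \<union> B \<Longrightarrow> T j \<in> borel_measurable borel"
    and good: "\<And>j. j \<in> G \<Longrightarrow> koebe_branch 0 c 0 1 (T j)" "\<And>j. j \<in> G \<Longrightarrow> koebe_branch c 1 0 1 (T j)"
    and bad: "\<And>j. j \<in> B \<Longrightarrow> koebe_branch 0 c 0 c (T j) \<or> koebe_branch 0 c c 1 (T j)"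
      "\<And>j. j \<in> B \<Longrightarrow> koebe_branch c 1 0 c (T j) \<or> koebe_branch c 1 c 1 (T j)"
    and l: "\<And>j. j \<in> B \<Longrightarrow> 1 < l j" and theta: "(\<Sum>j\<in>B. p j * l j) < 1"
    and a: "1 < a" and \<eta>: "0 < \<eta>" and C: "0 \<le> C" and r: "1 \<le> r"
    and repel: "\<And>j x. j \<in> G \<union> B \<Longrightarrow> x \<in> {0<..<1} \<Longrightarrow> edge x < \<eta> \<Longrightarrow> a * edge x \<le> edge (T j x)"
    and edge_off_c: "\<And>j x. j \<in> G \<union> B \<Longrightarrow> x \<in> {0<..<1} \<Longrightarrow> edge x < \<eta> \<Longrightarrow> - ln \<bar>T j x - c\<bar> \<le> C"
    and inner_edge: "\<And>j x. j \<in> G \<union> B \<Longrightarrow> x \<in> {0<..<c} \<union> {c<..<1} \<Longrightarrow> \<eta> \<le> edge x \<Longrightarrow>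
        - ln (edge (T j x)) \<le> C + r * - ln \<bar>x - c\<bar>"
    and bad_c: "\<And>j x. j \<in> B \<Longrightarrow> x \<in> {0<..<c} \<union> {c<..<1} \<Longrightarrow> - ln \<bar>T j x - c\<bar> \<le> C + l j * - ln \<bar>x - c\<bar>"
begin

section \<open>Admissible densities and duality for the averaged operator\<close>

definition U :: "real set" where "U = {0<..<c} \<union> {c<..<1}"
text \<open>At \<open>c\<close>, where \<open>ln 0 = 0\<close>, the function \<open>D\<close> has the harmless value \<open>0\<close>.\<close>

definition E :: "real \<Rightarrow> real" where "E x = - ln (edge x)"
definition D :: "real \<Rightarrow> real" where "D x = - ln \<bar>x - c\<bar>"
text \<open>No condition links the two sides of \<open>c\<close>, since branches of bad maps have
  ranges that end there and the density may jump or blow up.\<close>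

definition adm :: "(real \<Rightarrow> real) \<Rightarrow> bool" where "adm f \<longleftrightarrow> koebe 0 c f \<and> koebe c 1 f"
definition nu :: "(real \<Rightarrow> real) \<Rightarrow> real measure" where
  "nu f = density lborel (\<lambda>x. indicator U x * ennreal (f x))"
definition push2 :: "'i \<Rightarrow> (real \<Rightarrow> real) \<Rightarrow> real \<Rightarrow> real" where
  "push2 j f x = push 0 c (T j) f x + push c 1 (T j) f x"
definition P :: "(real \<Rightarrow> real) \<Rightarrow> real \<Rightarrow> real" where
  "P f x = (\<Sum>j\<in>G \<union> B. p j * push2 j f x)"

lemma U_meas[measurable]: "U \<in> sets borel" by (simp add: U_def)

lemma E_meas[measurable]: "E \<in> borel_measurable borel" unfolding E_def edge_def by measurable
lemma D_meas[measurable]: "D \<in> borel_measurable borel" unfolding D_def by measurable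

lemma U_D: assumes "x \<in> U" shows "0 < x" "x < 1" "x \<noteq> c"
  using assms c by (auto simp: U_def)

lemma E_nonneg: "x \<in> {0<..<1} \<Longrightarrow> 0 \<le> E x"
  unfolding E_def edge_def by (auto simp: min_def)

lemma p_le: "A \<subseteq> G \<union> B \<Longrightarrow> (\<Sum>j\<in>A. p j) \<le> 1"
  using sum_mono2[of "G \<union> B" A p] finite p_pos p_sum by (metis DiffD1 finite_UnI less_imp_le)

lemma finite_GB: "finite (G \<union> B)" using finite by simp

lemma T_U: assumes "j \<in> G \<union> B" "x \<in> U" shows "T j x \<in> {0<..<1}"
proof -
  obtain A A' where "koebe_branch 0 c A A' (T j)" "0 \<le> A" "A' \<le> 1"
    using good(1)[of j] bad(1)[of j] assms(1) c by (metis UnE less_imp_le order_refl)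
  then have 1: "T j ` {0<..<c} \<subseteq> {0<..<1}" by (auto simp: koebe_branch_image)
  obtain A A' where "koebe_branch c 1 A A' (T j)" "0 \<le> A" "A' \<le> 1"
    using good(2)[of j] bad(2)[of j] assms(1) c by (metis UnE less_imp_le order_refl)
  then have 2: "T j ` {c<..<1} \<subseteq> {0<..<1}" by (auto simp: koebe_branch_image)
  show ?thesis using assms(2) 1 2 unfolding U_def by blast
qed

lemma adm_nonneg: "adm f \<Longrightarrow> x \<in> U \<Longrightarrow> 0 \<le> f x"
  unfolding adm_def U_def using koebe_nonneg by blast

text \<open>The three pairs are the possible ranges of branches. A function Koebe over (0,1) is so
  over both halves by restriction; for a half range the function vanishes on the other half.\<close>

lemma adm_zero_outside:
  assumes h: "koebe A A' h" "\<And>x. x \<notin> {A<..<A'} \<Longrightarrow> h x = 0" and "(A, A') \<in> {(0, 1), (0, c), (c, 1)}"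
  shows "adm h"
proof -
  have z: "koebe s t h" if "{s<..<t} \<inter> {A<..<A'} = {}" for s t
  proof (rule koebe_cong[OF koebe_const[of 0]])
    fix x assume "x \<in> {s<..<t}"
    then have "x \<notin> {A<..<A'}" using that by blast
    then show "0 = h x" using h(2) by simp
  qed simp
  show ?thesis using assms c z[of c 1] z[of 0 c] unfolding adm_def by (auto intro: koebe_subinterval)
qed

lemma adm_push2: assumes j: "j \<in> G \<union> B" and f: "adm f" shows "adm (push2 j f)"
proof -
  have add: "adm h \<Longrightarrow> adm k \<Longrightarrow> adm (\<lambda>x. h x + k x)" for h k unfolding adm_def by (auto intro: koebe_add)
  have f': "koebe 0 c f" "koebe c 1 f" using f by (auto simp: adm_def)
  obtain A A' where L: "koebe_branch 0 c A A' (T j)" "(A, A') \<in> {(0, 1), (0, c), (c, 1)}"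
    using good(1)[of j] bad(1)[of j] j by auto
  have 1: "adm (push 0 c (T j) f)"
    by (rule adm_zero_outside[OF push_koebe[OF L(1) f'(1)] _ L(2)])
      (use koebe_branch_image[OF L(1)] in \<open>auto simp: push_outside\<close>)
  obtain A A' where R: "koebe_branch c 1 A A' (T j)" "(A, A') \<in> {(0, 1), (0, c), (c, 1)}"
    using good(2)[of j] bad(2)[of j] j by auto
  have 2: "adm (push c 1 (T j) f)"
    by (rule adm_zero_outside[OF push_koebe[OF R(1) f'(2)] _ R(2)])
      (use koebe_branch_image[OF R(1)] in \<open>auto simp: push_outside\<close>)
  show ?thesis using add[OF 1 2] by (simp add: push2_def[abs_def])
qed

lemma adm_P: "adm f \<Longrightarrow> adm (P f)"
proof -
  assume f: "adm f"
  have "adm (\<lambda>x. p j * push2 j f x)" if "j \<in> G \<union> B" for j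
    using adm_push2[OF that f] p_pos[OF that] unfolding adm_def by (auto intro: koebe_scale)
  then show ?thesis unfolding P_def[abs_def] adm_def by (auto intro!: koebe_sum)
qed

lemma adm_meas: assumes "adm f" shows "(\<lambda>x. indicator U x * ennreal (f x)) \<in> borel_measurable borel"
proof -
  have "(\<lambda>x. indicator {0<..<c} x * f x + indicator {c<..<1} x * f x) \<in> borel_measurable borel"
    using assms unfolding adm_def by (intro borel_measurable_add koebe_measurable) auto
  then have "(\<lambda>x. ennreal (indicator {0<..<c} x * f x + indicator {c<..<1} x * f x)) \<in> borel_measurable borel"
    by measurable
  moreover have "(\<lambda>x. ennreal (indicator {0<..<c} x * f x + indicator {c<..<1} x * f x)) = (\<lambda>x. indicator U x * ennreal (f x))"
    by (auto simp: U_def fun_eq_iff split: split_indicator)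
  ultimately show ?thesis by simp
qed

lemma sets_nu[simp, measurable_cong]: "sets (nu f) = sets borel" by (simp add: nu_def)
lemma space_nu[simp]: "space (nu f) = UNIV" by (simp add: nu_def)

lemma nn_integral_nu:
  assumes f: "adm f" and [measurable]: "\<psi> \<in> borel_measurable borel"
  shows "(\<integral>\<^sup>+x. \<psi> x \<partial>nu f) = (\<integral>\<^sup>+x. indicator U x * ennreal (f x) * \<psi> x \<partial>lborel)"
  unfolding nu_def using adm_meas[OF f] by (subst nn_integral_density) auto

lemma AE_nu_U: "adm f \<Longrightarrow> AE x in nu f. x \<in> U"
  unfolding nu_def using adm_meas by (subst AE_density) (auto split: split_indicator)

lemma push2_zero: "j \<in> G \<union> B \<Longrightarrow> x \<notin> {0<..<1} \<Longrightarrow> push2 j f x = 0"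
  using T_U[of j] by (auto simp: push2_def push_def U_def)

text \<open>The second form integrates over the whole line and agrees with the first because the
  image vanishes off (0,1) and \<open>c\<close> is a null point. It is the form that can be compared
  directly with Lebesgue measure near \<open>c\<close>.\<close>

lemma nn_integral_push2:
  assumes j: "j \<in> G \<union> B" and f: "adm f" and [measurable]: "\<psi> \<in> borel_measurable borel"
  shows "(\<integral>\<^sup>+x. \<psi> x \<partial>nu (push2 j f)) = (\<integral>\<^sup>+x. \<psi> (T j x) \<partial>nu f)"
    "(\<integral>\<^sup>+x. \<psi> x * ennreal (push2 j f x) \<partial>lborel) = (\<integral>\<^sup>+x. \<psi> (T j x) \<partial>nu f)"
proof -
  note [measurable] = T_meas[OF j]
  have f': "koebe 0 c f" "koebe c 1 f" using f by (auto simp: adm_def)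
  obtain A A' where L: "koebe_branch 0 c A A' (T j)" using good(1)[of j] bad(1)[of j] j by auto
  obtain A A' where R: "koebe_branch c 1 A A' (T j)" using good(2)[of j] bad(2)[of j] j by auto
  have nonneg: "0 \<le> push 0 c (T j) f x" "0 \<le> push c 1 (T j) f x" for x
    using push_nonneg f' by auto
  note [measurable] = push_measurable[OF L f'(1)] push_measurable[OF R f'(2)]
  have mL: "(\<lambda>x. indicator {0<..<c} x * (indicator U x * ennreal (f x))) \<in> borel_measurable borel"
    and mR: "(\<lambda>x. indicator {c<..<1} x * (indicator U x * ennreal (f x))) \<in> borel_measurable borel"
    using adm_meas[OF f] by measurable
  have eL: "indicator {0<..<c} x * (\<psi> (T j x) * ennreal (f x)) = \<psi> (T j x) * (indicator {0<..<c} x * (indicator U x * ennreal (f x)))"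
    and eR: "indicator {c<..<1} x * (\<psi> (T j x) * ennreal (f x)) = \<psi> (T j x) * (indicator {c<..<1} x * (indicator U x * ennreal (f x)))" for x
    by (auto simp: U_def split: split_indicator)
  have "(\<integral>\<^sup>+x. \<psi> x * ennreal (push2 j f x) \<partial>lborel)
      = (\<integral>\<^sup>+x. \<psi> x * ennreal (push 0 c (T j) f x) + \<psi> x * ennreal (push c 1 (T j) f x) \<partial>lborel)"
    using nonneg by (intro nn_integral_cong) (simp add: push2_def distrib_left)
  also have "\<dots> = (\<integral>\<^sup>+x. \<psi> x * ennreal (push 0 c (T j) f x) \<partial>lborel) + (\<integral>\<^sup>+x. \<psi> x * ennreal (push c 1 (T j) f x) \<partial>lborel)"
    by (rule nn_integral_add) auto
  also have "\<dots> = (\<integral>\<^sup>+x. indicator {0<..<c} x * (\<psi> (T j x) * ennreal (f x)) \<partial>lborel)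
      + (\<integral>\<^sup>+x. indicator {c<..<1} x * (\<psi> (T j x) * ennreal (f x)) \<partial>lborel)"
    by (simp add: nn_integral_push[OF L _ f'(1)] nn_integral_push[OF R _ f'(2)])
  also have "\<dots> = (\<integral>\<^sup>+x. indicator {0<..<c} x * (\<psi> (T j x) * ennreal (f x)) + indicator {c<..<1} x * (\<psi> (T j x) * ennreal (f x)) \<partial>lborel)"
    unfolding eL eR using mL mR by (intro nn_integral_add[symmetric]) auto
  also have "\<dots> = (\<integral>\<^sup>+x. indicator U x * ennreal (f x) * \<psi> (T j x) \<partial>lborel)"
    by (intro nn_integral_cong) (auto simp: U_def mult.commute split: split_indicator)
  also have "\<dots> = (\<integral>\<^sup>+x. \<psi> (T j x) \<partial>nu f)" by (rule nn_integral_nu[OF f, symmetric]) auto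
  finally show 2: "(\<integral>\<^sup>+x. \<psi> x * ennreal (push2 j f x) \<partial>lborel) = (\<integral>\<^sup>+x. \<psi> (T j x) \<partial>nu f)" .
  have "(\<integral>\<^sup>+x. \<psi> x \<partial>nu (push2 j f)) = (\<integral>\<^sup>+x. indicator U x * ennreal (push2 j f x) * \<psi> x \<partial>lborel)"
    by (rule nn_integral_nu[OF adm_push2[OF j f]]) simp
  also have "\<dots> = (\<integral>\<^sup>+x. \<psi> x * ennreal (push2 j f x) \<partial>lborel)"
  proof (rule nn_integral_cong_AE)
    have "AE x in lborel. x \<noteq> c" by (rule AE_lborel_singleton)
    then show "AE x in lborel. indicator U x * ennreal (push2 j f x) * \<psi> x = \<psi> x * ennreal (push2 j f x)"
    proof eventually_elim
      case (elim x)
      then show ?case using push2_zero[OF j, of x f] by (cases "x \<in> U") (auto simp: U_def mult.commute)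
    qed
  qed
  finally show "(\<integral>\<^sup>+x. \<psi> x \<partial>nu (push2 j f)) = (\<integral>\<^sup>+x. \<psi> (T j x) \<partial>nu f)" using 2 by simp
qed

lemma nn_integral_nu_sum:
  assumes J: "finite J" and h: "\<And>j. j \<in> J \<Longrightarrow> adm (h j)" and q: "\<And>j. j \<in> J \<Longrightarrow> 0 \<le> q j"
    and [measurable]: "\<psi> \<in> borel_measurable borel"
  shows "(\<integral>\<^sup>+x. \<psi> x \<partial>nu (\<lambda>x. \<Sum>j\<in>J. q j * h j x)) = (\<Sum>j\<in>J. ennreal (q j) * (\<integral>\<^sup>+x. \<psi> x \<partial>nu (h j)))"
proof -
  have adm: "adm (\<lambda>x. \<Sum>j\<in>J. q j * h j x)"
    using h q unfolding adm_def by (auto intro!: koebe_sum koebe_scale)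
  have [measurable]: "(\<lambda>x. indicator U x * ennreal (h j x)) \<in> borel_measurable borel" if "j \<in> J" for j
    using adm_meas[OF h[OF that]] .
  have "(\<integral>\<^sup>+x. \<psi> x \<partial>nu (\<lambda>x. \<Sum>j\<in>J. q j * h j x)) = (\<integral>\<^sup>+x. indicator U x * ennreal (\<Sum>j\<in>J. q j * h j x) * \<psi> x \<partial>lborel)"
    by (rule nn_integral_nu[OF adm]) simp
  also have "\<dots> = (\<integral>\<^sup>+x. (\<Sum>j\<in>J. ennreal (q j) * (indicator U x * ennreal (h j x) * \<psi> x)) \<partial>lborel)"
  proof (rule nn_integral_cong)
    fix x
    show "indicator U x * ennreal (\<Sum>j\<in>J. q j * h j x) * \<psi> x = (\<Sum>j\<in>J. ennreal (q j) * (indicator U x * ennreal (h j x) * \<psi> x))"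
    proof (cases "x \<in> U")
      case True
      then have "ennreal (\<Sum>j\<in>J. q j * h j x) = (\<Sum>j\<in>J. ennreal (q j) * ennreal (h j x))"
        using q adm_nonneg[OF h] by (subst sum_ennreal[symmetric]) (auto simp: ennreal_mult intro!: sum.cong)
      then show ?thesis using True by (simp add: sum_distrib_right mult.assoc)
    qed simp
  qed
  also have "\<dots> = (\<Sum>j\<in>J. ennreal (q j) * (\<integral>\<^sup>+x. indicator U x * ennreal (h j x) * \<psi> x \<partial>lborel))"
    by (subst nn_integral_sum) (auto intro!: sum.cong nn_integral_cmult)
  also have "\<dots> = (\<Sum>j\<in>J. ennreal (q j) * (\<integral>\<^sup>+x. \<psi> x \<partial>nu (h j)))"
    by (intro sum.cong refl) (simp add: nn_integral_nu[OF h])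
  finally show ?thesis .
qed

lemma nn_integral_P:
  assumes f: "adm f" and [measurable]: "\<psi> \<in> borel_measurable borel"
  shows "(\<integral>\<^sup>+x. \<psi> x \<partial>nu (P f)) = (\<Sum>j\<in>G \<union> B. ennreal (p j) * (\<integral>\<^sup>+x. \<psi> (T j x) \<partial>nu f))"
proof -
  have "P f = (\<lambda>x. \<Sum>j\<in>G \<union> B. p j * push2 j f x)" by (simp add: P_def fun_eq_iff)
  then have "(\<integral>\<^sup>+x. \<psi> x \<partial>nu (P f)) = (\<Sum>j\<in>G \<union> B. ennreal (p j) * (\<integral>\<^sup>+x. \<psi> x \<partial>nu (push2 j f)))"
    using nn_integral_nu_sum[OF finite_GB, of "\<lambda>j. push2 j f" p \<psi>] adm_push2 f p_pos by (simp add: less_imp_le)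
  then show ?thesis using nn_integral_push2(1)[OF _ f, of _ \<psi>] by (auto intro!: sum.cong)
qed

lemma p_sum_ennreal: "(\<Sum>j\<in>G \<union> B. ennreal (p j)) = 1"
  using p_sum p_pos by (subst sum_ennreal) (auto simp: less_imp_le)

lemma mass_P: assumes "adm f" shows "emeasure (nu (P f)) UNIV = emeasure (nu f) UNIV"
  using nn_integral_P[OF assms, of "\<lambda>_. 1"] p_sum_ennreal by (simp add: sum_distrib_right[symmetric])

lemma adm_bound:
  assumes f: "adm f" and mass: "emeasure (nu f) UNIV \<le> 1" and x: "x \<in> U"
  shows "f x * min (edge x) \<bar>x - c\<bar> \<le> 4"
proof -
  have m: "(\<integral>\<^sup>+x. indicator U x * ennreal (f x) \<partial>lborel) \<le> 1"
    using nn_integral_nu[OF f, of "\<lambda>_. 1"] mass by simp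
  have sub: "(\<integral>\<^sup>+x. indicator {s<..<t} x * ennreal (f x) \<partial>lborel) \<le> 1" if "{s<..<t} \<subseteq> U" for s t
    using that by (intro order_trans[OF nn_integral_mono m]) (auto split: split_indicator)
  have fx: "0 \<le> f x" by (rule adm_nonneg[OF f x])
  show ?thesis
  proof (cases "x < c")
    case True
    have "f x * min (x - 0) (c - x) \<le> 4"
      using f x True by (intro koebe_bound[OF _ sub]) (auto simp: adm_def U_def)
    moreover have "f x * min (edge x) \<bar>x - c\<bar> \<le> f x * min (x - 0) (c - x)"
      using fx True by (intro mult_left_mono) (auto simp: edge_def)
    ultimately show ?thesis by linarith
  next
    case False
    then have "f x * min (x - c) (1 - x) \<le> 4"
      using f x by (intro koebe_bound[OF _ sub]) (auto simp: adm_def U_def)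
    moreover have "f x * min (edge x) \<bar>x - c\<bar> \<le> f x * min (x - c) (1 - x)"
      using fx False by (intro mult_left_mono) (auto simp: edge_def)
    ultimately show ?thesis by linarith
  qed
qed

text \<open>Chosen so that a point within \<open>gap\<close> of \<open>c\<close> is at least
  \<open>gap\<close> away from 0 and 1.\<close>

definition gap :: real where "gap = min c (1 - c) / 2"

lemma gap_pos: "0 < gap" using c by (simp add: gap_def)

text \<open>The image under a good map is Koebe over all of (0,1), with no break at
  \<open>c\<close>, so \<open>koebe_bound\<close> gives the density bound 4 / \<open>gap\<close>
  near \<open>c\<close> for every admissible \<open>f\<close> of mass at most 1.\<close>

lemma good_near_c:
  assumes j: "j \<in> G" and f: "adm f" and mass: "emeasure (nu f) UNIV \<le> 1"
    and [measurable]: "\<psi> \<in> borel_measurable borel" and supp: "\<And>x. x \<in> {0<..<1} \<Longrightarrow> gap \<le> \<bar>x - c\<bar> \<Longrightarrow> \<psi> x = 0"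
  shows "(\<integral>\<^sup>+x. \<psi> (T j x) \<partial>nu f) \<le> ennreal (4 / gap) * (\<integral>\<^sup>+x. \<psi> x \<partial>lborel)"
proof -
  have jGB: "j \<in> G \<union> B" using j by simp
  have k: "koebe 0 1 (push2 j f)"
    using koebe_add[OF push_koebe[OF good(1)[OF j]] push_koebe[OF good(2)[OF j]]] f
    by (simp add: adm_def push2_def[abs_def])
  have "(\<integral>\<^sup>+x. ennreal (push2 j f x) \<partial>lborel) \<le> 1"
    using nn_integral_push2(2)[OF jGB f, of "\<lambda>_. 1"] mass by simp
  then have m: "(\<integral>\<^sup>+x. indicator {0<..<1} x * ennreal (push2 j f x) \<partial>lborel) \<le> 1"
    by (elim order_trans[rotated]) (auto intro!: nn_integral_mono split: split_indicator)
  have b: "push2 j f x \<le> 4 / gap" if x: "x \<in> {0<..<1}" "\<bar>x - c\<bar> < gap" for x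
  proof -
    have "gap \<le> min (x - 0) (1 - x)" using x(2) unfolding gap_def by (auto simp: min_def abs_if split: if_splits)
    then have "push2 j f x * gap \<le> push2 j f x * min (x - 0) (1 - x)"
      using koebe_nonneg[OF k x(1)] by (intro mult_left_mono)
    also have "\<dots> \<le> 4" using x by (intro koebe_bound[OF k m]) auto
    finally show ?thesis using gap_pos by (simp add: field_simps)
  qed
  have "(\<integral>\<^sup>+x. \<psi> (T j x) \<partial>nu f) = (\<integral>\<^sup>+x. \<psi> x * ennreal (push2 j f x) \<partial>lborel)"
    by (rule nn_integral_push2(2)[OF jGB f, symmetric]) simp
  also have "\<dots> \<le> (\<integral>\<^sup>+x. ennreal (4 / gap) * \<psi> x \<partial>lborel)"
  proof (rule nn_integral_mono)
    fix x
    show "\<psi> x * ennreal (push2 j f x) \<le> ennreal (4 / gap) * \<psi> x"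
    proof (cases "x \<in> {0<..<1} \<and> \<bar>x - c\<bar> < gap")
      case True
      then have "ennreal (push2 j f x) \<le> ennreal (4 / gap)" using b by (intro ennreal_leI) auto
      then show ?thesis by (subst mult.commute) (intro mult_right_mono, auto)
    next
      case False
      then show ?thesis using supp[of x] push2_zero[OF jGB, of x f] by (cases "x \<in> {0<..<1}") auto
    qed
  qed
  also have "\<dots> = ennreal (4 / gap) * (\<integral>\<^sup>+x. \<psi> x \<partial>lborel)" by (rule nn_integral_cmult) simp
  finally show ?thesis .
qed

end

section \<open>Drift towards the interior\<close>

context random_map
begin

text \<open>The poles of the Lyapunov function at the endpoints are \<open>E\<close> itself; the pole at \<open>c\<close> is
  truncated to so small a neighbourhood of \<open>c\<close> that the mass which good maps bring close to \<open>c\<close>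
  costs at most half of the gain \<open>ln a\<close> at the endpoints.\<close>

definition log_peak :: "real \<Rightarrow> real \<Rightarrow> real" where "log_peak d x = max 0 (D x - d)"
definition theta where "theta = (\<Sum>j\<in>B. p j * l j)"
text \<open>Bad maps reduce the averaged peak at \<open>c\<close> by the fraction 1 -
  \<open>theta\<close>. The weight makes this gain r + 1 times the peak: \<open>r\<close> units pay
  for mass thrown from near \<open>c\<close> to the endpoints, and one unit remains.\<close>

definition peak_weight where "peak_weight = (r + 1) / (1 - theta)"
text \<open>The additive costs of one step: \<open>C + r * d\<close> at the endpoints,
  \<open>peak_weight * (d + C)\<close> at \<open>c\<close>, and the gain \<open>ln a\<close> that is
  to hold everywhere.\<close>

definition drift_const where "drift_const d = C + r * d + peak_weight * (d + C) + ln a"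

lemma log_peak_meas[measurable]: "log_peak d \<in> borel_measurable borel" unfolding log_peak_def by measurable

lemma theta_bounds: "0 \<le> theta" "theta < 1"
  using theta l p_pos unfolding theta_def by (auto intro!: sum_nonneg mult_nonneg_nonneg simp: less_imp_le) (force simp: less_imp_le intro: order_trans[of 0 1])

lemma peak_weight_pos: "0 < peak_weight" "peak_weight * (1 - theta) = r + 1" using theta_bounds r by (auto simp: peak_weight_def)

text \<open>In the repelling zone every map lowers \<open>E\<close> by \<open>ln a\<close> and sends
  the point so far from \<open>c\<close> that the peak vanishes. Elsewhere the surplus unit of the
  peak covers \<open>drift_const d\<close> unless the peak is small, which is the case singled out
  by the indicator. Good maps are absent from the peak sum: no pointwise estimate keeps their images
  off \<open>c\<close>, so they are treated after integration.\<close>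

lemma drift_pointwise:
  assumes d: "C \<le> d" and x: "x \<in> U"
  shows "(\<Sum>j\<in>G \<union> B. p j * E (T j x)) + peak_weight * (\<Sum>j\<in>B. p j * log_peak d (T j x)) + ln a
    \<le> E x + peak_weight * log_peak d x + drift_const d * indicator {x. \<eta> \<le> edge x \<and> log_peak d x \<le> drift_const d} x"
proof -
  note U = U_D[OF x]
  have x01: "x \<in> {0<..<1}" using U by simp
  have ex: "0 < edge x" using U by (simp add: edge_def)
  have la: "0 < ln a" using a by simp
  have drift_const: "0 \<le> drift_const d" using d C r peak_weight_pos la unfolding drift_const_def by (intro add_nonneg_nonneg mult_nonneg_nonneg) auto
  have Dtx: "0 \<le> log_peak d x" by (simp add: log_peak_def)
  show ?thesis
  proof (cases "edge x < \<eta>")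
    case True
    have "E (T j x) \<le> E x - ln a" if j: "j \<in> G \<union> B" for j
    proof -
      have "ln (a * edge x) \<le> ln (edge (T j x))"
        using repel[OF j x01 True] ex a by (intro ln_mono) auto
      then show ?thesis using ex a by (simp add: E_def ln_mult)
    qed
    then have "(\<Sum>j\<in>G \<union> B. p j * E (T j x)) \<le> (\<Sum>j\<in>G \<union> B. p j * (E x - ln a))"
      using p_pos by (intro sum_mono mult_left_mono) (auto simp: less_imp_le)
    also have "\<dots> = E x - ln a" using p_sum by (simp add: sum_distrib_right[symmetric])
    finally have 1: "(\<Sum>j\<in>G \<union> B. p j * E (T j x)) \<le> E x - ln a" .
    have "log_peak d (T j x) = 0" if "j \<in> B" for j
      using edge_off_c[of j x] that x01 True d by (auto simp: log_peak_def D_def)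
    then have "(\<Sum>j\<in>B. p j * log_peak d (T j x)) = 0" by simp
    then show ?thesis using 1 drift_const Dtx peak_weight_pos by (auto intro!: add_increasing2)
  next
    case False
    then have ed: "\<eta> \<le> edge x" by simp
    have Dx: "D x \<le> log_peak d x + d" by (simp add: log_peak_def)
    have "(\<Sum>j\<in>G \<union> B. p j * E (T j x)) \<le> (\<Sum>j\<in>G \<union> B. p j * (C + r * D x))"
      using inner_edge x ed p_pos by (intro sum_mono mult_left_mono) (auto simp: less_imp_le U_def E_def D_def)
    also have "\<dots> = C + r * D x" using p_sum by (simp add: sum_distrib_right[symmetric])
    also have "\<dots> \<le> C + r * (log_peak d x + d)" using Dx r by (intro add_left_mono mult_left_mono) auto
    finally have 1: "(\<Sum>j\<in>G \<union> B. p j * E (T j x)) \<le> C + r * log_peak d x + r * d" by (simp add: algebra_simps)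
    have "(\<Sum>j\<in>B. p j * log_peak d (T j x)) \<le> (\<Sum>j\<in>B. p j * (l j * log_peak d x + l j * d + C))"
    proof (intro sum_mono mult_left_mono)
      fix j assume j: "j \<in> B"
      have "D (T j x) \<le> C + l j * D x" using bad_c[OF j] x by (simp add: U_def D_def)
      also have "\<dots> \<le> C + l j * (log_peak d x + d)" using Dx l[OF j] by (intro add_left_mono mult_left_mono) auto
      finally have "D (T j x) \<le> C + l j * (log_peak d x + d)" .
      moreover have "0 \<le> l j * log_peak d x + l j * d + C" using l[OF j] Dtx d C by auto
      ultimately show "log_peak d (T j x) \<le> l j * log_peak d x + l j * d + C"
        using d C by (auto simp: log_peak_def[of d "T j x"] algebra_simps)
      show "0 \<le> p j" using p_pos[of j] j by auto
    qed
    also have "\<dots> = theta * log_peak d x + theta * d + C * (\<Sum>j\<in>B. p j)"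
      by (simp add: theta_def sum_distrib_left sum_distrib_right sum.distrib[symmetric] algebra_simps)
    also have "\<dots> \<le> theta * log_peak d x + 1 * d + C * 1"
      using mult_right_mono[of theta 1 d] mult_left_mono[of "sum p B" 1 C] p_le[of B] theta_bounds C d by simp
    finally have "peak_weight * (\<Sum>j\<in>B. p j * log_peak d (T j x)) \<le> peak_weight * (theta * log_peak d x + 1 * d + C * 1)"
      using peak_weight_pos by (intro mult_left_mono) auto
    also have "\<dots> = peak_weight * log_peak d x - (peak_weight * (1 - theta)) * log_peak d x + peak_weight * (d + C)" by (simp add: algebra_simps)
    also have "\<dots> = peak_weight * log_peak d x - (r + 1) * log_peak d x + peak_weight * (d + C)" unfolding peak_weight_pos ..
    finally have 2: "peak_weight * (\<Sum>j\<in>B. p j * log_peak d (T j x)) \<le> peak_weight * log_peak d x - r * log_peak d x - log_peak d x + peak_weight * (d + C)"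
      by (simp add: algebra_simps)
    have 3: "drift_const d - log_peak d x \<le> drift_const d * indicator {x. \<eta> \<le> edge x \<and> log_peak d x \<le> drift_const d} x"
      using ed Dtx drift_const by (auto split: split_indicator)
    show ?thesis using 1 2 3 E_nonneg[OF x01] unfolding drift_const_def by linarith
  qed
qed

definition lyapunov :: "real \<Rightarrow> real \<Rightarrow> ennreal" where
  "lyapunov d x = ennreal (E x) + ennreal (peak_weight * log_peak d x)"

text \<open>Up to the point \<open>c\<close>, a region at positive distance from 0, \<open>c\<close>
  and 1. It may contain \<open>c\<close> itself, where \<open>D\<close> is 0 by convention;
  \<open>nu\<close> does not charge that point.\<close>

definition inner :: "real \<Rightarrow> real set" where
  "inner d = {x. \<eta> \<le> edge x \<and> log_peak d x \<le> drift_const d}"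

lemma lyapunov_meas[measurable]: "lyapunov d \<in> borel_measurable borel" unfolding lyapunov_def by measurable

lemma inner_meas[measurable]: "inner d \<in> sets borel"
proof -
  have [measurable]: "edge \<in> borel_measurable borel" unfolding edge_def by measurable
  show ?thesis unfolding inner_def by measurable
qed

lemma log_peak_integral: "(\<integral>\<^sup>+x. ennreal (log_peak d x) \<partial>lborel) \<le> ennreal (8 * exp (- d))"
proof -
  have "(\<integral>\<^sup>+x. ennreal (log_peak d x) \<partial>lborel) = (\<integral>\<^sup>+x. ennreal (max 0 (ln (exp (- d) / \<bar>x - c\<bar>))) \<partial>lborel)"
  proof (rule nn_integral_cong_AE)
    have "AE x in lborel. x \<noteq> c" by (rule AE_lborel_singleton)
    then show "AE x in lborel. ennreal (log_peak d x) = ennreal (max 0 (ln (exp (- d) / \<bar>x - c\<bar>)))"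
      by eventually_elim (simp add: log_peak_def D_def ln_div)
  qed
  also have "\<dots> \<le> ennreal (8 * exp (- d))" by (rule nn_integral_log_singularity) simp
  finally show ?thesis .
qed

text \<open>The pointwise inequality is integrated, with the bad maps only in the peak term. The
  peaks created by good maps are bounded by the density bound 4 / \<open>gap\<close> times the
  Lebesgue integral of the peak, which gives the last summand.\<close>

lemma drift:
  assumes d: "C \<le> d" "exp (- d) \<le> gap" and f: "adm f" and mass: "emeasure (nu f) UNIV = 1"
  shows "(\<integral>\<^sup>+x. lyapunov d x \<partial>nu (P f)) + ennreal (ln a)
    \<le> (\<integral>\<^sup>+x. lyapunov d x \<partial>nu f) + ennreal (drift_const d) * emeasure (nu f) (inner d) + ennreal (peak_weight * (4 / gap) * (8 * exp (- d)))"
proof -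
  have pj: "0 \<le> p j" if "j \<in> G \<union> B" for j using p_pos[OF that] by simp
  note [measurable] = T_meas
  have Tm: "T j \<in> borel_measurable borel" if "j \<in> G \<union> B" for j using T_meas[OF that] .
  have mE: "(\<lambda>x. E (T j x)) \<in> borel_measurable borel" and mD: "(\<lambda>x. log_peak d (T j x)) \<in> borel_measurable borel"
    if "j \<in> G \<union> B" for j using measurable_compose[OF Tm[OF that] E_meas] measurable_compose[OF Tm[OF that] log_peak_meas] by auto
  have "(\<integral>\<^sup>+x. lyapunov d x \<partial>nu (P f)) = (\<integral>\<^sup>+x. ennreal (E x) \<partial>nu (P f)) + (\<integral>\<^sup>+x. ennreal (peak_weight * log_peak d x) \<partial>nu (P f))"
    unfolding lyapunov_def by (rule nn_integral_add) auto
  also have "\<dots> = (\<Sum>j\<in>G \<union> B. ennreal (p j) * (\<integral>\<^sup>+x. ennreal (E (T j x)) \<partial>nu f))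
      + (\<Sum>j\<in>G \<union> B. ennreal (p j) * (\<integral>\<^sup>+x. ennreal (peak_weight * log_peak d (T j x)) \<partial>nu f))"
    by (simp add: nn_integral_P[OF f])
  also have "(\<Sum>j\<in>G \<union> B. ennreal (p j) * (\<integral>\<^sup>+x. ennreal (peak_weight * log_peak d (T j x)) \<partial>nu f))
      = (\<Sum>j\<in>B. ennreal (p j) * (\<integral>\<^sup>+x. ennreal (peak_weight * log_peak d (T j x)) \<partial>nu f))
        + (\<Sum>j\<in>G. ennreal (p j) * (\<integral>\<^sup>+x. ennreal (peak_weight * log_peak d (T j x)) \<partial>nu f))"
    using finite disj by (subst sum.union_disjoint) (auto simp: add.commute)
  finally have eq: "(\<integral>\<^sup>+x. lyapunov d x \<partial>nu (P f)) = (\<Sum>j\<in>G \<union> B. ennreal (p j) * (\<integral>\<^sup>+x. ennreal (E (T j x)) \<partial>nu f))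
      + ((\<Sum>j\<in>B. ennreal (p j) * (\<integral>\<^sup>+x. ennreal (peak_weight * log_peak d (T j x)) \<partial>nu f))
        + (\<Sum>j\<in>G. ennreal (p j) * (\<integral>\<^sup>+x. ennreal (peak_weight * log_peak d (T j x)) \<partial>nu f)))" .
  have "(\<Sum>j\<in>G. ennreal (p j) * (\<integral>\<^sup>+x. ennreal (peak_weight * log_peak d (T j x)) \<partial>nu f))
      \<le> (\<Sum>j\<in>G. ennreal (p j) * ennreal (peak_weight * (4 / gap) * (8 * exp (- d))))"
  proof (intro sum_mono mult_left_mono)
    fix j assume j: "j \<in> G"
    have "(\<integral>\<^sup>+x. ennreal (peak_weight * log_peak d (T j x)) \<partial>nu f) \<le> ennreal (4 / gap) * (\<integral>\<^sup>+x. ennreal (peak_weight * log_peak d x) \<partial>lborel)"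
    proof (rule good_near_c[OF j f])
      fix x assume "gap \<le> \<bar>x - c\<bar>"
      then have "exp (- d) \<le> \<bar>x - c\<bar>" "0 < \<bar>x - c\<bar>" using d gap_pos by auto
      then have "- d \<le> ln \<bar>x - c\<bar>" by (simp add: ln_ge_iff)
      then show "ennreal (peak_weight * log_peak d x) = 0" by (simp add: log_peak_def D_def)
    qed (use mass in auto)
    also have "(\<integral>\<^sup>+x. ennreal (peak_weight * log_peak d x) \<partial>lborel) = ennreal peak_weight * (\<integral>\<^sup>+x. ennreal (log_peak d x) \<partial>lborel)"
      using peak_weight_pos by (simp add: ennreal_mult' nn_integral_cmult)
    also have "ennreal (4 / gap) * (ennreal peak_weight * (\<integral>\<^sup>+x. ennreal (log_peak d x) \<partial>lborel)) \<le> ennreal (4 / gap) * (ennreal peak_weight * ennreal (8 * exp (- d)))"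
      by (intro mult_left_mono log_peak_integral) auto
    also have "\<dots> = ennreal (peak_weight * (4 / gap) * (8 * exp (- d)))"
      using peak_weight_pos gap_pos by (simp add: ennreal_mult[symmetric] mult_ac)
    finally show "(\<integral>\<^sup>+x. ennreal (peak_weight * log_peak d (T j x)) \<partial>nu f) \<le> ennreal (peak_weight * (4 / gap) * (8 * exp (- d)))" .
  qed simp
  also have "(\<Sum>j\<in>G. ennreal (p j) * ennreal (peak_weight * (4 / gap) * (8 * exp (- d)))) \<le> ennreal (peak_weight * (4 / gap) * (8 * exp (- d)))"
  proof -
    have "(\<Sum>j\<in>G. ennreal (p j)) = ennreal (\<Sum>j\<in>G. p j)" using pj by (subst sum_ennreal) auto
    also have "\<dots> \<le> 1" using p_le[of G] by (simp add: ennreal_le_1)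
    finally show ?thesis using mult_right_mono[of "\<Sum>j\<in>G. ennreal (p j)" 1] by (simp add: sum_distrib_right[symmetric])
  qed
  finally have "(\<Sum>j\<in>G. ennreal (p j) * (\<integral>\<^sup>+x. ennreal (peak_weight * log_peak d (T j x)) \<partial>nu f)) \<le> ennreal (peak_weight * (4 / gap) * (8 * exp (- d)))" .
  from add_left_mono[OF add_left_mono[OF this]]
  have 1: "(\<integral>\<^sup>+x. lyapunov d x \<partial>nu (P f)) \<le> (\<Sum>j\<in>G \<union> B. ennreal (p j) * (\<integral>\<^sup>+x. ennreal (E (T j x)) \<partial>nu f))
      + (\<Sum>j\<in>B. ennreal (p j) * (\<integral>\<^sup>+x. ennreal (peak_weight * log_peak d (T j x)) \<partial>nu f)) + ennreal (peak_weight * (4 / gap) * (8 * exp (- d)))"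
    unfolding eq by (simp only: add.assoc)
  have "(\<Sum>j\<in>G \<union> B. ennreal (p j) * (\<integral>\<^sup>+x. ennreal (E (T j x)) \<partial>nu f))
      + (\<Sum>j\<in>B. ennreal (p j) * (\<integral>\<^sup>+x. ennreal (peak_weight * log_peak d (T j x)) \<partial>nu f)) + ennreal (ln a)
    = (\<integral>\<^sup>+x. (\<Sum>j\<in>G \<union> B. ennreal (p j) * ennreal (E (T j x))) + (\<Sum>j\<in>B. ennreal (p j) * ennreal (peak_weight * log_peak d (T j x))) + ennreal (ln a) \<partial>nu f)"
  proof -
    have s1: "(\<Sum>j\<in>G \<union> B. ennreal (p j) * (\<integral>\<^sup>+x. ennreal (E (T j x)) \<partial>nu f)) = (\<integral>\<^sup>+x. (\<Sum>j\<in>G \<union> B. ennreal (p j) * ennreal (E (T j x))) \<partial>nu f)"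
      using mE by (subst nn_integral_sum) (auto intro!: sum.cong nn_integral_cmult[symmetric])
    have s2: "(\<Sum>j\<in>B. ennreal (p j) * (\<integral>\<^sup>+x. ennreal (peak_weight * log_peak d (T j x)) \<partial>nu f)) = (\<integral>\<^sup>+x. (\<Sum>j\<in>B. ennreal (p j) * ennreal (peak_weight * log_peak d (T j x))) \<partial>nu f)"
      using mD by (subst nn_integral_sum) (auto intro!: sum.cong nn_integral_cmult[symmetric])
    have s3: "ennreal (ln a) = (\<integral>\<^sup>+x. ennreal (ln a) \<partial>nu f)" using mass by simp
    have m1: "(\<lambda>x. \<Sum>j\<in>G \<union> B. ennreal (p j) * ennreal (E (T j x))) \<in> borel_measurable (nu f)"
      "(\<lambda>x. \<Sum>j\<in>B. ennreal (p j) * ennreal (peak_weight * log_peak d (T j x))) \<in> borel_measurable (nu f)"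
      using mE mD by (auto intro!: borel_measurable_sum)
    show ?thesis unfolding s1 s2 using m1
      by (subst s3) (subst nn_integral_add, (auto)[2], subst nn_integral_add, auto)
  qed
  also have "\<dots> \<le> (\<integral>\<^sup>+x. lyapunov d x + ennreal (drift_const d) * indicator (inner d) x \<partial>nu f)"
  proof (rule nn_integral_mono_AE)
    show "AE x in nu f. (\<Sum>j\<in>G \<union> B. ennreal (p j) * ennreal (E (T j x))) + (\<Sum>j\<in>B. ennreal (p j) * ennreal (peak_weight * log_peak d (T j x))) + ennreal (ln a)
      \<le> lyapunov d x + ennreal (drift_const d) * indicator (inner d) x"
      using AE_nu_U[OF f]
    proof eventually_elim
      case (elim x)
      have x01: "x \<in> {0<..<1}" using U_D[OF elim] by simp
      have e1: "(\<Sum>j\<in>G \<union> B. ennreal (p j) * ennreal (E (T j x))) = ennreal (\<Sum>j\<in>G \<union> B. p j * E (T j x))"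
        using pj E_nonneg[OF T_U[OF _ elim]] by (subst sum_ennreal[symmetric]) (auto simp: ennreal_mult intro!: sum.cong)
      have Dt0: "0 \<le> log_peak d y" for y by (simp add: log_peak_def)
      have e2: "(\<Sum>j\<in>B. ennreal (p j) * ennreal (peak_weight * log_peak d (T j x))) = ennreal (peak_weight * (\<Sum>j\<in>B. p j * log_peak d (T j x)))"
      proof -
        have "(\<Sum>j\<in>B. ennreal (p j) * ennreal (peak_weight * log_peak d (T j x))) = ennreal (\<Sum>j\<in>B. p j * (peak_weight * log_peak d (T j x)))"
          using pj Dt0 peak_weight_pos by (subst sum_ennreal[symmetric]) (auto simp: ennreal_mult intro!: sum.cong)
        then show ?thesis by (simp add: sum_distrib_left mult.left_commute)
      qed
      have n1: "0 \<le> (\<Sum>j\<in>G \<union> B. p j * E (T j x))" using pj E_nonneg[OF T_U[OF _ elim]] by (intro sum_nonneg) auto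
      have n2: "0 \<le> peak_weight * (\<Sum>j\<in>B. p j * log_peak d (T j x))" using pj Dt0 peak_weight_pos by (intro mult_nonneg_nonneg sum_nonneg) auto
      have la: "0 \<le> ln a" using a by simp
      have drift_const: "0 \<le> drift_const d" using d C r peak_weight_pos la unfolding drift_const_def by (intro add_nonneg_nonneg mult_nonneg_nonneg) auto
      have "ennreal ((\<Sum>j\<in>G \<union> B. p j * E (T j x)) + peak_weight * (\<Sum>j\<in>B. p j * log_peak d (T j x)) + ln a)
          \<le> ennreal (E x + peak_weight * log_peak d x + drift_const d * indicator (inner d) x)"
        unfolding inner_def by (rule ennreal_leI[OF drift_pointwise[OF d(1) elim]])
      then show ?case unfolding e1 e2 lyapunov_def using n1 n2 la drift_const E_nonneg[OF x01] peak_weight_pos Dt0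
        by (simp add: ennreal_mult' ennreal_indicator)
    qed
  qed
  also have "\<dots> = (\<integral>\<^sup>+x. lyapunov d x \<partial>nu f) + ennreal (drift_const d) * emeasure (nu f) (inner d)"
    by (subst nn_integral_add) (auto simp: nn_integral_cmult_indicator)
  finally have 2: "(\<Sum>j\<in>G \<union> B. ennreal (p j) * (\<integral>\<^sup>+x. ennreal (E (T j x)) \<partial>nu f))
      + (\<Sum>j\<in>B. ennreal (p j) * (\<integral>\<^sup>+x. ennreal (peak_weight * log_peak d (T j x)) \<partial>nu f)) + ennreal (ln a)
    \<le> (\<integral>\<^sup>+x. lyapunov d x \<partial>nu f) + ennreal (drift_const d) * emeasure (nu f) (inner d)" .
  let ?k = "ennreal (peak_weight * (4 / gap) * (8 * exp (- d)))"
  have "(\<integral>\<^sup>+x. lyapunov d x \<partial>nu (P f)) + ennreal (ln a) \<le> ((\<Sum>j\<in>G \<union> B. ennreal (p j) * (\<integral>\<^sup>+x. ennreal (E (T j x)) \<partial>nu f))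
      + (\<Sum>j\<in>B. ennreal (p j) * (\<integral>\<^sup>+x. ennreal (peak_weight * log_peak d (T j x)) \<partial>nu f)) + ?k) + ennreal (ln a)"
    by (rule add_right_mono[OF 1])
  also have "\<dots> = ((\<Sum>j\<in>G \<union> B. ennreal (p j) * (\<integral>\<^sup>+x. ennreal (E (T j x)) \<partial>nu f))
      + (\<Sum>j\<in>B. ennreal (p j) * (\<integral>\<^sup>+x. ennreal (peak_weight * log_peak d (T j x)) \<partial>nu f)) + ennreal (ln a)) + ?k"
    by (simp only: add_ac)
  also have "\<dots> \<le> ((\<integral>\<^sup>+x. lyapunov d x \<partial>nu f) + ennreal (drift_const d) * emeasure (nu f) (inner d)) + ?k"
    by (rule add_right_mono[OF 2])
  finally show ?thesis .
qed

section \<open>Cesaro means of the iterated densities\<close>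

definition density_iter :: "nat \<Rightarrow> real \<Rightarrow> real" where "density_iter k = (P ^^ k) (\<lambda>_. 1)"

lemma adm_density_iter: "adm (density_iter k)"
proof (induction k)
  case (Suc k)
  from adm_P[OF this] show ?case by (simp add: density_iter_def)
qed (simp add: density_iter_def adm_def koebe_const)

lemma mass_density_iter: "emeasure (nu (density_iter k)) UNIV = 1"
proof (induction k)
  case 0
  have "emeasure (nu (density_iter 0)) UNIV = (\<integral>\<^sup>+x. indicator U x \<partial>lborel)"
    using nn_integral_nu[OF adm_density_iter, of "\<lambda>_. 1" 0] by (simp add: density_iter_def)
  also have "\<dots> = emeasure lborel ({0<..<c} \<union> {c<..<1})" by (simp add: U_def)
  also have "\<dots> = emeasure lborel {0<..<c} + emeasure lborel {c<..<1}" by (rule plus_emeasure[symmetric]) auto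
  also have "\<dots> = 1" using c by (simp add: ennreal_plus[symmetric] del: ennreal_plus)
  finally show ?case .
next
  case (Suc k)
  then show ?case using mass_P[OF adm_density_iter[of k]] by (simp add: density_iter_def)
qed

text \<open>Lebesgue measure is a legitimate start because logarithmic poles are integrable.\<close>

lemma lyapunov_initial: "(\<integral>\<^sup>+x. lyapunov d x \<partial>nu (density_iter 0)) < \<infinity>"
proof -
  let ?h = "\<lambda>e x. ennreal (max 0 (ln (1 / \<bar>x - e\<bar>)))"
  have h: "(\<integral>\<^sup>+x. ?h e x \<partial>lborel) < \<infinity>" for e :: real
    using nn_integral_log_singularity[of 1 e] by (simp add: le_less_trans)
  have "(\<integral>\<^sup>+x. lyapunov d x \<partial>nu (density_iter 0)) = (\<integral>\<^sup>+x. indicator U x * lyapunov d x \<partial>lborel)"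
    using nn_integral_nu[OF adm_density_iter, of "lyapunov d" 0] by (simp add: density_iter_def)
  also have "\<dots> \<le> (\<integral>\<^sup>+x. (?h 0 x + ?h 1 x) + ennreal peak_weight * ennreal (log_peak d x) \<partial>lborel)"
  proof (rule nn_integral_mono)
    fix x
    show "indicator U x * lyapunov d x \<le> (?h 0 x + ?h 1 x) + ennreal peak_weight * ennreal (log_peak d x)"
    proof (cases "x \<in> U")
      case True
      note u = U_D[OF True]
      have "E x \<le> max 0 (ln (1 / \<bar>x - 0\<bar>)) + max 0 (ln (1 / \<bar>x - 1\<bar>))"
        using u by (auto simp: E_def edge_def ln_div min_def)
      then have "ennreal (E x) \<le> ennreal (max 0 (ln (1 / \<bar>x - 0\<bar>)) + max 0 (ln (1 / \<bar>x - 1\<bar>)))"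
        by (rule ennreal_leI)
      then have "ennreal (E x) \<le> ?h 0 x + ?h 1 x" by (simp only: ennreal_plus max.cobounded1)
      then show ?thesis using True peak_weight_pos by (simp add: lyapunov_def ennreal_mult' add_mono)
    qed simp
  qed
  also have "\<dots> = (\<integral>\<^sup>+x. ?h 0 x \<partial>lborel) + (\<integral>\<^sup>+x. ?h 1 x \<partial>lborel) + ennreal peak_weight * (\<integral>\<^sup>+x. ennreal (log_peak d x) \<partial>lborel)"
    by (simp add: nn_integral_add nn_integral_cmult)
  also have "\<dots> < \<infinity>"
    using h[of 0] h[of 1] log_peak_integral[of d] by (auto simp: ennreal_mult_less_top le_less_trans less_top)
  finally show ?thesis .
qed

definition avg :: "nat \<Rightarrow> real \<Rightarrow> real" where "avg n x = (\<Sum>k<n. (1 / real n) * density_iter k x)"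

lemma adm_avg: "adm (avg n)"
  unfolding adm_def avg_def[abs_def]
  by (intro conjI koebe_sum koebe_scale) (use adm_density_iter in \<open>simp_all add: adm_def\<close>)

lemma nn_integral_avg:
  assumes "\<psi> \<in> borel_measurable borel"
  shows "(\<integral>\<^sup>+x. \<psi> x \<partial>nu (avg n)) = (\<Sum>k<n. ennreal (1 / real n) * (\<integral>\<^sup>+x. \<psi> x \<partial>nu (density_iter k)))"
  using nn_integral_nu_sum[of "{..<n}" density_iter "\<lambda>_. 1 / real n" \<psi>] adm_density_iter assms by (simp add: avg_def[abs_def])

text \<open>The mass is 1 except at \<open>n = 0\<close>, where the empty sum is the zero
  function.\<close>

lemma mass_avg: "emeasure (nu (avg n)) UNIV \<le> 1"
  using nn_integral_avg[of "\<lambda>_. 1" n] mass_density_iter by (cases "n = 0") (auto simp: ennreal_of_nat_eq_real_of_nat ennreal_mult[symmetric])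

text \<open>The drift inequality is summed over k < n. The Lyapunov integral cannot become negative,
  so the accumulated gain of order \<open>n\<close> must be balanced by the masses of
  \<open>inner d\<close>, whose mean is therefore bounded below.\<close>

lemma avg_inner_mass:
  obtains d \<delta> n0 where "0 < \<delta>" "\<And>n. n0 \<le> n \<Longrightarrow> ennreal \<delta> \<le> emeasure (nu (avg n)) (inner d)"
proof -
  define \<alpha> where "\<alpha> = ln a"
  have \<alpha>: "0 < \<alpha>" using a by (simp add: \<alpha>_def)
  \<comment> \<open>The first two bounds are the assumptions of \<open>drift\<close>; the third
    makes its error term at most half of \<open>ln a\<close>.\<close>
  define d where "d = max C (max (- ln gap) (ln (64 * peak_weight / (gap * \<alpha>))))"
  have d1: "C \<le> d" by (simp add: d_def)
  have "exp (- d) \<le> exp (ln gap)" unfolding exp_le_cancel_iff by (simp add: d_def)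
  then have d2: "exp (- d) \<le> gap" using gap_pos by simp
  have "64 * peak_weight / (gap * \<alpha>) = exp (ln (64 * peak_weight / (gap * \<alpha>)))" using peak_weight_pos gap_pos \<alpha> by simp
  also have "\<dots> \<le> exp d" unfolding exp_le_cancel_iff by (simp add: d_def)
  finally have "64 * peak_weight \<le> exp d * (gap * \<alpha>)" using peak_weight_pos gap_pos \<alpha> by (simp add: pos_divide_le_eq)
  then have d3: "peak_weight * (4 / gap) * (8 * exp (- d)) \<le> \<alpha> / 2"
    using gap_pos by (simp add: exp_minus field_simps)
  have drift_const: "0 < drift_const d" using d1 C r peak_weight_pos \<alpha> unfolding drift_const_def \<alpha>_def by (intro add_nonneg_pos add_nonneg_nonneg mult_nonneg_nonneg) auto
  define u0 where "u0 = enn2real (\<integral>\<^sup>+x. lyapunov d x \<partial>nu (density_iter 0))"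
  have u0: "(\<integral>\<^sup>+x. lyapunov d x \<partial>nu (density_iter 0)) = ennreal u0" "0 \<le> u0" using lyapunov_initial by (auto simp: u0_def less_top)
  define v where "v k = enn2real (emeasure (nu (density_iter k)) (inner d))" for k
  have v: "emeasure (nu (density_iter k)) (inner d) = ennreal (v k)" "0 \<le> v k" for k
  proof -
    have "emeasure (nu (density_iter k)) (inner d) \<le> emeasure (nu (density_iter k)) UNIV" by (intro emeasure_mono) auto
    then have "emeasure (nu (density_iter k)) (inner d) < top" by (simp add: mass_density_iter le_less_trans)
    then show "emeasure (nu (density_iter k)) (inner d) = ennreal (v k)" "0 \<le> v k" by (auto simp: v_def)
  qed
  \<comment> \<open>One half of \<open>ln a\<close> is spent on the error term, the other half
    remains as gain.\<close>
  have step: "(\<integral>\<^sup>+x. lyapunov d x \<partial>nu (density_iter (Suc k))) + ennreal (\<alpha> / 2) \<le> (\<integral>\<^sup>+x. lyapunov d x \<partial>nu (density_iter k)) + ennreal (drift_const d * v k)" for k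
  proof -
    have "(\<integral>\<^sup>+x. lyapunov d x \<partial>nu (density_iter (Suc k))) + ennreal (\<alpha> / 2) + ennreal (\<alpha> / 2) = (\<integral>\<^sup>+x. lyapunov d x \<partial>nu (P (density_iter k))) + ennreal (ln a)"
      using \<alpha> by (simp add: density_iter_def add.assoc ennreal_plus[symmetric] \<alpha>_def del: ennreal_plus)
    also have "\<dots> \<le> (\<integral>\<^sup>+x. lyapunov d x \<partial>nu (density_iter k)) + ennreal (drift_const d) * emeasure (nu (density_iter k)) (inner d) + ennreal (peak_weight * (4 / gap) * (8 * exp (- d)))"
      by (rule drift[OF d1 d2 adm_density_iter mass_density_iter])
    also have "\<dots> \<le> (\<integral>\<^sup>+x. lyapunov d x \<partial>nu (density_iter k)) + ennreal (drift_const d * v k) + ennreal (\<alpha> / 2)"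
      using drift_const v d3 by (intro add_mono ennreal_leI) (auto simp: ennreal_mult)
    finally have "ennreal (\<alpha> / 2) + ((\<integral>\<^sup>+x. lyapunov d x \<partial>nu (density_iter (Suc k))) + ennreal (\<alpha> / 2))
        \<le> ennreal (\<alpha> / 2) + ((\<integral>\<^sup>+x. lyapunov d x \<partial>nu (density_iter k)) + ennreal (drift_const d * v k))"
      by (simp only: add_ac)
    then show ?thesis unfolding ennreal_add_left_cancel_le by simp
  qed
  have sum: "(\<integral>\<^sup>+x. lyapunov d x \<partial>nu (density_iter n)) + ennreal (real n * (\<alpha> / 2)) \<le> ennreal (u0 + drift_const d * (\<Sum>k<n. v k))" for n
  proof (induction n)
    case (Suc n)
    have s0: "0 \<le> (\<Sum>k<n. v k)" using v by (intro sum_nonneg) auto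
    have "(\<integral>\<^sup>+x. lyapunov d x \<partial>nu (density_iter (Suc n))) + ennreal (real (Suc n) * (\<alpha> / 2))
        = (\<integral>\<^sup>+x. lyapunov d x \<partial>nu (density_iter (Suc n))) + ennreal (\<alpha> / 2) + ennreal (real n * (\<alpha> / 2))"
      using \<alpha> by (simp add: add.assoc ennreal_plus[symmetric] algebra_simps add_divide_distrib del: ennreal_plus)
    also have "\<dots> \<le> (\<integral>\<^sup>+x. lyapunov d x \<partial>nu (density_iter n)) + ennreal (drift_const d * v n) + ennreal (real n * (\<alpha> / 2))"
      by (intro add_right_mono step)
    also have "\<dots> = (\<integral>\<^sup>+x. lyapunov d x \<partial>nu (density_iter n)) + ennreal (real n * (\<alpha> / 2)) + ennreal (drift_const d * v n)" by (simp add: add_ac)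
    also have "\<dots> \<le> ennreal (u0 + drift_const d * (\<Sum>k<n. v k)) + ennreal (drift_const d * v n)" by (intro add_right_mono Suc)
    also have "\<dots> = ennreal (u0 + drift_const d * (\<Sum>k<Suc n. v k))"
      using u0 drift_const v s0 by (subst ennreal_plus[symmetric]) (auto simp: algebra_simps)
    finally show ?case .
  qed (simp add: u0)
  \<comment> \<open>From here on the initial Lyapunov integral \<open>u0\<close> is at most n
    \<alpha> / 4, half of the accumulated gain.\<close>
  define n0 where "n0 = Suc (nat \<lceil>4 * u0 / \<alpha>\<rceil>)"
  have "ennreal (\<alpha> / (4 * drift_const d)) \<le> emeasure (nu (avg n)) (inner d)" if n: "n0 \<le> n" for n
  proof -
    have npos: "0 < real n" using n by (simp add: n0_def)
    have "4 * u0 / \<alpha> \<le> real n" using n unfolding n0_def by linarith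
    then have "u0 \<le> real n * (\<alpha> / 4)" using \<alpha> by (simp add: field_simps)
    moreover have s0: "0 \<le> (\<Sum>k<n. v k)" using v by (intro sum_nonneg) auto
    moreover have "real n * (\<alpha> / 2) \<le> u0 + drift_const d * (\<Sum>k<n. v k)"
    proof -
      have "ennreal (real n * (\<alpha> / 2)) \<le> ennreal (u0 + drift_const d * (\<Sum>k<n. v k))"
        using sum[of n] by (rule order_trans[rotated]) simp
      then show ?thesis using u0 drift_const s0 by (subst (asm) ennreal_le_iff) auto
    qed
    ultimately have "real n * (\<alpha> / 4) \<le> drift_const d * (\<Sum>k<n. v k)" by (simp add: algebra_simps)
    then have "\<alpha> / (4 * drift_const d) \<le> (1 / real n) * (\<Sum>k<n. v k)" using drift_const npos by (simp add: field_simps)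
    then have "ennreal (\<alpha> / (4 * drift_const d)) \<le> ennreal (\<Sum>k<n. (1 / real n) * v k)" by (simp add: sum_distrib_left ennreal_leI)
    also have "\<dots> = (\<Sum>k<n. ennreal (1 / real n) * emeasure (nu (density_iter k)) (inner d))"
      using v by (subst sum_ennreal[symmetric]) (auto simp: ennreal_mult[symmetric] intro!: sum.cong)
    also have "\<dots> = emeasure (nu (avg n)) (inner d)"
      using nn_integral_avg[of "indicator (inner d)" n] by simp
    finally show ?thesis .
  qed
  moreover have "0 < \<alpha> / (4 * drift_const d)" using \<alpha> drift_const by simp
  ultimately show thesis using that by blast
qed

end

section \<open>The invariant density\<close>

text \<open>The lower limit is taken in \<open>ennreal\<close>, where Fatou's lemma applies, and
  returned to the reals; the bound \<open>M\<close> keeps it finite. The last two facts characterise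
  it by eventual inequalities.\<close>

lemma liminf_enn2real:
  fixes s :: "nat \<Rightarrow> real"
  assumes "\<And>n. 0 \<le> s n" "\<And>n. s n \<le> M"
  defines "L \<equiv> enn2real (liminf (\<lambda>n. ennreal (s n)))"
  shows "liminf (\<lambda>n. ennreal (s n)) = ennreal L" "0 \<le> L"
    "\<And>e. 0 < e \<Longrightarrow> \<forall>\<^sub>F n in sequentially. L - e < s n"
    "\<And>t. \<forall>\<^sub>F n in sequentially. t \<le> s n \<Longrightarrow> t \<le> L"
proof -
  have "liminf (\<lambda>n. ennreal (s n)) \<le> limsup (\<lambda>n. ennreal (s n))" by (rule Liminf_le_Limsup) simp
  also have "\<dots> \<le> ennreal M" using assms by (intro Limsup_bounded always_eventually allI ennreal_leI)
  finally have "liminf (\<lambda>n. ennreal (s n)) < top" by (simp add: le_less_trans)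
  then show eq: "liminf (\<lambda>n. ennreal (s n)) = ennreal L" by (simp add: L_def)
  show L0: "0 \<le> L" by (simp add: L_def)
  show "\<forall>\<^sub>F n in sequentially. L - e < s n" if e: "0 < e" for e
  proof (cases "0 \<le> L - e")
    case True
    then have "ennreal (L - e) < liminf (\<lambda>n. ennreal (s n))" using e eq by (simp add: ennreal_less_iff)
    then have "\<forall>\<^sub>F n in sequentially. ennreal (L - e) < ennreal (s n)" by (rule less_LiminfD)
    then show ?thesis by eventually_elim (use True in \<open>simp add: ennreal_less_iff\<close>)
  next
    case False
    then have "L - e < s n" for n using assms(1)[of n] by linarith
    then show ?thesis by (intro always_eventually) blast
  qed
  show "t \<le> L" if "\<forall>\<^sub>F n in sequentially. t \<le> s n" for t
  proof -
    have "\<forall>\<^sub>F n in sequentially. ennreal t \<le> ennreal (s n)" using that by eventually_elim (rule ennreal_leI)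
    then have "ennreal t \<le> ennreal L" unfolding eq[symmetric] by (rule Liminf_bounded)
    then show ?thesis using L0 by (simp add: ennreal_le_iff)
  qed
qed

lemma push_sum: "push s t S (\<lambda>x. \<Sum>k\<in>K. q k * h k x) x = (\<Sum>k\<in>K. q k * push s t S (h k) x)"
  by (simp add: push_def sum_divide_distrib)

context random_map
begin

definition w :: "real \<Rightarrow> real" where "w x = enn2real (liminf (\<lambda>n. ennreal (avg n x)))"

definition bnd :: "real \<Rightarrow> real" where "bnd x = 4 / min (edge x) \<bar>x - c\<bar>"

lemma bnd: assumes "adm h" "emeasure (nu h) UNIV \<le> 1" "x \<in> U" shows "0 \<le> h x" "h x \<le> bnd x"
  using adm_nonneg[OF assms(1,3)] adm_bound[OF assms] U_D[OF assms(3)]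
  by (auto simp: bnd_def edge_def pos_le_divide_eq)

lemma avg_bnd: "x \<in> U \<Longrightarrow> 0 \<le> avg n x" "x \<in> U \<Longrightarrow> avg n x \<le> bnd x"
  using bnd[OF adm_avg mass_avg] by auto

lemma w_liminf:
  assumes x: "x \<in> U"
  shows "liminf (\<lambda>n. ennreal (avg n x)) = ennreal (w x)" "0 \<le> w x"
    "\<And>e. 0 < e \<Longrightarrow> \<forall>\<^sub>F n in sequentially. w x - e < avg n x"
    "\<And>t. \<forall>\<^sub>F n in sequentially. t \<le> avg n x \<Longrightarrow> t \<le> w x"
  using liminf_enn2real[of "\<lambda>n. avg n x" "bnd x", folded w_def] avg_bnd[OF x] by auto

text \<open>A lower limit is monotone and commutes with positive factors. It does not matter that
  the lower limits at \<open>x\<close> and \<open>y\<close> may be attained along different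
  subsequences, because the inequality holds for every \<open>n\<close>.\<close>

lemma w_compare:
  assumes "x \<in> U" "y \<in> U" "0 \<le> s" "0 < t" "\<And>n. s * avg n x \<le> t * avg n y"
  shows "s * w x \<le> t * w y"
proof (cases "s = 0")
  case True
  then show ?thesis using w_liminf(2)[OF assms(2)] assms by simp
next
  case False
  then have s: "0 < s" using assms by simp
  show ?thesis
  proof (rule field_le_epsilon)
    fix e :: real assume e: "0 < e"
    have "\<forall>\<^sub>F n in sequentially. w x - e / s < avg n x" using e s by (intro w_liminf(3)[OF assms(1)]) auto
    then have "\<forall>\<^sub>F n in sequentially. s * (w x - e / s) / t \<le> avg n y"
    proof eventually_elim
      case (elim n)
      then have "s * (w x - e / s) \<le> s * avg n x" using s by simp
      also have "\<dots> \<le> t * avg n y" by (rule assms)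
      finally show ?case using assms(4) by (simp add: pos_divide_le_eq mult.commute)
    qed
    then have "s * (w x - e / s) / t \<le> w y" by (rule w_liminf(4)[OF assms(2)])
    then have "s * (w x - e / s) \<le> t * w y" using assms(4) by (simp add: pos_divide_le_eq mult.commute)
    then show "s * w x \<le> t * w y + e" using s by (simp add: algebra_simps)
  qed
qed

lemma adm_w: "adm w"
proof -
  have k: "koebe lo hi w" if sub: "{lo<..<hi} \<subseteq> U" and av: "\<And>n. koebe lo hi (avg n)" for lo hi
    unfolding koebe_def
  proof (intro allI impI)
    fix x y assume xy: "lo < x \<and> x \<le> y \<and> y < hi"
    then have U: "x \<in> U" "y \<in> U" using sub by auto
    show "0 \<le> w x \<and> (x - lo)\<^sup>2 * w x \<le> (y - lo)\<^sup>2 * w y \<and> (hi - y)\<^sup>2 * w y \<le> (hi - x)\<^sup>2 * w x"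
      using w_liminf(2)[OF U(1)] xy
      by (intro conjI w_compare U koebeD(2,3)[OF av]) auto
  qed
  have "koebe 0 c (avg n)" "koebe c 1 (avg n)" for n using adm_avg[of n] by (auto simp: adm_def)
  then show ?thesis unfolding adm_def by (intro conjI k) (auto simp: U_def)
qed

text \<open>Fatou's lemma gives only an upper bound, as mass may be lost in the limit; that
  \<open>w\<close> does not vanish is shown in \<open>w_pos\<close>.\<close>

lemma mass_w: "emeasure (nu w) UNIV \<le> 1"
proof -
  have "emeasure (nu w) UNIV = (\<integral>\<^sup>+x. indicator U x * ennreal (w x) \<partial>lborel)"
    using nn_integral_nu[OF adm_w, of "\<lambda>_. 1"] by simp
  also have "\<dots> = (\<integral>\<^sup>+x. liminf (\<lambda>n. indicator U x * ennreal (avg n x)) \<partial>lborel)"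
  proof (rule nn_integral_cong)
    fix x show "indicator U x * ennreal (w x) = liminf (\<lambda>n. indicator U x * ennreal (avg n x))"
      using w_liminf(1)[of x] by (cases "x \<in> U") (auto simp: Liminf_const)
  qed
  also have "\<dots> \<le> liminf (\<lambda>n. \<integral>\<^sup>+x. indicator U x * ennreal (avg n x) \<partial>lborel)"
    using adm_meas[OF adm_avg] by (intro nn_integral_liminf) simp
  also have "\<dots> \<le> limsup (\<lambda>n. \<integral>\<^sup>+x. indicator U x * ennreal (avg n x) \<partial>lborel)" by (rule Liminf_le_Limsup) simp
  also have "\<dots> \<le> 1"
    using mass_avg nn_integral_nu[OF adm_avg, of "\<lambda>_. 1"] by (intro Limsup_bounded) simp
  finally show ?thesis .
qed

lemma P_avg: "P (avg n) x = avg n x + (density_iter n x - density_iter 0 x) / n"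
proof -
  have "P (avg n) x = (\<Sum>j\<in>G \<union> B. p j * (\<Sum>k<n. (1 / real n) * push2 j (density_iter k) x))"
    unfolding P_def push2_def avg_def[abs_def] push_sum by (simp add: sum.distrib[symmetric] distrib_left)
  also have "\<dots> = (\<Sum>k<n. (1 / real n) * P (density_iter k) x)"
    unfolding P_def sum_distrib_left by (subst sum.swap) (simp add: mult.left_commute)
  also have "\<dots> = (\<Sum>k<n. (1 / real n) * density_iter (Suc k) x)" by (simp add: density_iter_def)
  also have "\<dots> = avg n x + (\<Sum>k<n. (1 / real n) * (density_iter (Suc k) x - density_iter k x))"
    unfolding avg_def by (simp add: sum.distrib[symmetric] algebra_simps)
  also have "(\<Sum>k<n. (1 / real n) * (density_iter (Suc k) x - density_iter k x)) = (density_iter n x - density_iter 0 x) / n"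
    unfolding sum_distrib_left[symmetric] using sum_lessThan_telescope[of "\<lambda>k. density_iter k x" n] by simp
  finally show ?thesis .
qed

text \<open>Telescoping leaves a difference of two densities divided by \<open>n\<close>, and at a
  fixed point all densities of mass at most 1 in the cone share the bound
  \<open>bnd x\<close>.\<close>

lemma avg_ge_P_avg:
  assumes x: "x \<in> U" and e: "0 < e"
  shows "\<forall>\<^sub>F n in sequentially. P (avg n) x - e \<le> avg n x"
proof -
  have "((\<lambda>n. bnd x / real n) \<longlongrightarrow> 0) sequentially" by (rule lim_const_over_n)
  then have "\<forall>\<^sub>F n in sequentially. bnd x / real n < e" using e by (rule order_tendstoD(2))
  then show ?thesis
  proof eventually_elim
    case (elim n)
    have "density_iter n x - density_iter 0 x \<le> bnd x" using bnd[OF adm_density_iter _ x] mass_density_iter by (smt (verit) order_refl)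
    then have "(density_iter n x - density_iter 0 x) / n \<le> bnd x / n" by (intro divide_right_mono) auto
    then show ?case using elim P_avg[of n x] by simp
  qed
qed

text \<open>\<open>P\<close> at a point is a nonnegative combination of finitely many preimage
  values. At each of these the means eventually exceed \<open>w\<close> minus a tolerance, so
  \<open>P\<close> of the lower limit is at most the lower limit of \<open>P\<close>.\<close>

lemma P_w_le: assumes x: "x \<in> U" shows "P w x \<le> w x"
proof -
  have push_ev: "\<forall>\<^sub>F n in sequentially. push s t (T j) w x - e \<le> push s t (T j) (avg n) x"
    if e: "0 < e" and st: "{s<..<t} \<subseteq> U" and d: "\<And>y. y \<in> {s<..<t} \<Longrightarrow> deriv (T j) y \<noteq> 0" for s t e and j :: 'i
  proof (cases "x \<in> T j ` {s<..<t}")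
    case True
    define y where "y = inv_into {s<..<t} (T j) x"
    have y: "y \<in> {s<..<t}" unfolding y_def using True by (rule inv_into_into)
    then have dy: "0 < \<bar>deriv (T j) y\<bar>" and yU: "y \<in> U" using d st by auto
    \<comment> \<open>The tolerance is scaled by the derivative, so that it becomes exactly
      \<open>e\<close> after the division in \<open>push\<close>.\<close>
    have "\<forall>\<^sub>F n in sequentially. w y - e * \<bar>deriv (T j) y\<bar> < avg n y"
      using e dy by (intro w_liminf(3)[OF yU]) simp
    then show ?thesis
    proof eventually_elim
      case (elim n)
      then have "(w y - e * \<bar>deriv (T j) y\<bar>) / \<bar>deriv (T j) y\<bar> \<le> avg n y / \<bar>deriv (T j) y\<bar>"
        using dy by (intro divide_right_mono) auto
      then show ?case using dy True by (simp add: push_def y_def[symmetric] diff_divide_distrib)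
    qed
  next
    case False
    then show ?thesis using e by (simp add: push_outside)
  qed
  show ?thesis
  proof (rule field_le_epsilon)
    fix e :: real assume e: "0 < e"
    have "\<forall>\<^sub>F n in sequentially. push2 j w x - e / 2 \<le> push2 j (avg n) x" if j: "j \<in> G \<union> B" for j
    proof -
      obtain s s' t t' where br: "koebe_branch 0 c s t (T j)" "koebe_branch c 1 s' t' (T j)"
        using good[of j] bad[of j] j by auto
      have "\<forall>\<^sub>F n in sequentially. push 0 c (T j) w x - e / 4 \<le> push 0 c (T j) (avg n) x"
        using e koebe_branch_deriv(2)[OF br(1)] by (intro push_ev) (auto simp: U_def)
      moreover have "\<forall>\<^sub>F n in sequentially. push c 1 (T j) w x - e / 4 \<le> push c 1 (T j) (avg n) x"
        using e koebe_branch_deriv(2)[OF br(2)] by (intro push_ev) (auto simp: U_def)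
      ultimately show ?thesis by eventually_elim (simp add: push2_def)
    qed
    then have "\<forall>\<^sub>F n in sequentially. \<forall>j\<in>G \<union> B. push2 j w x - e / 2 \<le> push2 j (avg n) x"
      using finite_GB by (simp add: eventually_ball_finite)
    moreover have "\<forall>\<^sub>F n in sequentially. P (avg n) x - e / 2 \<le> avg n x" using x e by (intro avg_ge_P_avg) auto
    ultimately have "\<forall>\<^sub>F n in sequentially. P w x - e \<le> avg n x"
    proof eventually_elim
      case (elim n)
      have "(\<Sum>j\<in>G \<union> B. p j * (push2 j w x - e / 2)) \<le> P (avg n) x"
        unfolding P_def using elim p_pos by (intro sum_mono mult_left_mono) (auto simp: less_imp_le)
      moreover have "(\<Sum>j\<in>G \<union> B. p j * (push2 j w x - e / 2)) = P w x - e / 2"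
        unfolding P_def using p_sum by (simp add: right_diff_distrib sum_subtractf sum_distrib_right[symmetric] sum_divide_distrib[symmetric])
      ultimately show ?case using elim by simp
    qed
    then have "P w x - e \<le> w x" by (rule w_liminf(4)[OF x])
    then show "P w x \<le> w x + e" by simp
  qed
qed

text \<open>A good map gives \<open>x0\<close> a preimage in each half of (0,1). The Harnack
  inequality on each half bounds \<open>h\<close> on \<open>inner d\<close> by its value at that
  preimage, and both values enter P h x0 with positive weight.\<close>

lemma P_lower:
  assumes x0: "x0 \<in> U"
  obtains k where "0 < k" "\<And>h. adm h \<Longrightarrow> ennreal k * emeasure (nu h) (inner d) \<le> ennreal (P h x0)"
proof -
  obtain g where g: "g \<in> G" using G_ne by auto
  have x01: "x0 \<in> {0<..<1}" using U_D[OF x0] by simp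
  have "x0 \<in> T g ` {0<..<c}" using koebe_branch_image[OF good(1)[OF g]] x01 by simp
  then obtain y where y: "y \<in> {0<..<c}" "x0 = T g y" by auto
  have "x0 \<in> T g ` {c<..<1}" using koebe_branch_image[OF good(2)[OF g]] x01 by simp
  then obtain z where z: "z \<in> {c<..<1}" "x0 = T g z" by auto
  \<comment> \<open>A lower bound for the distance of the points of \<open>inner d\<close> in
    \<open>U\<close> from 0, \<open>c\<close> and 1.\<close>
  define \<delta> where "\<delta> = min \<eta> (exp (- (d + drift_const d)))"
  have \<delta>: "0 < \<delta>" using \<eta> by (simp add: \<delta>_def)
  define ky where "ky = \<delta>\<^sup>2 * (min (y - 0) (c - y))\<^sup>2"
  define kz where "kz = \<delta>\<^sup>2 * (min (z - c) (1 - z))\<^sup>2"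
  have ky: "0 < ky" and kz: "0 < kz" using \<delta> y z by (auto simp: ky_def kz_def min_def)
  define dy dz where "dy = \<bar>deriv (T g) y\<bar>" and "dz = \<bar>deriv (T g) z\<bar>"
  have dy: "0 < dy" and dz: "0 < dz"
    using koebe_branch_deriv(2)[OF good(1)[OF g] y(1)] koebe_branch_deriv(2)[OF good(2)[OF g] z(1)] by (auto simp: dy_def dz_def)
  have pg: "0 < p g" using p_pos g by simp
  define k where "k = p g * min (ky / dy) (kz / dz)"
  have k: "0 < k" using pg ky kz dy dz by (simp add: k_def)
  show thesis
  proof (rule that[OF k])
    fix h assume h: "adm h"
    have hk: "koebe 0 c h" "koebe c 1 h" using h by (auto simp: adm_def)
    have hy: "0 \<le> h y" and hz: "0 \<le> h z" using koebe_nonneg[OF hk(1) y(1)] koebe_nonneg[OF hk(2) z(1)] by auto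
    have bound: "h x \<le> h y / ky + h z / kz" if x: "x \<in> U" "x \<in> inner d" for x
    proof -
      note u = U_D[OF x(1)]
      have ex: "\<delta> \<le> edge x" using x(2) by (simp add: inner_def \<delta>_def min.coboundedI1)
      have "D x \<le> d + drift_const d" using x(2) by (simp add: inner_def log_peak_def)
      then have "- (d + drift_const d) \<le> ln \<bar>x - c\<bar>" by (simp add: D_def)
      then have "exp (- (d + drift_const d)) \<le> \<bar>x - c\<bar>" using u by (simp add: ln_ge_iff)
      then have xc: "\<delta> \<le> \<bar>x - c\<bar>" unfolding \<delta>_def by (rule min.coboundedI2)
      show ?thesis
      proof (cases "x < c")
        case True
        have "\<delta>\<^sup>2 * h x * (min (y - 0) (c - y))\<^sup>2 \<le> h y"
          by (rule koebe_compare(2)[OF hk(1) \<delta>]) (use c y ex xc True in \<open>auto simp: edge_def\<close>)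
        then have "h x \<le> h y / ky" using ky by (simp add: ky_def pos_le_divide_eq mult_ac)
        then show ?thesis using hz kz by (simp add: add_increasing2)
      next
        case False
        have "\<delta>\<^sup>2 * h x * (min (z - c) (1 - z))\<^sup>2 \<le> h z"
          by (rule koebe_compare(2)[OF hk(2) \<delta>]) (use c z ex xc False in \<open>auto simp: edge_def\<close>)
        then have "h x \<le> h z / kz" using kz by (simp add: kz_def pos_le_divide_eq mult_ac)
        then show ?thesis using hy ky by (simp add: add_increasing)
      qed
    qed
    have "emeasure (nu h) (inner d) = (\<integral>\<^sup>+x. indicator U x * ennreal (h x) * indicator (inner d) x \<partial>lborel)"
      using nn_integral_nu[OF h, of "indicator (inner d)"] by simp
    also have "\<dots> \<le> (\<integral>\<^sup>+x. ennreal (h y / ky + h z / kz) * indicator {0<..<1::real} x \<partial>lborel)"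
    proof (rule nn_integral_mono)
      fix x
      show "indicator U x * ennreal (h x) * indicator (inner d) x \<le> ennreal (h y / ky + h z / kz) * indicator {0<..<1} x"
        using bound[of x] U_D[of x] by (auto split: split_indicator intro: ennreal_leI)
    qed
    also have "\<dots> = ennreal (h y / ky + h z / kz)" by (simp add: nn_integral_cmult_indicator)
    finally have "ennreal k * emeasure (nu h) (inner d) \<le> ennreal k * ennreal (h y / ky + h z / kz)" by (rule mult_left_mono) simp
    also have "\<dots> = ennreal (k * (h y / ky + h z / kz))" using k hy hz ky kz by (simp add: ennreal_mult)
    also have "\<dots> \<le> ennreal (P h x0)"
    proof (rule ennreal_leI)
      have "k * (h y / ky + h z / kz) = p g * (min (ky / dy) (kz / dz) * (h y / ky) + min (ky / dy) (kz / dz) * (h z / kz))"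
        by (simp add: k_def algebra_simps)
      also have "\<dots> \<le> p g * ((ky / dy) * (h y / ky) + (kz / dz) * (h z / kz))"
        using pg hy hz ky kz by (intro mult_left_mono add_mono mult_right_mono) auto
      also have "\<dots> = p g * push2 g h x0"
      proof -
        have "push 0 c (T g) h x0 = h y / dy"
          unfolding y(2) dy_def by (rule push_image[OF koebe_branch_inj[OF good(1)[OF g]] y(1)])
        moreover have "push c 1 (T g) h x0 = h z / dz"
          unfolding z(2) dz_def by (rule push_image[OF koebe_branch_inj[OF good(2)[OF g]] z(1)])
        ultimately show ?thesis using ky kz by (simp add: push2_def)
      qed
      also have "\<dots> \<le> P h x0"
        unfolding P_def using g finite_GB p_pos adm_nonneg[OF adm_push2[OF _ h] x0]
        by (intro member_le_sum) (auto intro!: mult_nonneg_nonneg simp: less_imp_le)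
      finally show "k * (h y / ky + h z / kz) \<le> P h x0" .
    qed
    finally show "ennreal k * emeasure (nu h) (inner d) \<le> ennreal (P h x0)" .
  qed
qed

lemma w_pos: assumes x: "x \<in> U" shows "0 < w x"
proof -
  obtain d \<delta> n0 where \<delta>: "0 < \<delta>" and n0: "\<And>n. n0 \<le> n \<Longrightarrow> ennreal \<delta> \<le> emeasure (nu (avg n)) (inner d)"
    by (rule avg_inner_mass, rule that)
  obtain k where k: "0 < k" "\<And>h. adm h \<Longrightarrow> ennreal k * emeasure (nu h) (inner d) \<le> ennreal (P h x)"
    by (rule P_lower[OF x, of d], rule that)
  have "\<forall>\<^sub>F n in sequentially. n0 \<le> n" by (rule eventually_ge_at_top)
  moreover have "\<forall>\<^sub>F n in sequentially. P (avg n) x - k * \<delta> / 2 \<le> avg n x" using k \<delta> x by (intro avg_ge_P_avg) auto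
  ultimately have "\<forall>\<^sub>F n in sequentially. k * \<delta> / 2 \<le> avg n x"
  proof eventually_elim
    case (elim n)
    have "ennreal (k * \<delta>) = ennreal k * ennreal \<delta>" using k \<delta> by (simp add: ennreal_mult)
    also have "\<dots> \<le> ennreal k * emeasure (nu (avg n)) (inner d)" using n0 elim by (intro mult_left_mono) auto
    also have "\<dots> \<le> ennreal (P (avg n) x)" by (rule k(2)[OF adm_avg])
    finally have "k * \<delta> \<le> P (avg n) x" using adm_nonneg[OF adm_P[OF adm_avg] x] by (simp add: ennreal_le_iff)
    then show ?case using elim by simp
  qed
  then have "k * \<delta> / 2 \<le> w x" by (rule w_liminf(4)[OF x])
  then show ?thesis using k \<delta> by (smt (verit) divide_pos_pos mult_pos_pos)
qed

lemma vimage_T: "j \<in> G \<union> B \<Longrightarrow> X \<in> sets borel \<Longrightarrow> T j -` X \<in> sets borel"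
  using measurable_sets_borel[OF T_meas] by auto

text \<open>The measure of P w lies below that of \<open>w\<close> on every Borel set and has the
  same finite total mass. A strict inequality on \<open>X\<close> could not be made up on the
  complement.\<close>

lemma stationary_w:
  assumes X[measurable]: "X \<in> sets borel"
  shows "emeasure (nu w) X = (\<Sum>j\<in>G \<union> B. ennreal (p j) * emeasure (nu w) (T j -` X))"
proof -
  have le: "emeasure (nu (P w)) Y \<le> emeasure (nu w) Y" if [measurable]: "Y \<in> sets borel" for Y
  proof -
    have "emeasure (nu (P w)) Y = (\<integral>\<^sup>+x. indicator U x * ennreal (P w x) * indicator Y x \<partial>lborel)"
      using nn_integral_nu[OF adm_P[OF adm_w], of "indicator Y"] by simp
    also have "\<dots> \<le> (\<integral>\<^sup>+x. indicator U x * ennreal (w x) * indicator Y x \<partial>lborel)"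
      using P_w_le by (intro nn_integral_mono) (auto split: split_indicator intro: ennreal_leI)
    also have "\<dots> = emeasure (nu w) Y" using nn_integral_nu[OF adm_w, of "indicator Y"] by simp
    finally show ?thesis .
  qed
  have fin: "emeasure (nu w) Y < \<infinity>" if "Y \<in> sets borel" for Y
  proof -
    have "emeasure (nu w) Y \<le> emeasure (nu w) UNIV" by (intro emeasure_mono) auto
    then show ?thesis using mass_w by (simp add: le_less_trans[OF order_trans])
  qed
  have "emeasure (nu w) X = emeasure (nu (P w)) X"
  proof (rule antisym)
    have split: "emeasure (nu h) UNIV = emeasure (nu h) X + emeasure (nu h) (- X)" for h
      by (subst plus_emeasure) auto
    have "emeasure (nu w) X + emeasure (nu w) (- X) = emeasure (nu (P w)) X + emeasure (nu (P w)) (- X)"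
      unfolding split[symmetric] mass_P[OF adm_w] ..
    also have "\<dots> \<le> emeasure (nu (P w)) X + emeasure (nu w) (- X)" by (intro add_left_mono le) simp
    finally have "emeasure (nu w) (- X) + emeasure (nu w) X \<le> emeasure (nu w) (- X) + emeasure (nu (P w)) X" by (simp only: add.commute)
    then show "emeasure (nu w) X \<le> emeasure (nu (P w)) X"
      unfolding ennreal_add_left_cancel_le using fin[of "- X"] by auto
  qed (rule le[OF X])
  also have "\<dots> = (\<Sum>j\<in>G \<union> B. ennreal (p j) * (\<integral>\<^sup>+x. indicator X (T j x) \<partial>nu w))"
    using nn_integral_P[OF adm_w, of "indicator X"] by simp
  also have "\<dots> = (\<Sum>j\<in>G \<union> B. ennreal (p j) * emeasure (nu w) (T j -` X))"
  proof (intro sum.cong refl)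
    fix j assume j: "j \<in> G \<union> B"
    have "(\<integral>\<^sup>+x. indicator X (T j x) \<partial>nu w) = (\<integral>\<^sup>+x. indicator (T j -` X) x \<partial>nu w)"
      by (intro nn_integral_cong) (auto split: split_indicator)
    then show "ennreal (p j) * (\<integral>\<^sup>+x. indicator X (T j x) \<partial>nu w) = ennreal (p j) * emeasure (nu w) (T j -` X)"
      using vimage_T[OF j X] by simp
  qed
  finally show ?thesis .
qed

end

section \<open>Domination of stationary densities\<close>

context random_map
begin

text \<open>On \<open>Es = {h < s w}\<close> the positive part of \<open>s w - h\<close> is integrable and its total mass cannot
  decrease under \<open>P\<close>, so that no mass may leave \<open>Es\<close>; \<open>h\<close> itself need not be integrable.\<close>

lemma compare_exceptional:
  fixes h :: "real \<Rightarrow> ennreal" and s :: real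
  assumes h[measurable]: "h \<in> borel_measurable borel" and s: "0 \<le> s"
    and stat: "\<And>X. X \<in> sets borel \<Longrightarrow> emeasure (density lborel (\<lambda>x. indicator U x * h x)) X =
      (\<Sum>j\<in>G \<union> B. ennreal (p j) * emeasure (density lborel (\<lambda>x. indicator U x * h x)) (T j -` X))"
  defines "Es \<equiv> {x. indicator U x * h x < ennreal s * (indicator U x * ennreal (w x))}"
  shows "Es \<in> sets borel" "j \<in> G \<union> B \<Longrightarrow> emeasure lborel (Es - T j -` Es) = 0"
proof -
  note [measurable] = adm_meas[OF adm_w]
  define hU where "hU x = indicator U x * h x" for x
  define wU where "wU x = ennreal s * (indicator U x * ennreal (w x))" for x
  have [measurable]: "hU \<in> borel_measurable borel" "wU \<in> borel_measurable borel"
    unfolding hU_def wU_def by measurable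
  have Es: "Es = {x. hU x < wU x}" by (simp add: Es_def hU_def wU_def)
  show Em[measurable]: "Es \<in> sets borel" unfolding Es by measurable
  define M where "M = density lborel hU"
  define N where "N = density lborel wU"
  have sM[simp]: "sets M = sets borel" and sN[simp]: "sets N = sets borel" by (simp_all add: M_def N_def)
  have eM: "emeasure M X = (\<integral>\<^sup>+x. hU x * indicator X x \<partial>lborel)" and eN: "emeasure N X = (\<integral>\<^sup>+x. wU x * indicator X x \<partial>lborel)"
    if [measurable]: "X \<in> sets borel" for X
    unfolding M_def N_def by (subst emeasure_density; simp)+
  have eN': "emeasure N X = ennreal s * emeasure (nu w) X" if [measurable]: "X \<in> sets borel" for X
  proof -
    have "emeasure N X = (\<integral>\<^sup>+x. ennreal s * (indicator U x * ennreal (w x) * indicator X x) \<partial>lborel)"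
      unfolding eN[OF that] wU_def by (simp only: mult.assoc)
    also have "\<dots> = ennreal s * (\<integral>\<^sup>+x. indicator U x * ennreal (w x) * indicator X x \<partial>lborel)"
      by (rule nn_integral_cmult) measurable
    also have "(\<integral>\<^sup>+x. indicator U x * ennreal (w x) * indicator X x \<partial>lborel) = emeasure (nu w) X"
      unfolding nu_def by (subst emeasure_density) auto
    finally show ?thesis .
  qed
  have statM: "emeasure M X = (\<Sum>j\<in>G \<union> B. ennreal (p j) * emeasure M (T j -` X))" if "X \<in> sets borel" for X
    using stat[OF that] unfolding M_def hU_def[abs_def] .
  have statN: "emeasure N X = (\<Sum>j\<in>G \<union> B. ennreal (p j) * emeasure N (T j -` X))" if X: "X \<in> sets borel" for X
    using stationary_w[OF X] X vimage_T by (simp add: eN' sum_distrib_left mult.left_commute)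
  have Nfin: "emeasure N X < top" if X: "X \<in> sets borel" for X
  proof -
    have "emeasure (nu w) X \<le> emeasure (nu w) UNIV" by (intro emeasure_mono) auto
    then have "emeasure (nu w) X < top" using mass_w by (simp add: le_less_trans[OF order_trans])
    then show ?thesis using X by (simp add: eN' ennreal_mult_less_top)
  qed
  have in_Es: "emeasure M X \<le> emeasure N X" if "X \<in> sets borel" "X \<subseteq> Es" for X
    unfolding eM[OF that(1)] eN[OF that(1)] using that(2)
    by (intro nn_integral_mono) (auto simp: Es less_imp_le split: split_indicator)
  have off_Es: "emeasure N X \<le> emeasure M X" if "X \<in> sets borel" "X \<inter> Es = {}" for X
    unfolding eM[OF that(1)] eN[OF that(1)] using that(2)
    by (intro nn_integral_mono) (auto simp: Es not_less[symmetric] split: split_indicator)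
  have MEfin: "emeasure M Es < top" using in_Es[OF Em] Nfin[OF Em] by (simp add: le_less_trans)
  have TE: "T j -` Es \<in> sets borel" if "j \<in> G \<union> B" for j using vimage_T[OF that Em] .
  \<comment> \<open>The measure \<open>M\<close> may be infinite, but stationarity and positivity of
    \<open>p j\<close> bound the preimages of \<open>Es\<close> by \<open>Es\<close> itself, so all
    quantities below are real numbers.\<close>
  have MTfin: "emeasure M (T j -` Es) < top" if j: "j \<in> G \<union> B" for j
  proof -
    have "ennreal (p j) * emeasure M (T j -` Es) \<le> emeasure M Es"
      unfolding statM[OF Em] using finite_GB j by (intro member_le_sum) auto
    then have "ennreal (p j) * emeasure M (T j -` Es) < top" using MEfin by (rule le_less_trans)
    then show ?thesis using p_pos[OF j] by (auto simp: ennreal_mult_less_top)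
  qed
  have Mfin: "emeasure M X < top" if "X \<subseteq> Es \<or> X \<subseteq> T j -` Es" "j \<in> G \<union> B" for X j
    using that MEfin MTfin[OF that(2)] emeasure_mono[of X Es M] emeasure_mono[of X "T j -` Es" M] TE[OF that(2)]
    by (auto intro: le_less_trans)
  have mM: "emeasure M X = ennreal (measure M X)" if "emeasure M X < top" for X
    using that by (intro emeasure_eq_ennreal_measure) auto
  have mN: "emeasure N X = ennreal (measure N X)" if "X \<in> sets borel" for X
    using Nfin[OF that] by (intro emeasure_eq_ennreal_measure) auto
  \<comment> \<open>For each map: the part of \<open>Es\<close> that stays in \<open>Es\<close>, the
    part that leaves, and the part that enters from outside, measured by the given density (m) and
    by s w (n).\<close>
  define m1 m2 m3 where "m1 j = measure M (Es \<inter> T j -` Es)" and "m2 j = measure M (Es - T j -` Es)" and "m3 j = measure M (T j -` Es - Es)" for j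
  define n1 n2 n3 where "n1 j = measure N (Es \<inter> T j -` Es)" and "n2 j = measure N (Es - T j -` Es)" and "n3 j = measure N (T j -` Es - Es)" for j
  have nonneg: "0 \<le> m1 j" "0 \<le> m2 j" "0 \<le> m3 j" "0 \<le> n1 j" "0 \<le> n2 j" "0 \<le> n3 j" for j
    by (simp_all add: m1_def m2_def m3_def n1_def n2_def n3_def)
  have M1: "measure M Es = m1 j + m2 j" "measure M (T j -` Es) = m1 j + m3 j"
    and N1: "measure N Es = n1 j + n2 j" "measure N (T j -` Es) = n1 j + n3 j" if j: "j \<in> G \<union> B" for j
  proof -
    note [measurable] = TE[OF j]
    have split: "emeasure Q X = emeasure Q (X \<inter> Y) + emeasure Q (X - Y)" if "sets Q = sets borel" "X \<in> sets borel" "Y \<in> sets borel" for Q :: "real measure" and X Y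
    proof -
      have "(X \<inter> Y) \<union> (X - Y) = X" by blast
      moreover have "emeasure Q (X \<inter> Y) + emeasure Q (X - Y) = emeasure Q ((X \<inter> Y) \<union> (X - Y))"
        using that by (intro plus_emeasure) auto
      ultimately show ?thesis by simp
    qed
    have "ennreal (measure M Es) = ennreal (m1 j) + ennreal (m2 j)"
      unfolding m1_def m2_def using split[OF sM Em TE[OF j]] mM Mfin[OF _ j] by (metis Diff_subset inf_le1 order_refl)
    then show "measure M Es = m1 j + m2 j" using nonneg by (simp add: ennreal_plus[symmetric] del: ennreal_plus)
    have "ennreal (measure M (T j -` Es)) = ennreal (m1 j) + ennreal (m3 j)"
      unfolding m1_def m3_def using split[OF sM TE[OF j] Em] mM Mfin[OF _ j] by (metis Diff_subset inf_le1 inf_commute order_refl)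
    then show "measure M (T j -` Es) = m1 j + m3 j" using nonneg by (simp add: ennreal_plus[symmetric] del: ennreal_plus)
    have "ennreal (measure N Es) = ennreal (n1 j) + ennreal (n2 j)"
      unfolding n1_def n2_def using split[OF sN Em TE[OF j]] mN Em TE[OF j] by (metis sets.Diff sets.Int)
    then show "measure N Es = n1 j + n2 j" using nonneg by (simp add: ennreal_plus[symmetric] del: ennreal_plus)
    have "ennreal (measure N (T j -` Es)) = ennreal (n1 j) + ennreal (n3 j)"
      unfolding n1_def n3_def using split[OF sN TE[OF j] Em] mN Em TE[OF j] by (metis sets.Diff sets.Int inf_commute)
    then show "measure N (T j -` Es) = n1 j + n3 j" using nonneg by (simp add: ennreal_plus[symmetric] del: ennreal_plus)
  qed
  have le2: "m2 j \<le> n2 j" and le3: "n3 j \<le> m3 j" if j: "j \<in> G \<union> B" for j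
  proof -
    note [measurable] = TE[OF j]
    have "ennreal (m2 j) \<le> ennreal (n2 j)"
      using in_Es[of "Es - T j -` Es"] mM[OF Mfin[OF _ j], of "Es - T j -` Es"] mN[of "Es - T j -` Es"] unfolding m2_def n2_def by auto
    then show "m2 j \<le> n2 j" using nonneg by simp
    have "ennreal (n3 j) \<le> ennreal (m3 j)"
      using off_Es[of "T j -` Es - Es"] mM[OF Mfin[OF _ j], of "T j -` Es - Es"] mN[of "T j -` Es - Es"] unfolding m3_def n3_def by auto
    then show "n3 j \<le> m3 j" using nonneg by simp
  qed
  \<comment> \<open>Stationarity as a balance: after averaging over the maps, outflow from
    \<open>Es\<close> equals inflow.\<close>
  have sumM: "(\<Sum>j\<in>G \<union> B. p j * m2 j) = (\<Sum>j\<in>G \<union> B. p j * m3 j)"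
  proof -
    have "ennreal (measure M Es) = (\<Sum>j\<in>G \<union> B. ennreal (p j) * ennreal (measure M (T j -` Es)))"
      unfolding mM[OF MEfin, symmetric] statM[OF Em] using mM[OF MTfin] by (intro sum.cong refl) metis
    also have "\<dots> = ennreal (\<Sum>j\<in>G \<union> B. p j * measure M (T j -` Es))"
      using p_pos by (subst sum_ennreal[symmetric]) (auto simp: ennreal_mult less_imp_le intro!: sum.cong)
    finally have "measure M Es = (\<Sum>j\<in>G \<union> B. p j * measure M (T j -` Es))"
      using p_pos by (subst (asm) ennreal_inj) (auto intro!: sum_nonneg mult_nonneg_nonneg simp: less_imp_le)
    also have "\<dots> = (\<Sum>j\<in>G \<union> B. p j * (m1 j + m3 j))" using M1(2) by (intro sum.cong refl) metis
    finally have "measure M Es = (\<Sum>j\<in>G \<union> B. p j * (m1 j + m3 j))" .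
    moreover have "measure M Es = (\<Sum>j\<in>G \<union> B. p j * measure M Es)" using p_sum by (simp add: sum_distrib_right[symmetric])
    moreover have "(\<Sum>j\<in>G \<union> B. p j * measure M Es) = (\<Sum>j\<in>G \<union> B. p j * (m1 j + m2 j))" using M1(1) by (intro sum.cong) auto
    ultimately have "(\<Sum>j\<in>G \<union> B. p j * (m1 j + m3 j)) = (\<Sum>j\<in>G \<union> B. p j * (m1 j + m2 j))" by metis
    then show ?thesis by (simp add: distrib_left sum.distrib)
  qed
  have sumN: "(\<Sum>j\<in>G \<union> B. p j * n2 j) = (\<Sum>j\<in>G \<union> B. p j * n3 j)"
  proof -
    have "ennreal (measure N Es) = (\<Sum>j\<in>G \<union> B. ennreal (p j) * ennreal (measure N (T j -` Es)))"
      unfolding mN[OF Em, symmetric] statN[OF Em] using mN[OF TE] by (intro sum.cong refl) metis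
    also have "\<dots> = ennreal (\<Sum>j\<in>G \<union> B. p j * measure N (T j -` Es))"
      using p_pos by (subst sum_ennreal[symmetric]) (auto simp: ennreal_mult less_imp_le intro!: sum.cong)
    finally have "measure N Es = (\<Sum>j\<in>G \<union> B. p j * measure N (T j -` Es))"
      using p_pos by (subst (asm) ennreal_inj) (auto intro!: sum_nonneg mult_nonneg_nonneg simp: less_imp_le)
    also have "\<dots> = (\<Sum>j\<in>G \<union> B. p j * (n1 j + n3 j))" using N1(2) by (intro sum.cong refl) metis
    finally have "measure N Es = (\<Sum>j\<in>G \<union> B. p j * (n1 j + n3 j))" .
    moreover have "measure N Es = (\<Sum>j\<in>G \<union> B. p j * measure N Es)" using p_sum by (simp add: sum_distrib_right[symmetric])
    moreover have "(\<Sum>j\<in>G \<union> B. p j * measure N Es) = (\<Sum>j\<in>G \<union> B. p j * (n1 j + n2 j))" using N1(1) by (intro sum.cong) auto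
    ultimately have "(\<Sum>j\<in>G \<union> B. p j * (n1 j + n3 j)) = (\<Sum>j\<in>G \<union> B. p j * (n1 j + n2 j))" by metis
    then show ?thesis by (simp add: distrib_left sum.distrib)
  qed
  \<comment> \<open>The two balances give sum p n2 = sum p n3 <= sum p m3 = sum p m2, while m2 <= n2
    term by term; hence equality for every map.\<close>
  have "(\<Sum>j\<in>G \<union> B. p j * n3 j) \<le> (\<Sum>j\<in>G \<union> B. p j * m3 j)"
    using le3 p_pos by (intro sum_mono mult_left_mono) (auto simp: less_imp_le)
  then have "(\<Sum>j\<in>G \<union> B. p j * (n2 j - m2 j)) \<le> 0"
    using sumM sumN by (simp add: right_diff_distrib sum_subtractf)
  moreover have nn: "0 \<le> p j * (n2 j - m2 j)" if "j \<in> G \<union> B" for j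
    using le2[OF that] p_pos[OF that] by (intro mult_nonneg_nonneg) auto
  ultimately have "(\<Sum>j\<in>G \<union> B. p j * (n2 j - m2 j)) = 0" by (intro antisym sum_nonneg) auto
  then have "\<forall>j\<in>G \<union> B. p j * (n2 j - m2 j) = 0" using sum_nonneg_eq_0_iff[OF finite_GB, of "\<lambda>j. p j * (n2 j - m2 j)"] nn by blast
  then have eq: "n2 j = m2 j" if "j \<in> G \<union> B" for j using p_pos[OF that] that by force
  show "emeasure lborel (Es - T j -` Es) = 0" if j: "j \<in> G \<union> B"
  proof -
    note [measurable] = TE[OF j]
    let ?X = "Es - T j -` Es"
    have "(\<integral>\<^sup>+x. hU x * indicator ?X x \<partial>lborel) = emeasure M ?X" by (subst eM) auto
    also have "\<dots> = ennreal (m2 j)" unfolding m2_def by (intro mM Mfin[OF _ j]) auto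
    finally have i1: "(\<integral>\<^sup>+x. hU x * indicator ?X x \<partial>lborel) = ennreal (m2 j)" .
    have "(\<integral>\<^sup>+x. wU x * indicator ?X x \<partial>lborel) = emeasure N ?X" by (subst eN) auto
    also have "\<dots> = ennreal (m2 j)" unfolding eq[OF j, symmetric] n2_def by (intro mN) auto
    finally have i2: "(\<integral>\<^sup>+x. wU x * indicator ?X x \<partial>lborel) = ennreal (m2 j)" .
    \<comment> \<open>On \<open>Es\<close> the integrand \<open>hU\<close> is strictly smaller than
      \<open>wU\<close>, so equal finite integrals force the leaving part to be null.\<close>
    have "AE x in lborel. wU x * indicator ?X x \<le> hU x * indicator ?X x"
    proof (rule ccontr)
      assume "\<not> ?thesis"
      then have "(\<integral>\<^sup>+x. hU x * indicator ?X x \<partial>lborel) < (\<integral>\<^sup>+x. wU x * indicator ?X x \<partial>lborel)"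
      proof (rule nn_integral_less[rotated 4])
        have "hU x * indicator ?X x \<le> wU x * indicator ?X x" for x
          using less_imp_le[of "hU x" "wU x"] by (cases "x \<in> ?X") (auto simp: Es)
        then show "AE x in lborel. hU x * indicator ?X x \<le> wU x * indicator ?X x" by simp
      qed (use i1 in simp_all)
      then show False unfolding i1 i2 by simp
    qed
    then have "AE x in lborel. x \<notin> ?X"
      by eventually_elim (auto simp: Es split: split_indicator_asm)
    from emeasure_eq_0_AE[OF this] show ?thesis by (simp add: set_diff_eq)
  qed
qed

lemma full_branch_good: "g \<in> G \<Longrightarrow> full_branch_map c (T g) a \<eta>"
  using c T_meas good a \<eta> repel by unfold_locales auto

text \<open>If no \<open>s\<close> works, then for each \<open>s\<close> the set where h >= s w is
  not null, hence has full measure by the zero-one law for one good map. Taking s = 1, 2, ...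
  contradicts w > 0 and the finiteness of \<open>h\<close>.\<close>

lemma density_dominated:
  fixes h :: "real \<Rightarrow> ennreal"
  assumes h[measurable]: "h \<in> borel_measurable borel" and fin: "AE x in lborel. x \<in> U \<longrightarrow> h x \<noteq> \<infinity>"
    and stat: "\<And>X. X \<in> sets borel \<Longrightarrow> emeasure (density lborel (\<lambda>x. indicator U x * h x)) X =
      (\<Sum>j\<in>G \<union> B. ennreal (p j) * emeasure (density lborel (\<lambda>x. indicator U x * h x)) (T j -` X))"
  obtains s :: real where "0 < s" "AE x in lborel. x \<in> U \<longrightarrow> h x \<le> ennreal (s * w x)"
proof (rule ccontr)
  assume no: "\<not> thesis"
  obtain g where g: "g \<in> G" using G_ne by auto
  interpret F: full_branch_map c "T g" a \<eta> by (rule full_branch_good[OF g])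
  have big: "AE x in lborel. x \<in> U \<longrightarrow> ennreal (real (Suc n) * w x) \<le> h x" for n
  proof -
    define s where "s = real (Suc n)"
    have s: "0 < s" by (simp add: s_def)
    define Es where "Es = {x. indicator U x * h x < ennreal s * (indicator U x * ennreal (w x))}"
    note ce = compare_exceptional[OF h less_imp_le[OF s] stat, folded Es_def]
    have mem: "x \<in> Es \<longleftrightarrow> h x < ennreal (s * w x)" if "x \<in> U" for x
      using that s w_liminf(2)[OF that] by (simp add: Es_def ennreal_mult)
    have EsU: "Es \<subseteq> U" by (auto simp: Es_def split: split_indicator_asm)
    have [measurable]: "Es \<in> sets borel" by (rule ce(1))
    define Z where "Z = U - Es"
    have [measurable]: "Z \<in> sets borel" by (simp add: Z_def)
    have nz: "emeasure lborel Z \<noteq> 0"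
    proof
      assume "emeasure lborel Z = 0"
      then have "Z \<in> null_sets lborel" by auto
      then have "AE x in lborel. x \<notin> Z" by (rule AE_not_in)
      then have "AE x in lborel. x \<in> U \<longrightarrow> h x \<le> ennreal (s * w x)"
        by eventually_elim (auto simp: Z_def mem less_imp_le)
      then show False using no that s by blast
    qed
    have "emeasure lborel ({0<..<1} - Z) = 0"
    proof (rule F.zero_one_law[OF _ _ _ nz])
      show "Z \<subseteq> {0<..<1}" using U_D by (auto simp: Z_def)
      have "emeasure lborel {x \<in> {0<..<c} \<union> {c<..<1}. T g x \<in> Z \<and> x \<notin> Z} \<le> emeasure lborel (Es - T g -` Es)"
      proof (rule emeasure_mono)
        show "{x \<in> {0<..<c} \<union> {c<..<1}. T g x \<in> Z \<and> x \<notin> Z} \<subseteq> Es - T g -` Es" by (auto simp: Z_def U_def)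
        show "Es - T g -` Es \<in> sets lborel" using vimage_T[of g Es] g by auto
      qed
      then show "emeasure lborel {x \<in> {0<..<c} \<union> {c<..<1}. T g x \<in> Z \<and> x \<notin> Z} = 0" using ce(2)[of g] g by simp
    qed simp
    then have "{0<..<1} - Z \<in> null_sets lborel" by auto
    then have "AE x in lborel. x \<notin> {0<..<1} - Z" by (rule AE_not_in)
    then show ?thesis
    proof eventually_elim
      case (elim x)
      show ?case
      proof
        assume x: "x \<in> U"
        then have "x \<notin> Es" using elim U_D[OF x] by (auto simp: Z_def)
        then show "ennreal (real (Suc n) * w x) \<le> h x" using mem[OF x] by (simp add: s_def not_less)
      qed
    qed
  qed
  have "AE x in lborel. \<forall>n. x \<in> U \<longrightarrow> ennreal (real (Suc n) * w x) \<le> h x" unfolding AE_all_countable using big by blast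
  then have "AE x in lborel. x \<notin> U" using fin
  proof eventually_elim
    case (elim x)
    show ?case
    proof
      assume x: "x \<in> U"
      then have "h x \<noteq> \<infinity>" using elim by simp
      then obtain H where H: "h x = ennreal H" "0 \<le> H" by (cases "h x") auto
      obtain n where "H < real n * w x" using reals_Archimedean3[OF w_pos[OF x]] by blast
      also have "\<dots> \<le> real (Suc n) * w x" using w_pos[OF x] by simp
      finally have "\<not> ennreal (real (Suc n) * w x) \<le> h x" using H w_pos[OF x] by (simp add: ennreal_le_iff not_le)
      then show False using elim x by blast
    qed
  qed
  from emeasure_eq_0_AE[OF this] have "emeasure lborel U = 0" by simp
  moreover have "emeasure lborel {0<..<c} \<le> emeasure lborel U" by (intro emeasure_mono) (auto simp: U_def)
  ultimately show False using c by simp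
qed

end

text \<open>By continuity the sum of p l^\<kappa> stays below 1 for some \<kappa> > 1. The ansatz K
  (L + \<sigma>)^(-\<kappa>) is then reproduced by the recursion with factor \<open>q\<close>, and
  the exponentially small source fits into the remaining share 1 - q.\<close>

lemma log_tail_recursion:
  fixes n :: "real \<Rightarrow> real" and p l :: "'i \<Rightarrow> real"
  assumes B: "finite B" and p: "\<And>j. j \<in> B \<Longrightarrow> 0 \<le> p j" and l: "\<And>j. j \<in> B \<Longrightarrow> 1 < l j"
    and theta: "(\<Sum>j\<in>B. p j * l j) < 1" and C: "0 \<le> C" and K0: "0 \<le> K0"
    and n1: "\<And>L. n L \<le> 1"
    and rec: "\<And>L. L0 \<le> L \<Longrightarrow> n L \<le> K0 * exp (- L) + (\<Sum>j\<in>B. p j * n ((L - C) / l j))"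
  obtains \<kappa> K \<sigma> where "1 < \<kappa>" "0 < K" "0 < \<sigma>" "\<And>L. 0 \<le> L \<Longrightarrow> n L \<le> K * (L + \<sigma>) powr (- \<kappa>)"
proof -
  have "((\<lambda>k. \<Sum>j\<in>B. p j * l j powr k) \<longlongrightarrow> (\<Sum>j\<in>B. p j * l j powr 1)) (at_right 1)"
    using l by (intro tendsto_sum tendsto_mult tendsto_powr tendsto_const tendsto_ident_at) fastforce
  moreover have "(\<Sum>j\<in>B. p j * l j powr 1) = (\<Sum>j\<in>B. p j * l j)" using l by (intro sum.cong) fastforce+
  ultimately have "\<forall>\<^sub>F k in at_right 1. (\<Sum>j\<in>B. p j * l j powr k) < 1" using theta by (intro order_tendstoD) auto
  then obtain \<kappa> where \<kappa>: "1 < \<kappa>" "(\<Sum>j\<in>B. p j * l j powr \<kappa>) < 1"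
    using eventually_happens[OF eventually_conj[OF _ eventually_at_right_less[of "1::real"]]] by fastforce
  define q where "q = (\<Sum>j\<in>B. p j * l j powr \<kappa>)"
  have q: "0 \<le> q" "q < 1" using \<kappa> p by (auto simp: q_def intro!: sum_nonneg)
  \<comment> \<open>The shift absorbs \<open>C\<close>: \<sigma> (l - 1) >= C gives (L - C) / l +
    \<sigma> >= (L + \<sigma>) / l.\<close>
  define \<sigma> where "\<sigma> = C + 1 + (\<Sum>j\<in>B. C / (l j - 1))"
  have \<sigma>: "C + 1 \<le> \<sigma>" "C \<le> \<sigma> * (l j - 1)" if "j \<in> B" for j
  proof -
    have nn: "0 \<le> (\<Sum>j\<in>B. C / (l j - 1))" using C l by (intro sum_nonneg divide_nonneg_nonneg) (auto simp: less_imp_le)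
    then show "C + 1 \<le> \<sigma>" by (simp add: \<sigma>_def)
    have "C / (l j - 1) \<le> (\<Sum>j\<in>B. C / (l j - 1))"
      using B that C l by (intro member_le_sum divide_nonneg_nonneg) (auto simp: less_imp_le)
    then have "C / (l j - 1) \<le> \<sigma>" using C by (simp add: \<sigma>_def)
    then show "C \<le> \<sigma> * (l j - 1)" using l[OF that] by (simp add: pos_divide_le_eq)
  qed
  have \<sigma>C: "C + 1 \<le> \<sigma>"
  proof -
    have "0 \<le> (\<Sum>j\<in>B. C / (l j - 1))" using C l by (intro sum_nonneg divide_nonneg_nonneg) (auto simp: less_imp_le)
    then show ?thesis by (simp add: \<sigma>_def)
  qed
  have "((\<lambda>L. exp (- L) * (L + \<sigma>) powr \<kappa>) \<longlongrightarrow> 0) at_top" by real_asymp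
  then have "\<forall>\<^sub>F L in at_top. exp (- L) * (L + \<sigma>) powr \<kappa> < 1" by (rule order_tendstoD) simp
  then obtain L1 where L1: "\<And>L. L1 \<le> L \<Longrightarrow> exp (- L) * (L + \<sigma>) powr \<kappa> < 1"
    unfolding eventually_at_top_linorder by blast
  \<comment> \<open>Beyond l / (l - 1) one has L / l <= L - 1, so the recursion refers at least one
    unit back and the claim extends in unit steps.\<close>
  define L2 where "L2 = max (max L0 L1) (max 0 (\<Sum>j\<in>B. l j / (l j - 1)))"
  have L2: "L0 \<le> L2" "L1 \<le> L2" "0 \<le> L2" by (auto simp: L2_def)
  have dec: "L / l j \<le> L - 1" if "j \<in> B" "L2 \<le> L" for j L
  proof -
    have "l j / (l j - 1) \<le> (\<Sum>j\<in>B. l j / (l j - 1))"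
      using B that l by (intro member_le_sum divide_nonneg_nonneg) (fastforce simp: less_imp_le)+
    then have "l j / (l j - 1) \<le> L" using that by (simp add: L2_def)
    then have "l j \<le> L * (l j - 1)" using l[OF that(1)] by (simp add: pos_divide_le_eq)
    then show ?thesis using l[OF that(1)] by (simp add: field_simps)
  qed
  \<comment> \<open>The first entry settles L <= L2 through n <= 1; the second gives K0 <= (1 - q) K
    for the source.\<close>
  define K where "K = max ((L2 + \<sigma>) powr \<kappa>) (K0 / (1 - q))"
  have K: "0 < K" "(L2 + \<sigma>) powr \<kappa> \<le> K" "K0 \<le> (1 - q) * K"
  proof -
    show 1: "(L2 + \<sigma>) powr \<kappa> \<le> K" by (simp add: K_def)
    have "0 < (L2 + \<sigma>) powr \<kappa>" using L2 \<sigma>C C by simp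
    then show "0 < K" using 1 by linarith
    have "K0 / (1 - q) \<le> K" by (simp add: K_def)
    then show "K0 \<le> (1 - q) * K" using q by (simp add: pos_divide_le_eq mult.commute)
  qed
  \<comment> \<open>The range starts at -C because (L - C) / l may be negative even for L >=
    0.\<close>
  have main: "\<forall>L. - C \<le> L \<and> L \<le> L2 + real k \<longrightarrow> n L \<le> K * (L + \<sigma>) powr (- \<kappa>)" for k
  proof (induction k)
    case 0
    show ?case
    proof (intro allI impI)
      fix L assume L: "- C \<le> L \<and> L \<le> L2 + real 0"
      have pos: "0 < L + \<sigma>" using L \<sigma>C by linarith
      have "(L + \<sigma>) powr \<kappa> \<le> (L2 + \<sigma>) powr \<kappa>" using L pos \<kappa> by (intro powr_mono2) auto
      then have "(L + \<sigma>) powr \<kappa> \<le> K" using K by linarith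
      then have "1 \<le> K * (L + \<sigma>) powr (- \<kappa>)" using pos by (simp add: powr_minus field_simps)
      then show "n L \<le> K * (L + \<sigma>) powr (- \<kappa>)" using n1[of L] by linarith
    qed
  next
    case (Suc k)
    show ?case
    proof (intro allI impI)
      fix L assume L: "- C \<le> L \<and> L \<le> L2 + real (Suc k)"
      show "n L \<le> K * (L + \<sigma>) powr (- \<kappa>)"
      proof (cases "L \<le> L2 + real k")
        case True
        then show ?thesis using Suc L by blast
      next
        case False
        then have LL: "L2 \<le> L" by simp
        have pos: "0 < L + \<sigma>" using L \<sigma>C by linarith
        have each: "n ((L - C) / l j) \<le> l j powr \<kappa> * (K * (L + \<sigma>) powr (- \<kappa>))" if j: "j \<in> B" for j
        proof -
          have lj: "1 < l j" by (rule l[OF j])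
          have "(L - C) / l j \<le> L / l j" using C lj by (intro divide_right_mono) auto
          then have u: "(L - C) / l j \<le> L2 + real k" using dec[OF j LL] L by simp
          have "- C * l j \<le> L - C" using LL L2 C lj mult_left_mono[of 1 "l j" C] by auto
          then have v: "- C \<le> (L - C) / l j" using lj by (simp add: pos_le_divide_eq)
          have "(L + \<sigma>) / l j \<le> (L - C + \<sigma> * l j) / l j"
            using \<sigma>(2)[OF j] lj by (intro divide_right_mono) (auto simp: algebra_simps)
          also have "\<dots> = (L - C) / l j + \<sigma>" using lj by (simp add: add_divide_distrib)
          finally have "(L + \<sigma>) / l j \<le> (L - C) / l j + \<sigma>" .
          moreover have "0 < (L + \<sigma>) / l j" using pos lj by simp
          ultimately have "((L - C) / l j + \<sigma>) powr (- \<kappa>) \<le> ((L + \<sigma>) / l j) powr (- \<kappa>)"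
            using \<kappa> by (intro powr_mono2') auto
          also have "\<dots> = l j powr \<kappa> * (L + \<sigma>) powr (- \<kappa>)" using pos lj by (simp add: powr_divide powr_minus field_simps)
          finally have "K * ((L - C) / l j + \<sigma>) powr (- \<kappa>) \<le> K * (l j powr \<kappa> * (L + \<sigma>) powr (- \<kappa>))"
            using K by (intro mult_left_mono) auto
          moreover have "n ((L - C) / l j) \<le> K * ((L - C) / l j + \<sigma>) powr (- \<kappa>)" using Suc u v by blast
          ultimately show ?thesis by (simp add: mult.left_commute)
        qed
        have "n L \<le> K0 * exp (- L) + (\<Sum>j\<in>B. p j * n ((L - C) / l j))" using LL L2 by (intro rec) auto
        also have "(\<Sum>j\<in>B. p j * n ((L - C) / l j)) \<le> (\<Sum>j\<in>B. p j * (l j powr \<kappa> * (K * (L + \<sigma>) powr (- \<kappa>))))"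
          using each p by (intro sum_mono mult_left_mono) auto
        also have "\<dots> = q * (K * (L + \<sigma>) powr (- \<kappa>))" by (simp add: q_def sum_distrib_right mult.assoc)
        also have "K0 * exp (- L) \<le> ((1 - q) * K) * (L + \<sigma>) powr (- \<kappa>)"
        proof -
          have "exp (- L) * (L + \<sigma>) powr \<kappa> \<le> 1" using L1[of L] LL L2 by simp
          then have "exp (- L) \<le> (L + \<sigma>) powr (- \<kappa>)" using pos by (simp add: powr_minus field_simps)
          then show ?thesis using K K0 q by (intro mult_mono) auto
        qed
        finally show ?thesis by (simp add: algebra_simps)
      qed
    qed
  qed
  show thesis
  proof (rule that[OF \<kappa>(1) K(1), of \<sigma>])
    show "0 < \<sigma>" using \<sigma>C C by simp
    fix L :: real assume L: "0 \<le> L"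
    obtain k where "L - L2 \<le> real k" using real_arch_simple by blast
    then show "n L \<le> K * (L + \<sigma>) powr (- \<kappa>)" using main[of k] L C by auto
  qed
qed

section \<open>Tails of the invariant density\<close>

text \<open>Iterating the recursion sums terms of order L^(-\<kappa>) along steps of length
  \<alpha>, which costs one power. The sum is avoided by a supersolution: K' L^(1-\<kappa>) drops by
  at least the bound for \<open>n\<close> in each step, so m - K' L^(1-\<kappa>) does not decrease
  along L + k \<alpha>, where \<open>m\<close> tends to 0.\<close>

lemma powr_tail_sum:
  fixes n m :: "real \<Rightarrow> real"
  assumes \<kappa>: "1 < \<kappa>" and \<alpha>: "0 < \<alpha>" and r: "1 \<le> r" and C: "0 \<le> C" and K: "0 < K" and \<sigma>: "0 < \<sigma>"
    and n: "\<And>L. 0 \<le> L \<Longrightarrow> n L \<le> K * (L + \<sigma>) powr (- \<kappa>)"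
    and rec: "\<And>L. m L \<le> n ((L - C) / r) + m (L + \<alpha>)"
    and lim: "\<And>L. (\<lambda>k. m (L + real k * \<alpha>)) \<longlonglongrightarrow> 0"
  obtains K' L1 where "0 < K'" "1 \<le> L1" "\<And>L. L1 \<le> L \<Longrightarrow> m L \<le> K' * L powr (1 - \<kappa>)"
proof -
  define L1 where "L1 = max 1 (2 * C)"
  define k1 where "k1 = K * (2 * r) powr \<kappa>"
  define k2 where "k2 = (\<kappa> - 1) * \<alpha> * (1 + \<alpha>) powr (- \<kappa>)"
  have k1: "0 < k1" and k2: "0 < k2" using K r \<kappa> \<alpha> by (auto simp: k1_def k2_def)
  have n1: "n ((L - C) / r) \<le> k1 * L powr (- \<kappa>)" if L: "L1 \<le> L" for L
  proof -
    have L': "1 \<le> L" "2 * C \<le> L" using L by (auto simp: L1_def)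
    have "L / (2 * r) \<le> (L - C) / r" using L' r by (simp add: field_simps)
    then have ge: "L / (2 * r) \<le> (L - C) / r + \<sigma>" using \<sigma> by simp
    have "0 \<le> (L - C) / r" using L' r C by simp
    then have "n ((L - C) / r) \<le> K * ((L - C) / r + \<sigma>) powr (- \<kappa>)" by (rule n)
    also have "\<dots> \<le> K * (L / (2 * r)) powr (- \<kappa>)"
      using K ge L' r \<kappa> by (intro mult_left_mono powr_mono2') auto
    also have "\<dots> = k1 * L powr (- \<kappa>)" using L' r by (simp add: k1_def powr_divide powr_minus field_simps)
    finally show ?thesis .
  qed
  \<comment> \<open>Mean value theorem; the intermediate point is at most (1 + \<alpha>) L because L
    >= 1.\<close>
  have gap: "k2 * L powr (- \<kappa>) \<le> L powr (1 - \<kappa>) - (L + \<alpha>) powr (1 - \<kappa>)" if L: "1 \<le> L" for L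
  proof -
    have "\<exists>z. L < z \<and> z < L + \<alpha> \<and> (L + \<alpha>) powr (1 - \<kappa>) - L powr (1 - \<kappa>) = (L + \<alpha> - L) * ((1 - \<kappa>) * z powr (1 - \<kappa> - 1))"
      using \<alpha> L by (intro MVT2) (auto intro!: derivative_eq_intros)
    then obtain z where z: "L < z" "z < L + \<alpha>" "(L + \<alpha>) powr (1 - \<kappa>) - L powr (1 - \<kappa>) = \<alpha> * ((1 - \<kappa>) * z powr (- \<kappa>))"
      by auto
    have "\<alpha> \<le> \<alpha> * L" using L \<alpha> by simp
    then have "z \<le> (1 + \<alpha>) * L" using z(2) by (simp add: algebra_simps)
    then have "((1 + \<alpha>) * L) powr (- \<kappa>) \<le> z powr (- \<kappa>)" using z L \<kappa> by (intro powr_mono2') auto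
    then have "\<alpha> * (\<kappa> - 1) * ((1 + \<alpha>) * L) powr (- \<kappa>) \<le> \<alpha> * (\<kappa> - 1) * z powr (- \<kappa>)"
      using \<alpha> \<kappa> by (intro mult_left_mono) auto
    moreover have "\<alpha> * (\<kappa> - 1) * ((1 + \<alpha>) * L) powr (- \<kappa>) = k2 * L powr (- \<kappa>)"
      using \<alpha> L by (simp add: k2_def powr_mult)
    ultimately show ?thesis using z(3) by (simp add: algebra_simps)
  qed
  define K' where "K' = k1 / k2"
  have K': "0 < K'" using k1 k2 by (simp add: K'_def)
  have step: "m L - K' * L powr (1 - \<kappa>) \<le> m (L + \<alpha>) - K' * (L + \<alpha>) powr (1 - \<kappa>)" if L: "L1 \<le> L" for L
  proof -
    have "k1 * L powr (- \<kappa>) = K' * (k2 * L powr (- \<kappa>))" using k2 by (simp add: K'_def)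
    also have "\<dots> \<le> K' * (L powr (1 - \<kappa>) - (L + \<alpha>) powr (1 - \<kappa>))"
      using K' L by (intro mult_left_mono gap) (auto simp: L1_def)
    finally have "k1 * L powr (- \<kappa>) \<le> K' * L powr (1 - \<kappa>) - K' * (L + \<alpha>) powr (1 - \<kappa>)" by (simp add: right_diff_distrib)
    then show ?thesis using n1[OF L] rec[of L] by linarith
  qed
  have iter: "m L - K' * L powr (1 - \<kappa>) \<le> m (L + real k * \<alpha>)" if L: "L1 \<le> L" for L k
  proof -
    have "m L - K' * L powr (1 - \<kappa>) \<le> m (L + real k * \<alpha>) - K' * (L + real k * \<alpha>) powr (1 - \<kappa>)"
    proof (induction k)
      case (Suc k)
      have "L1 \<le> L + real k * \<alpha>" using L \<alpha> by (simp add: add_increasing2)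
      from step[OF this] show ?case using Suc by (simp add: algebra_simps)
    qed simp
    moreover have "0 \<le> K' * (L + real k * \<alpha>) powr (1 - \<kappa>)" using K' by simp
    ultimately show ?thesis by linarith
  qed
  show thesis
  proof (rule that[OF K', of L1])
    show "1 \<le> L1" by (simp add: L1_def)
    fix L assume L: "L1 \<le> L"
    have "m L - K' * L powr (1 - \<kappa>) \<le> 0" by (rule LIMSEQ_le_const[OF lim]) (use iter[OF L] in auto)
    then show "m L \<le> K' * L powr (1 - \<kappa>)" by simp
  qed
qed

section \<open>Mass of \<open>w\<close> near c and near the endpoints\<close>

context random_map
begin

lemma finite_nu_w: "finite_measure (nu w)"
proof (rule finite_measureI)
  show "emeasure (nu w) (space (nu w)) \<noteq> \<infinity>" using mass_w by (auto simp: top_unique)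
qed

lemma measure_nu_w_le_1: "measure (nu w) X \<le> 1"
proof -
  interpret finite_measure "nu w" by (rule finite_nu_w)
  have "measure (nu w) X \<le> measure (nu w) (space (nu w))" by (rule bounded_measure)
  also have "\<dots> \<le> 1" using mass_w by (simp add: measure_def enn2real_leI)
  finally show ?thesis .
qed

lemma measure_nu_w_mono:
  assumes "X \<in> sets borel" "Y \<in> sets borel" "X \<inter> U \<subseteq> Y"
  shows "measure (nu w) X \<le> measure (nu w) Y"
proof -
  interpret finite_measure "nu w" by (rule finite_nu_w)
  show ?thesis
    by (rule finite_measure_mono_AE) (use AE_nu_U[OF adm_w] assms in \<open>auto elim!: eventually_mono\<close>)
qed

lemma measure_stationary_w:
  assumes X: "X \<in> sets borel"
  shows "measure (nu w) X = (\<Sum>j\<in>G \<union> B. p j * measure (nu w) (T j -` X))"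
proof -
  interpret finite_measure "nu w" by (rule finite_nu_w)
  have "ennreal (measure (nu w) X) = (\<Sum>j\<in>G \<union> B. ennreal (p j) * ennreal (measure (nu w) (T j -` X)))"
    using stationary_w[OF X] by (simp add: emeasure_eq_measure)
  also have "\<dots> = ennreal (\<Sum>j\<in>G \<union> B. p j * measure (nu w) (T j -` X))"
    using p_pos by (subst sum_ennreal[symmetric]) (auto simp: ennreal_mult less_imp_le intro!: sum.cong)
  finally show ?thesis
    using p_pos by (subst (asm) ennreal_inj) (auto intro!: sum_nonneg mult_nonneg_nonneg simp: less_imp_le)
qed

definition nD :: "real \<Rightarrow> real" where "nD L = measure (nu w) {x \<in> U. L < D x}"
definition nE :: "real \<Rightarrow> real" where "nE L = measure (nu w) {x \<in> U. L < E x}"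

lemma nD_set[measurable]: "{x \<in> U. L < D x} \<in> sets borel" and nE_set[measurable]: "{x \<in> U. L < E x} \<in> sets borel"
  by measurable

text \<open>For \<open>L\<close> at least -ln \<open>gap\<close> the neighbourhood of
  \<open>c\<close> lies within \<open>gap\<close>, so good maps contribute at most 4 /
  \<open>gap\<close> times its length 2 exp(-L). For bad maps \<open>bad_c\<close> turns closeness
  of the image to \<open>c\<close> into closeness of the point.\<close>

lemma nD_recursion:
  assumes L: "max 0 (- ln gap) \<le> L"
  shows "nD L \<le> (8 / gap) * exp (- L) + (\<Sum>j\<in>B. p j * nD ((L - C) / l j))"
proof -
  interpret finite_measure "nu w" by (rule finite_nu_w)
  let ?X = "{x \<in> U. L < D x}"
  have good: "measure (nu w) (T j -` ?X) \<le> (8 / gap) * exp (- L)" if j: "j \<in> G" for j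
  proof -
    have sub: "?X \<subseteq> {c - exp (- L)<..<c + exp (- L)}"
    proof
      fix x assume "x \<in> ?X"
      then have x: "x \<noteq> c" "ln \<bar>x - c\<bar> < - L" using U_D[of x] by (auto simp: D_def)
      then have "\<bar>x - c\<bar> < exp (- L)" by (metis exp_less_cancel_iff exp_ln right_minus_eq zero_less_abs_iff)
      then show "x \<in> {c - exp (- L)<..<c + exp (- L)}" by auto
    qed
    have "emeasure (nu w) (T j -` ?X) = (\<integral>\<^sup>+x. indicator (T j -` ?X) x \<partial>nu w)"
      using vimage_T[of j ?X] j by simp
    also have "\<dots> = (\<integral>\<^sup>+x. indicator ?X (T j x) \<partial>nu w)"
      by (intro nn_integral_cong) (auto split: split_indicator)
    also have "\<dots> \<le> ennreal (4 / gap) * (\<integral>\<^sup>+x. indicator ?X x \<partial>lborel)"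
    proof (rule good_near_c[OF j adm_w mass_w])
      fix x assume "gap \<le> \<bar>x - c\<bar>"
      then have "ln gap \<le> ln \<bar>x - c\<bar>" using gap_pos by (intro ln_mono) auto
      then show "indicator ?X x = (0::ennreal)" using L by (auto simp: D_def)
    qed simp
    also have "(\<integral>\<^sup>+x. indicator ?X x \<partial>lborel) = emeasure lborel ?X" by (rule nn_integral_indicator) simp
    also have "ennreal (4 / gap) * emeasure lborel ?X \<le> ennreal (4 / gap) * emeasure lborel {c - exp (- L)<..<c + exp (- L)}"
      by (intro mult_left_mono emeasure_mono sub) auto
    also have "\<dots> = ennreal ((8 / gap) * exp (- L))"
      using gap_pos by (simp add: ennreal_mult[symmetric])
    finally show ?thesis using gap_pos by (simp add: emeasure_eq_measure)
  qed
  have bad': "measure (nu w) (T j -` ?X) \<le> nD ((L - C) / l j)" if j: "j \<in> B" for j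
    unfolding nD_def
  proof (rule measure_nu_w_mono)
    show "T j -` ?X \<in> sets borel" using vimage_T[of j ?X] j by simp
    show "T j -` ?X \<inter> U \<subseteq> {x \<in> U. (L - C) / l j < D x}"
    proof
      fix x assume x: "x \<in> T j -` ?X \<inter> U"
      then have "L < C + l j * D x" using bad_c[OF j, of x] by (auto simp: U_def D_def)
      then show "x \<in> {x \<in> U. (L - C) / l j < D x}" using x l[OF j] by (auto simp: pos_divide_less_eq mult.commute)
    qed
  qed simp
  have "nD L = (\<Sum>j\<in>G \<union> B. p j * measure (nu w) (T j -` ?X))" unfolding nD_def by (rule measure_stationary_w) simp
  also have "\<dots> = (\<Sum>j\<in>G. p j * measure (nu w) (T j -` ?X)) + (\<Sum>j\<in>B. p j * measure (nu w) (T j -` ?X))"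
    using finite disj by (rule sum.union_disjoint)
  also have "(\<Sum>j\<in>G. p j * measure (nu w) (T j -` ?X)) \<le> (\<Sum>j\<in>G. p j * ((8 / gap) * exp (- L)))"
    using good p_pos by (intro sum_mono mult_left_mono) (auto simp: less_imp_le)
  also have "\<dots> \<le> 1 * ((8 / gap) * exp (- L))"
    unfolding sum_distrib_right[symmetric] using p_le[of G] gap_pos by (intro mult_right_mono) auto
  also have "(\<Sum>j\<in>B. p j * measure (nu w) (T j -` ?X)) \<le> (\<Sum>j\<in>B. p j * nD ((L - C) / l j))"
    using bad' p_pos by (intro sum_mono mult_left_mono) (auto simp: less_imp_le)
  finally show ?thesis by simp
qed

text \<open>A point whose image is near {0,1} either lies in the repelling zone, and is then closer
  to {0,1} by the factor \<open>a\<close>, or lies outside it, and is then close to \<open>c\<close>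
  by \<open>inner_edge\<close>.\<close>

lemma nE_recursion: "nE L \<le> nD ((L - C) / r) + nE (L + ln a)"
proof -
  interpret finite_measure "nu w" by (rule finite_nu_w)
  let ?X = "{x \<in> U. L < E x}"
  have "measure (nu w) (T j -` ?X) \<le> nD ((L - C) / r) + nE (L + ln a)" if j: "j \<in> G \<union> B" for j
  proof -
    have "measure (nu w) (T j -` ?X) \<le> measure (nu w) ({x \<in> U. (L - C) / r < D x} \<union> {x \<in> U. L + ln a < E x})"
    proof (rule measure_nu_w_mono)
      show "T j -` ?X \<in> sets borel" using vimage_T[OF j, of ?X] by simp
      show "T j -` ?X \<inter> U \<subseteq> {x \<in> U. (L - C) / r < D x} \<union> {x \<in> U. L + ln a < E x}"
      proof
        fix x assume x: "x \<in> T j -` ?X \<inter> U"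
        then have xU: "x \<in> U" and E: "L < E (T j x)" by auto
        note u = U_D[OF xU]
        have ex: "0 < edge x" using u by (simp add: edge_def)
        show "x \<in> {x \<in> U. (L - C) / r < D x} \<union> {x \<in> U. L + ln a < E x}"
        proof (cases "edge x < \<eta>")
          case True
          then have "ln (a * edge x) \<le> ln (edge (T j x))"
            using repel[OF j, of x] u ex a by (intro ln_mono) auto
          then have "L + ln a < E x" using E ex a by (simp add: E_def ln_mult)
          then show ?thesis using xU by simp
        next
          case False
          then have "L < C + r * D x" using inner_edge[OF j, of x] xU E by (auto simp: U_def D_def E_def)
          then have "(L - C) / r < D x" using r by (simp add: pos_divide_less_eq mult.commute)
          then show ?thesis using xU by simp
        qed
      qed
    qed simp
    also have "\<dots> \<le> nD ((L - C) / r) + nE (L + ln a)"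
      unfolding nD_def nE_def by (rule measure_Un_le) simp_all
    finally show ?thesis .
  qed
  then have "(\<Sum>j\<in>G \<union> B. p j * measure (nu w) (T j -` ?X)) \<le> (\<Sum>j\<in>G \<union> B. p j * (nD ((L - C) / r) + nE (L + ln a)))"
    using p_pos by (intro sum_mono mult_left_mono) (auto simp: less_imp_le)
  also have "\<dots> = nD ((L - C) / r) + nE (L + ln a)" using p_sum by (simp add: sum_distrib_right[symmetric])
  finally show ?thesis using measure_stationary_w[of ?X] by (simp add: nE_def)
qed

text \<open>Continuity from above: \<open>E x\<close> is a real number, so no point lies in all of
  these sets.\<close>

lemma nE_lim: "(\<lambda>k. nE (L + real k * ln a)) \<longlonglongrightarrow> 0"
proof -
  interpret finite_measure "nu w" by (rule finite_nu_w)
  have la: "0 < ln a" using a by simp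
  let ?S = "\<lambda>k. {x \<in> U. L + real k * ln a < E x}"
  have "(\<lambda>k. measure (nu w) (?S k)) \<longlonglongrightarrow> measure (nu w) (\<Inter>k. ?S k)"
  proof (rule finite_Lim_measure_decseq)
    show "decseq ?S"
    proof (rule decseq_SucI)
      fix k have "L + real k * ln a \<le> L + real (Suc k) * ln a" using la by simp
      then show "?S (Suc k) \<subseteq> ?S k" by auto
    qed
  qed auto
  moreover have "(\<Inter>k. ?S k) = {}"
  proof (rule ccontr)
    assume "(\<Inter>k. ?S k) \<noteq> {}"
    then obtain x where x: "\<And>k. L + real k * ln a < E x" by auto
    obtain k where "E x - L < real k * ln a" using reals_Archimedean3[OF la] by blast
    then show False using x[of k] by simp
  qed
  ultimately show ?thesis by (simp add: nE_def)
qed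

text \<open>Write the Lebesgue measure of \<open>X\<close> as exp(-2L) and cut at distance exp(-L)
  from 0, \<open>c\<close> and 1. Off these neighbourhoods w <= 4 exp L, so that part of
  \<open>X\<close> has mass at most 4 exp(-L); the neighbourhoods themselves are bounded by
  \<open>nD L\<close> and \<open>nE L\<close>, and the latter sets the rate L^(1-\<kappa>).\<close>

lemma nu_w_log_bound:
  obtains K \<kappa> where "0 < K" "0 < \<kappa>"
    "\<And>X. X \<in> sets borel \<Longrightarrow> X \<subseteq> {0..1} \<Longrightarrow> 0 < measure lborel X \<Longrightarrow> measure lborel X < 1 \<Longrightarrow>
      emeasure (nu w) X \<le> ennreal (K * (1 / (ln (1 / measure lborel X)) powr \<kappa>))"
proof -
  interpret finite_measure "nu w" by (rule finite_nu_w)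
  have pB: "0 \<le> p j" if "j \<in> B" for j using p_pos[of j] that by auto
  have g8: "0 \<le> 8 / gap" using gap_pos by simp
  obtain \<kappa> K \<sigma> where \<kappa>: "1 < \<kappa>" and K: "0 < K" and \<sigma>: "0 < \<sigma>" and nD: "\<And>L. 0 \<le> L \<Longrightarrow> nD L \<le> K * (L + \<sigma>) powr (- \<kappa>)"
  proof (rule log_tail_recursion[of B p l C "8 / gap" nD "max 0 (- ln gap)"])
    show "nD L \<le> 1" for L unfolding nD_def by (rule measure_nu_w_le_1)
    show "nD L \<le> 8 / gap * exp (- L) + (\<Sum>j\<in>B. p j * nD ((L - C) / l j))" if "max 0 (- ln gap) \<le> L" for L
      by (rule nD_recursion[OF that])
    show "finite B" by (rule finite)
    show "0 \<le> C" by (rule C)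
    show "0 \<le> 8 / gap" by (rule g8)
  qed (use pB l theta that in auto)
  obtain K' L1 where K': "0 < K'" and L1: "1 \<le> L1" and nE: "\<And>L. L1 \<le> L \<Longrightarrow> nE L \<le> K' * L powr (1 - \<kappa>)"
  proof (rule powr_tail_sum[OF \<kappa> _ r C K \<sigma> nD nE_recursion nE_lim])
    show "0 < ln a" using a by simp
  qed (use that in auto)
  have "((\<lambda>L::real. exp (- L) / L powr (1 - \<kappa>)) \<longlongrightarrow> 0) at_top" by real_asymp
  then have "\<forall>\<^sub>F L in at_top. exp (- L) / L powr (1 - \<kappa>) < 1" by (rule order_tendstoD) simp
  then obtain L2 where L2: "\<And>L. L2 \<le> L \<Longrightarrow> exp (- L) / L powr (1 - \<kappa>) < 1"
    unfolding eventually_at_top_linorder by blast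
  define L3 where "L3 = max L1 L2"
  have L3: "L1 \<le> L3" "L2 \<le> L3" "1 \<le> L3" using L1 by (auto simp: L3_def)
  \<comment> \<open>The three summands belong to \<open>nD\<close>, \<open>nE\<close> and the bulk,
    valid for L >= L3; the second entry makes the bound at least 1, hence trivial, for smaller
    \<open>L\<close>.\<close>
  define K1 where "K1 = max (K + K' + 4) (L3 powr (\<kappa> - 1))"
  have K1: "0 < K1" "K + K' + 4 \<le> K1" "L3 powr (\<kappa> - 1) \<le> K1" using K K' by (auto simp: K1_def)
  have main: "measure (nu w) X \<le> K1 * L powr (1 - \<kappa>)"
    if X[measurable]: "X \<in> sets borel" and L: "0 < L" and X1: "emeasure lborel X = ennreal (exp (- (2 * L)))" for X L
  proof (cases "L3 \<le> L")
    case False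
    then have "L powr (\<kappa> - 1) \<le> L3 powr (\<kappa> - 1)" using L \<kappa> by (intro powr_mono2) auto
    then have "L powr (\<kappa> - 1) \<le> K1" using K1 by linarith
    then have "1 \<le> K1 * L powr (1 - \<kappa>)"
      using powr_minus_divide[of L "\<kappa> - 1"] L by (simp add: pos_le_divide_eq)
    then show ?thesis using measure_nu_w_le_1[of X] by linarith
  next
    case True
    let ?Y = "{x \<in> U. D x \<le> L \<and> E x \<le> L}"
    have Y[measurable]: "?Y \<in> sets borel" by measurable
    have "measure (nu w) X \<le> measure (nu w) (({x \<in> U. L < D x} \<union> {x \<in> U. L < E x}) \<union> (X \<inter> ?Y))"
      by (rule measure_nu_w_mono) auto
    also have "\<dots> \<le> measure (nu w) ({x \<in> U. L < D x} \<union> {x \<in> U. L < E x}) + measure (nu w) (X \<inter> ?Y)"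
      by (rule measure_Un_le) simp_all
    also have "measure (nu w) ({x \<in> U. L < D x} \<union> {x \<in> U. L < E x}) \<le> nD L + nE L"
      unfolding nD_def nE_def by (rule measure_Un_le) simp_all
    also have "measure (nu w) (X \<inter> ?Y) \<le> 4 * exp (- L)"
    proof -
      have "emeasure (nu w) (X \<inter> ?Y) = (\<integral>\<^sup>+x. indicator U x * ennreal (w x) * indicator (X \<inter> ?Y) x \<partial>lborel)"
        using nn_integral_nu[OF adm_w, of "indicator (X \<inter> ?Y)"] by simp
      also have "\<dots> \<le> (\<integral>\<^sup>+x. ennreal (4 * exp L) * indicator X x \<partial>lborel)"
      proof (rule nn_integral_mono)
        fix x
        show "indicator U x * ennreal (w x) * indicator (X \<inter> ?Y) x \<le> ennreal (4 * exp L) * indicator X x"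
        proof (cases "x \<in> X \<inter> ?Y")
          case True
          then have xU: "x \<in> U" and DE: "D x \<le> L" "E x \<le> L" by auto
          note u = U_D[OF xU]
          have pos: "0 < edge x" "0 < \<bar>x - c\<bar>" using u by (auto simp: edge_def)
          moreover have "- L \<le> ln (edge x)" "- L \<le> ln \<bar>x - c\<bar>" using DE by (auto simp: D_def E_def)
          ultimately have "exp (- L) \<le> edge x" "exp (- L) \<le> \<bar>x - c\<bar>" by (simp_all add: ln_ge_iff)
          then have "exp (- L) \<le> min (edge x) \<bar>x - c\<bar>" by simp
          then have "bnd x \<le> 4 / exp (- L)" unfolding bnd_def using pos by (intro divide_left_mono) auto
          then have "w x \<le> 4 * exp L" using bnd(2)[OF adm_w mass_w xU] by (simp add: exp_minus field_simps)
          then show ?thesis using True by (auto intro: ennreal_leI)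
        qed auto
      qed
      also have "\<dots> = ennreal (4 * exp L) * ennreal (exp (- (2 * L)))"
        by (simp add: nn_integral_cmult_indicator X1)
      also have "\<dots> = ennreal (4 * exp (- L))" by (simp add: ennreal_mult[symmetric] exp_add[symmetric] mult.assoc)
      finally show ?thesis by (simp add: emeasure_eq_measure)
    qed
    also have "nD L \<le> K * L powr (1 - \<kappa>)"
    proof -
      have "nD L \<le> K * (L + \<sigma>) powr (- \<kappa>)" using L by (intro nD) simp
      also have "\<dots> \<le> K * L powr (- \<kappa>)" using K L \<sigma> \<kappa> by (intro mult_left_mono powr_mono2') auto
      also have "\<dots> \<le> K * L powr (1 - \<kappa>)" using K True L3 by (intro mult_left_mono powr_mono) auto
      finally show ?thesis .
    qed
    also have "nE L \<le> K' * L powr (1 - \<kappa>)" using True L3 by (intro nE) auto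
    also have "4 * exp (- L) \<le> 4 * L powr (1 - \<kappa>)" using L2[of L] True L3 L by (simp add: divide_less_eq)
    finally have "measure (nu w) X \<le> (K + K' + 4) * L powr (1 - \<kappa>)" by (simp add: algebra_simps)
    also have "\<dots> \<le> K1 * L powr (1 - \<kappa>)" using K1 by (intro mult_right_mono) auto
    finally show ?thesis .
  qed
  show thesis
  proof (rule that[of "K1 * 2 powr (\<kappa> - 1)" "\<kappa> - 1"])
    show "0 < K1 * 2 powr (\<kappa> - 1)" "0 < \<kappa> - 1" using K1 \<kappa> by auto
    fix X :: "real set" assume X: "X \<in> sets borel" "X \<subseteq> {0..1}" "0 < measure lborel X" "measure lborel X < 1"
    define L where "L = ln (1 / measure lborel X) / 2"
    have l2: "ln (1 / measure lborel X) = 2 * L" by (simp add: L_def)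
    have L: "0 < L" using X by (simp add: L_def)
    have "exp (- (2 * L)) = measure lborel X" using X unfolding l2[symmetric] by (simp add: ln_div)
    moreover have "emeasure lborel X < top"
      using emeasure_mono[OF X(2), of lborel] by (simp add: le_less_trans)
    ultimately have "emeasure lborel X = ennreal (exp (- (2 * L)))" by (simp add: emeasure_eq_ennreal_measure)
    from main[OF X(1) L this] have "measure (nu w) X \<le> K1 * L powr (1 - \<kappa>)" .
    also have "K1 * L powr (1 - \<kappa>) = K1 * 2 powr (\<kappa> - 1) * (1 / (2 * L) powr (\<kappa> - 1))"
    proof -
      have "1 - \<kappa> = - (\<kappa> - 1)" by simp
      then have "L powr (1 - \<kappa>) = 1 / L powr (\<kappa> - 1)" by (simp only: powr_minus_divide)
      then show ?thesis using L by (simp add: powr_mult)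
    qed
    finally show "emeasure (nu w) X \<le> ennreal (K1 * 2 powr (\<kappa> - 1) * (1 / (ln (1 / measure lborel X)) powr (\<kappa> - 1)))"
      unfolding l2 emeasure_eq_measure by (rule ennreal_leI)
  qed
qed

end

section \<open>Logarithmic bound\<close>

text \<open>A branch depends only on values in the open interval; this permits redefining the maps
  at \<open>c\<close> and outside (0,1).\<close>

lemma koebe_branch_cong:
  assumes T: "koebe_branch a b A B T" and eq: "\<And>x. x \<in> {a<..<b} \<Longrightarrow> T x = S x"
  shows "koebe_branch a b A B S"
proof -
  have d: "(S has_real_derivative deriv T x) (at x)" if x: "x \<in> {a<..<b}" for x
    by (rule has_field_derivative_transform_within_open[OF koebe_branch_deriv(1)[OF T x] _ x eq]) auto
  then have dS: "deriv S x = deriv T x" if "x \<in> {a<..<b}" for x using DERIV_imp_deriv that by blast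
  have im: "S ` {a<..<b} = T ` {a<..<b}" using eq by (intro image_cong) auto
  have fd: "S field_differentiable at x" if "x \<in> {a<..<b}" for x
    using d[OF that] by (auto simp: field_differentiable_def)
  show ?thesis
    using T im fd unfolding koebe_branch_def
    by (simp add: dS eq[symmetric] cong: conj_cong)
qed

lemma maps_log_estimates:
  assumes c: "0 < c" "c < 1" and T: "T \<in> good_maps c \<union> bad_maps c"
    and l: "T \<in> bad_maps c \<Longrightarrow> bad_exponent c T l" and \<eta>: "0 < \<eta>"
  obtains r C where "1 \<le> r" "0 \<le> C"
    "\<And>x. x \<in> {0<..<c} \<union> {c<..<1} \<Longrightarrow> \<eta> \<le> edge x \<Longrightarrow> - ln (edge (T x)) \<le> C + r * - ln \<bar>x - c\<bar>"
    "\<And>x. T \<in> bad_maps c \<Longrightarrow> x \<in> {0<..<c} \<union> {c<..<1} \<Longrightarrow> \<eta> \<le> edge x \<Longrightarrow> - ln \<bar>T x - c\<bar> \<le> C + l * - ln \<bar>x - c\<bar>"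
proof -
  have log: "- ln y \<le> \<bar>ln k\<bar> + r * - ln \<bar>x - c\<bar>"
    if "0 < k" "k * \<bar>x - c\<bar> powr r \<le> y" "x \<noteq> c" for k r x y :: real
  proof -
    have "ln (k * \<bar>x - c\<bar> powr r) \<le> ln y" using that by (intro ln_mono) auto
    then show ?thesis using that by (simp add: ln_mult ln_powr)
  qed
  show thesis
  proof (cases "T \<in> good_maps c")
    case True
    obtain k r where k: "0 < k" "1 \<le> r" and "\<forall>x\<in>{0<..<c} \<union> {c<..<1}. \<eta> \<le> edge x \<longrightarrow> k * \<bar>x - c\<bar> powr r \<le> edge (T x)"
      using good_maps_away_from_edge[OF c True \<eta>] by blast
    moreover have "T \<notin> bad_maps c" by (rule good_bad_disjoint[OF c True])
    ultimately show thesis by (intro that[of r "\<bar>ln k\<bar>"] log) auto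
  next
    case False
    then have b: "T \<in> bad_maps c" using T by simp
    obtain k where k: "0 < k" "\<forall>x\<in>{0<..<c} \<union> {c<..<1}. \<eta> \<le> edge x \<longrightarrow>
        k * \<bar>x - c\<bar> powr l \<le> edge (T x) \<and> k * \<bar>x - c\<bar> powr l \<le> \<bar>T x - c\<bar>"
      using bad_maps_away_from_edge[OF c b l[OF b] \<eta>] by blast
    moreover have "1 \<le> l" using l[OF b] by (simp add: bad_exponent_def)
    ultimately show thesis by (intro that[of l "\<bar>ln k\<bar>"] log) auto
  qed
qed

text \<open>The maps are arbitrary outside [0,1], so they are replaced by 0 off the two open
  branches to obtain Borel functions on the line. The constants of the finitely many maps are then
  made uniform.\<close>

lemma random_map_exists:
  fixes c :: real and N :: nat and T :: "nat \<Rightarrow> real \<Rightarrow> real" and p l :: "nat \<Rightarrow> real"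
  assumes c: "0 < c" "c < 1"
    and maps: "\<And>j. j \<in> {1..N} \<Longrightarrow> T j \<in> good_maps c \<union> bad_maps c"
    and G: "Sigma_G c N T \<noteq> {}"
    and p: "positive_prob_vector N p"
    and l: "\<And>b. b \<in> Sigma_B c N T \<Longrightarrow> bad_exponent c (T b) (l b)"
    and theta: "(\<Sum>b\<in>Sigma_B c N T. p b * l b) < 1"
  shows "\<exists>a \<eta> C r. random_map c (Sigma_G c N T) (Sigma_B c N T)
    (\<lambda>j x. if x \<in> {0<..<c} \<union> {c<..<1} then T j x else 0) p l a \<eta> C r"
proof -
  let ?G = "Sigma_G c N T" and ?B = "Sigma_B c N T" and ?U = "{0<..<c} \<union> {c<..<1}"
  have GB: "?G \<union> ?B = {1..N}" using maps unfolding Sigma_G_def Sigma_B_def by blast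
  have N: "{1..N} \<noteq> {}" using G by (auto simp: Sigma_G_def)
  \<comment> \<open>\<open>edge c\<close> is 2 \<delta> and \<open>edge\<close> is 1-Lipschitz, so
    \<open>edge y\<close> < \<delta> forces |y - c| >= \<delta>.\<close>
  define \<delta> where "\<delta> = min c (1 - c) / 2"
  have \<delta>: "0 < \<delta>" using c by (simp add: \<delta>_def)
  have "\<forall>j\<in>{1..N}. \<exists>a. 1 < a \<and> (\<forall>\<^sub>F \<eta> in at_right 0. \<forall>x\<in>{0<..<1}. edge x < \<eta> \<longrightarrow> a * edge x \<le> edge (T j x) \<and> edge (T j x) < \<delta>)"
    using maps_edge_repelling[OF c maps \<delta>] by blast
  from bchoice[OF this] obtain aj where aj: "\<forall>j\<in>{1..N}. 1 < aj j \<and>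
      (\<forall>\<^sub>F \<eta> in at_right 0. \<forall>x\<in>{0<..<1}. edge x < \<eta> \<longrightarrow> aj j * edge x \<le> edge (T j x) \<and> edge (T j x) < \<delta>)" ..
  define a where "a = Min (aj ` {1..N})"
  have a: "1 < a" using aj N by (auto simp: a_def)
  have a_le: "a \<le> aj j" if "j \<in> {1..N}" for j using that by (auto simp: a_def)
  have "\<forall>\<^sub>F \<eta> in at_right 0. (\<forall>j\<in>{1..N}. \<forall>x\<in>{0<..<1}. edge x < \<eta> \<longrightarrow> aj j * edge x \<le> edge (T j x) \<and> edge (T j x) < \<delta>)
      \<and> \<eta> \<in> {0<..<min c (1 - c)}"
    using aj c by (intro eventually_conj eventually_ball_finite eventually_at_right_real) auto
  \<comment> \<open>\<eta> below \<open>min c (1 - c)\<close> keeps \<open>c\<close> out of the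
    repelling zone.\<close>
  then obtain \<eta> where \<eta>: "0 < \<eta>" "\<eta> < min c (1 - c)" and
    near: "\<And>j x. j \<in> {1..N} \<Longrightarrow> x \<in> {0<..<1} \<Longrightarrow> edge x < \<eta> \<Longrightarrow> aj j * edge x \<le> edge (T j x) \<and> edge (T j x) < \<delta>"
    by (auto dest!: eventually_happens'[OF trivial_limit_at_right_real])
  have ex: "\<exists>r C. 1 \<le> r \<and> 0 \<le> C \<and> (\<forall>x\<in>?U. \<eta> \<le> edge x \<longrightarrow> - ln (edge (T j x)) \<le> C + r * - ln \<bar>x - c\<bar>) \<and>
      (j \<in> ?B \<longrightarrow> (\<forall>x\<in>?U. \<eta> \<le> edge x \<longrightarrow> - ln \<bar>T j x - c\<bar> \<le> C + l j * - ln \<bar>x - c\<bar>))" if j: "j \<in> {1..N}" for j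
  proof (rule maps_log_estimates[OF c maps[OF j] _ \<eta>(1), of "l j"])
    show "bad_exponent c (T j) (l j)" if "T j \<in> bad_maps c" using l[of j] that j by (simp add: Sigma_B_def)
  next
    fix r C assume "1 \<le> r" "0 \<le> C"
      "\<And>x. x \<in> ?U \<Longrightarrow> \<eta> \<le> edge x \<Longrightarrow> - ln (edge (T j x)) \<le> C + r * - ln \<bar>x - c\<bar>"
      "\<And>x. T j \<in> bad_maps c \<Longrightarrow> x \<in> ?U \<Longrightarrow> \<eta> \<le> edge x \<Longrightarrow> - ln \<bar>T j x - c\<bar> \<le> C + l j * - ln \<bar>x - c\<bar>"
    then show ?thesis by (intro exI[of _ r] exI[of _ C]) (simp add: Sigma_B_def)
  qed
  define Q where "Q j r C \<longleftrightarrow> 1 \<le> r \<and> 0 \<le> C \<and> (\<forall>x\<in>?U. \<eta> \<le> edge x \<longrightarrow> - ln (edge (T j x)) \<le> C + r * - ln \<bar>x - c\<bar>) \<and>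
      (j \<in> ?B \<longrightarrow> (\<forall>x\<in>?U. \<eta> \<le> edge x \<longrightarrow> - ln \<bar>T j x - c\<bar> \<le> C + l j * - ln \<bar>x - c\<bar>))" for j r C
  have "\<forall>j\<in>{1..N}. \<exists>rC. Q j (fst rC) (snd rC)" using ex unfolding Q_def[symmetric] by simp
  from bchoice[OF this] obtain rC' where rC': "\<forall>j\<in>{1..N}. Q j (fst (rC' j)) (snd (rC' j))" ..
  define rj Cj where "rj j = fst (rC' j)" and "Cj j = snd (rC' j)" for j
  have rC: "\<And>j. j \<in> {1..N} \<Longrightarrow> 1 \<le> rj j \<and> 0 \<le> Cj j \<and>
      (\<forall>x\<in>?U. \<eta> \<le> edge x \<longrightarrow> - ln (edge (T j x)) \<le> Cj j + rj j * - ln \<bar>x - c\<bar>) \<and>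
      (j \<in> ?B \<longrightarrow> (\<forall>x\<in>?U. \<eta> \<le> edge x \<longrightarrow> - ln \<bar>T j x - c\<bar> \<le> Cj j + l j * - ln \<bar>x - c\<bar>))"
    using rC' unfolding Q_def rj_def Cj_def by blast
  define r where "r = 1 + (\<Sum>j\<in>{1..N}. rj j)"
  define C where "C = \<bar>ln \<delta>\<bar> + (\<Sum>j\<in>{1..N}. Cj j)"
  have r_ge: "rj j \<le> r" and C_ge: "Cj j \<le> C" if "j \<in> {1..N}" for j
  proof -
    have "rj j \<le> (\<Sum>j\<in>{1..N}. rj j)" using that rC by (intro member_le_sum) force+
    then show "rj j \<le> r" by (simp add: r_def)
    have "Cj j \<le> (\<Sum>j\<in>{1..N}. Cj j)" using that rC by (intro member_le_sum) auto
    then show "Cj j \<le> C" by (simp add: C_def)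
  qed
  have "0 \<le> (\<Sum>j\<in>{1..N}. rj j)" "0 \<le> (\<Sum>j\<in>{1..N}. Cj j)" using rC by (force intro: sum_nonneg)+
  then have r: "1 \<le> r" and C: "0 \<le> C" "\<bar>ln \<delta>\<bar> \<le> C" by (auto simp: r_def C_def)
  have D0: "0 \<le> - ln \<bar>x - c\<bar>" if "x \<in> ?U" for x using that c by auto
  have off_c: "- ln \<bar>y - c\<bar> \<le> C" if "edge y < \<delta>" for y
  proof -
    have "\<delta> \<le> \<bar>y - c\<bar>" using that unfolding edge_def \<delta>_def by (auto simp: min_def abs_if split: if_splits)
    then have "ln \<delta> \<le> ln \<bar>y - c\<bar>" using \<delta> by (intro ln_mono) auto
    then show ?thesis using C by simp
  qed
  have edge_U: "x \<in> ?U" if "x \<in> {0<..<1}" "edge x < \<eta>" for x using that \<eta> by (cases "x = c") (auto simp: edge_def)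
  have l1: "1 < l j" if "j \<in> ?B" for j using l[OF that] by (simp add: bad_exponent_def)
  let ?S = "\<lambda>j x. if x \<in> ?U then T j x else 0"
  have cong: "koebe_branch 0 c s t (?S j)" "koebe_branch c 1 s' t' (?S j)"
    if "koebe_branch 0 c s t (T j)" "koebe_branch c 1 s' t' (T j)" for s t s' t' j
    by (rule koebe_branch_cong[OF that(1)], simp, rule koebe_branch_cong[OF that(2)], simp)
  have good_br: "koebe_branch 0 c 0 1 (T j)" "koebe_branch c 1 0 1 (T j)" if "j \<in> ?G" for j
    using good_maps_branches[OF c] that by (auto simp: Sigma_G_def)
  have bad_br: "koebe_branch 0 c 0 c (T j) \<or> koebe_branch 0 c c 1 (T j)" "koebe_branch c 1 0 c (T j) \<or> koebe_branch c 1 c 1 (T j)" if "j \<in> ?B" for j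
    using bad_maps_branches[OF c] that by (auto simp: Sigma_B_def)
  have "random_map c ?G ?B ?S p l a \<eta> C r"
  proof
    show "?G \<inter> ?B = {}" using good_bad_disjoint[OF c] by (auto simp: Sigma_G_def Sigma_B_def)
    show "0 < p j" if "j \<in> ?G \<union> ?B" for j using that p unfolding GB positive_prob_vector_def by blast
    show "(\<Sum>j\<in>?G \<union> ?B. p j) = 1" using p unfolding GB positive_prob_vector_def by blast
    show "?S j \<in> borel_measurable borel" if j: "j \<in> ?G \<union> ?B" for j
    proof (rule borel_measurable_continuous_on_if)
      obtain s t s' t' where "koebe_branch 0 c s t (T j)" "koebe_branch c 1 s' t' (T j)" using good_br bad_br j by blast
      then show "continuous_on ?U (T j)" by (intro continuous_on_open_Un koebe_branch_continuous) auto
    qed auto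
    show "koebe_branch 0 c 0 1 (?S j)" "koebe_branch c 1 0 1 (?S j)" if "j \<in> ?G" for j
      using cong good_br[OF that] by blast+
    show "koebe_branch 0 c 0 c (?S j) \<or> koebe_branch 0 c c 1 (?S j)" "koebe_branch c 1 0 c (?S j) \<or> koebe_branch c 1 c 1 (?S j)"
      if "j \<in> ?B" for j using cong bad_br[OF that] by blast+
    show "a * edge x \<le> edge (?S j x)" if j: "j \<in> ?G \<union> ?B" and x: "x \<in> {0<..<1}" "edge x < \<eta>" for j x
    proof -
      have "a * edge x \<le> aj j * edge x" using a_le j x unfolding GB by (intro mult_right_mono) (auto simp: edge_def)
      then show ?thesis using near[of j x] edge_U[OF x] j x unfolding GB by auto
    qed
    show "- ln \<bar>?S j x - c\<bar> \<le> C" if "j \<in> ?G \<union> ?B" "x \<in> {0<..<1}" "edge x < \<eta>" for j x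
      using off_c near[of j x] edge_U[of x] that unfolding GB by auto
    show "- ln (edge (?S j x)) \<le> C + r * - ln \<bar>x - c\<bar>" if j: "j \<in> ?G \<union> ?B" and x: "x \<in> ?U" "\<eta> \<le> edge x" for j x
    proof -
      have "- ln (edge (T j x)) \<le> Cj j + rj j * - ln \<bar>x - c\<bar>" using rC[of j] j x unfolding GB by blast
      also have "\<dots> \<le> C + r * - ln \<bar>x - c\<bar>"
        using C_ge[of j] r_ge[of j] D0[OF x(1)] j unfolding GB by (intro add_mono mult_right_mono) auto
      finally show ?thesis using x by simp
    qed
    show "- ln \<bar>?S j x - c\<bar> \<le> C + l j * - ln \<bar>x - c\<bar>" if j: "j \<in> ?B" and x: "x \<in> ?U" for j x
    \<comment> \<open>In the repelling zone the image is far from \<open>c\<close>, and the term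
      with \<open>l j\<close> is nonnegative, so the bound holds there too.\<close>
    proof (cases "edge x < \<eta>")
      case True
      have "- ln \<bar>T j x - c\<bar> \<le> C" using off_c near[of j x] True x c j by (auto simp: Sigma_B_def)
      moreover have "0 \<le> l j * - ln \<bar>x - c\<bar>" using D0[OF x] l1[OF j] by (intro mult_nonneg_nonneg) auto
      ultimately show ?thesis using x by simp
    next
      case False
      have jN: "j \<in> {1..N}" using j by (simp add: Sigma_B_def)
      then have "- ln \<bar>T j x - c\<bar> \<le> Cj j + l j * - ln \<bar>x - c\<bar>" using rC[OF jN] j x False by (meson not_less)
      then show ?thesis using C_ge[OF jN] x by simp
    qed
  qed (use c G l1 theta a \<eta> r C in \<open>auto simp: Sigma_G_def Sigma_B_def\<close>)
  then show ?thesis by blast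
qed

theorem corollary1p1:
  fixes c :: real and N :: nat and T :: "nat \<Rightarrow> real \<Rightarrow> real"
    and p l :: "nat \<Rightarrow> real" and \<mu> :: "real measure"
  assumes "0 < c" and "c < 1"
    and "\<And>j. j \<in> {1..N} \<Longrightarrow> T j \<in> good_maps c \<union> bad_maps c"
    and "Sigma_G c N T \<noteq> {}" and "Sigma_B c N T \<noteq> {}"
    and "positive_prob_vector N p"
    and "\<And>b. b \<in> Sigma_B c N T \<Longrightarrow> bad_exponent c (T b) (l b)"
    and "(\<Sum>b\<in>Sigma_B c N T. p b * l b) < 1"
    and "stationary N p T \<mu>"
    and "sigma_finite_measure \<mu>"
    and "absolutely_continuous (restrict_space lborel {0..1}) \<mu>"
  shows "\<exists>K>0. \<exists>\<kappa>>0. \<forall>A\<in>sets borel. A \<subseteq> {0..1} \<longrightarrow>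
           0 < measure lborel A \<longrightarrow> measure lborel A < 1 \<longrightarrow>
           emeasure \<mu> A \<le> ennreal (K * (1 / (ln (1 / measure lborel A)) powr \<kappa>))"
proof -
  \<comment> \<open>Agrees with \<open>T j\<close> on both branches; inside [0,1] it can differ only
    at 0, \<open>c\<close> and 1, which an absolutely continuous measure does not see.\<close>
  define S where "S j x = (if x \<in> {0<..<c} \<union> {c<..<1} then T j x else 0)" for j x
  obtain a \<eta> C r where "random_map c (Sigma_G c N T) (Sigma_B c N T) S p l a \<eta> C r"
    using random_map_exists[OF assms(1-4,6-8)] unfolding S_def[abs_def] by blast
  then interpret random_map c "Sigma_G c N T" "Sigma_B c N T" S p l a \<eta> C r .
  have GB: "Sigma_G c N T \<union> Sigma_B c N T = {1..N}" using assms(3) unfolding Sigma_G_def Sigma_B_def by blast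
  have sets\<mu>: "sets \<mu> = sets (restrict_space borel {0..1})" using assms(9) by (simp add: stationary_def)
  have sets_iff: "X \<in> sets \<mu> \<longleftrightarrow> X \<in> sets borel \<and> X \<subseteq> {0..1}" for X
    unfolding sets\<mu> by (subst sets_restrict_space_iff) auto
  define M0 where "M0 = (restrict_space lborel {0..1} :: real measure)"
  interpret M0: sigma_finite_measure M0
    unfolding M0_def by (rule sigma_finite_measure_restrict_space) (auto intro: lborel.sigma_finite_measure_axioms)
  have "sets \<mu> = sets M0" unfolding sets\<mu> M0_def by (auto simp: sets_restrict_space)
  then obtain h0 where h0: "h0 \<in> borel_measurable M0" "density M0 h0 = \<mu>"
    using M0.Radon_Nikodym assms(11) unfolding M0_def by metis
  \<comment> \<open>Sigma-finiteness of \<mu> is used here: it makes the density finite almost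
    everywhere, as the comparison with all multiples of \<open>w\<close> requires.\<close>
  have h0_fin: "AE x in M0. h0 x \<noteq> \<infinity>"
    using M0.sigma_finite_iff_density_finite[OF h0(1)] h0(2) assms(10) by simp
  define h where "h x = h0 x * indicator {0..1} x" for x
  have h[measurable]: "h \<in> borel_measurable borel"
    using h0(1) unfolding h_def[abs_def] M0_def
    by (subst (asm) borel_measurable_restrict_space_iff_ennreal) auto
  have fin: "AE x in lborel. x \<in> U \<longrightarrow> h x \<noteq> \<infinity>"
  proof -
    have "AE x in lborel. x \<in> {0..1} \<longrightarrow> h0 x \<noteq> \<infinity>"
      using h0_fin unfolding M0_def by (subst (asm) AE_restrict_space_iff) auto
    then show ?thesis
    proof eventually_elim
      case (elim x)
      show ?case
      proof
        assume "x \<in> U"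
        then have "x \<in> {0..1}" using U_D[of x] by simp
        then show "h x \<noteq> \<infinity>" using elim by (simp add: h_def)
      qed
    qed
  qed
  define M where "M = density lborel (\<lambda>x. indicator U x * h x)"
  have M: "emeasure M X = (\<integral>\<^sup>+x. indicator U x * h x * indicator X x \<partial>lborel)" if "X \<in> sets borel" for X
    unfolding M_def using that by (subst emeasure_density) auto
  have \<mu>M: "emeasure \<mu> X = emeasure M X" if X: "X \<in> sets borel" "X \<subseteq> {0..1}" for X
  proof -
    have "emeasure \<mu> X = (\<integral>\<^sup>+x. h0 x * indicator X x \<partial>M0)"
      using h0 X \<open>sets \<mu> = sets M0\<close> sets_iff by (metis emeasure_density)
    also have "\<dots> = (\<integral>\<^sup>+x. h0 x * indicator X x * indicator {0..1} x \<partial>lborel)"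
      unfolding M0_def by (subst nn_integral_restrict_space) auto
    also have "\<dots> = emeasure M X"
      unfolding M[OF X(1)]
    proof (rule nn_integral_cong_AE)
      have "AE x in lborel. x \<noteq> 0 \<and> x \<noteq> 1 \<and> x \<noteq> c" using AE_lborel_singleton by (intro AE_conjI)
      then show "AE x in lborel. h0 x * indicator X x * indicator {0..1} x = indicator U x * h x * indicator X x"
        by eventually_elim (use X(2) in \<open>auto simp: h_def U_def split: split_indicator\<close>)
    qed
    finally show ?thesis .
  qed
  have MU: "emeasure M X = emeasure M (X \<inter> U)" if [measurable]: "X \<in> sets borel" for X
    by (simp add: M) (auto intro!: nn_integral_cong split: split_indicator)
  have T01: "T j x \<in> {0..1}" if "j \<in> {1..N}" "x \<in> {0..1}" for j x
  proof -
    have "T j ` {0..1} \<subseteq> {0..1}" using assms(3)[OF that(1)] by (auto simp only: good_maps_def bad_maps_def)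
    then show ?thesis using that(2) by blast
  qed
  \<comment> \<open>Stationarity is transported from \<open>T\<close> on [0,1] to \<open>S\<close>
    on the line, the preimages under \<open>T j\<close> and \<open>S j\<close> agreeing on
    \<open>U\<close>.\<close>
  have stat: "emeasure M X = (\<Sum>j\<in>Sigma_G c N T \<union> Sigma_B c N T. ennreal (p j) * emeasure M (S j -` X))"
    if X[measurable]: "X \<in> sets borel" for X
  proof -
    let ?X = "X \<inter> {0..1}"
    have U01: "U \<subseteq> {0..1}" using U_D by (auto simp: less_imp_le)
    have X': "?X \<in> sets \<mu>" using sets_iff by auto
    have "emeasure M X = emeasure M (?X \<inter> U)" using U01 by (subst MU) (auto intro!: arg_cong[where f = "emeasure M"])
    also have "\<dots> = emeasure \<mu> ?X" using MU[of ?X] by (simp add: \<mu>M)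
    also have "\<dots> = (\<Sum>j=1..N. ennreal (p j) * emeasure \<mu> (T j -` ?X \<inter> {0..1}))"
    proof -
      have "\<forall>A\<in>sets \<mu>. (\<Sum>j=1..N. ennreal (p j) * emeasure \<mu> (T j -` A \<inter> {0..1})) = emeasure \<mu> A"
        using assms(9) unfolding stationary_def by blast
      from bspec[OF this X'] show ?thesis by (rule sym)
    qed
    also have "\<dots> = (\<Sum>j=1..N. ennreal (p j) * emeasure M (S j -` X))"
    proof (intro sum.cong refl)
      fix j assume j: "j \<in> {1..N}"
      then have SX: "S j -` X \<in> sets borel" using vimage_T[of j X] X by (simp add: GB)
      let ?Y = "T j -` ?X \<inter> {0..1}"
      have YU: "?Y \<inter> U = S j -` X \<inter> U" using T01[OF j] U01 by (auto simp: S_def U_def)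
      \<comment> \<open>Measurability of the preimage under \<open>T j\<close> comes from that under
        \<open>S j\<close>, since the two differ by a subset of {0, c, 1}.\<close>
      have "?Y = (S j -` X \<inter> U) \<union> (?Y \<inter> {0, c, 1})" using YU by (auto simp: U_def)
      moreover have "?Y \<inter> {0, c, 1} \<in> sets borel" by (intro borel_closed finite_imp_closed) auto
      moreover have "S j -` X \<inter> U \<in> sets borel" using SX by auto
      ultimately have Y: "?Y \<in> sets borel" by (metis sets.Un)
      have "emeasure \<mu> ?Y = emeasure M ?Y" by (rule \<mu>M[OF Y]) auto
      also have "\<dots> = emeasure M (S j -` X)" using MU[OF Y] MU[OF SX] YU by simp
      finally show "ennreal (p j) * emeasure \<mu> ?Y = ennreal (p j) * emeasure M (S j -` X)" by simp
    qed
    finally show ?thesis by (simp add: GB)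
  qed
  obtain s where s: "0 < s" and hs: "AE x in lborel. x \<in> U \<longrightarrow> h x \<le> ennreal (s * w x)"
    using density_dominated[OF h fin stat[unfolded M_def]] by blast
  obtain K \<kappa> where K: "0 < K" and \<kappa>: "0 < \<kappa>" and bound:
    "\<And>X. X \<in> sets borel \<Longrightarrow> X \<subseteq> {0..1} \<Longrightarrow> 0 < measure lborel X \<Longrightarrow> measure lborel X < 1 \<Longrightarrow>
      emeasure (nu w) X \<le> ennreal (K * (1 / (ln (1 / measure lborel X)) powr \<kappa>))"
    by (rule nu_w_log_bound, rule that)
  have "emeasure \<mu> X \<le> ennreal (s * K * (1 / (ln (1 / measure lborel X)) powr \<kappa>))"
    if X[measurable]: "X \<in> sets borel" and X': "X \<subseteq> {0..1}" "0 < measure lborel X" "measure lborel X < 1" for X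
  proof -
    note [measurable] = adm_meas[OF adm_w]
    have "emeasure \<mu> X = (\<integral>\<^sup>+x. indicator U x * h x * indicator X x \<partial>lborel)" by (simp add: \<mu>M M X')
    also have "\<dots> \<le> (\<integral>\<^sup>+x. ennreal s * (indicator U x * ennreal (w x) * indicator X x) \<partial>lborel)"
    proof (rule nn_integral_mono_AE)
      show "AE x in lborel. indicator U x * h x * indicator X x \<le> ennreal s * (indicator U x * ennreal (w x) * indicator X x)"
        using hs by eventually_elim (use s w_liminf(2) in \<open>auto simp: ennreal_mult split: split_indicator\<close>)
    qed
    also have "\<dots> = ennreal s * (\<integral>\<^sup>+x. indicator U x * ennreal (w x) * indicator X x \<partial>lborel)"
      by (rule nn_integral_cmult) measurable
    also have "(\<integral>\<^sup>+x. indicator U x * ennreal (w x) * indicator X x \<partial>lborel) = emeasure (nu w) X"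
      using nn_integral_nu[OF adm_w, of "indicator X"] by simp
    also have "ennreal s * emeasure (nu w) X \<le> ennreal s * ennreal (K * (1 / (ln (1 / measure lborel X)) powr \<kappa>))"
      by (intro mult_left_mono bound X X') auto
    also have "\<dots> = ennreal (s * K * (1 / (ln (1 / measure lborel X)) powr \<kappa>))"
      using s K by (simp add: ennreal_mult[symmetric] mult.assoc)
    finally show ?thesis .
  qed
  moreover have "0 < s * K" using s K by simp
  ultimately show ?thesis using \<kappa> by blast
qed

end
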